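(* Assume that (a) $\theta\mapsto H^\alpha$ and $\theta\mapsto L_k^\beta$ ($k=1,\dots,r$) are once continuously differentiable on $\Theta$; (b) (identifiability) for every $\theta=(\alpha,\beta)\in\Theta$ with $\theta\neq\theta_0$ there is at least one $t\in[0,T]$ with $b(\mathbf L^\beta,\bar\rho_t^\theta)\neq b(\mathbf L^{\beta_0},\bar\rho_t^{\theta_0})$. Let $$\Phi_N(\theta)=\int_0^T h(t,\theta)\cdot d\overline{\mathbf Y}^N_t-\frac12\int_0^T\|h(t,\theta)\|_{\mathbb R^r}^2\,dt,\qquad \hat\theta_N=\operatorname{arg\,max}_{\theta\in\Theta}\Phi_N(\theta).$$ Then $\hat\theta_N\to\theta_0$ almost surely as $N\to\infty$.
   Context: Fix $T>0$ and integers $d,r,p\ge1$. Let $\Theta^\circ\subset\mathbb R^p$ be a bounded convex open set, $\Theta=\overline{\Theta^\circ}$ (compact), and let the true parameter $\theta_0=(\alpha_0,\beta_0)$ lie in $\Theta^\circ$. Each $\theta\in\Theta$ is written $\theta=(\alpha,\beta)$ with $\alpha,\beta$ vector-valued. For each $\theta$ there are given a self-adjoint matrix $H^\alpha\in M_d(\mathbb C)$ and matrices $L_1^\beta,\dots,L_r^\beta\in M_d(\mathbb C)$; $\mathbf L^\beta=(L_1^\beta,\dots,L_r^\beta)$. "$\ell$-times continuously differentiable on $\Theta$" means on $\Theta^\circ$, with all derivatives of order at most $\ell$ extending continuously to $\Theta$. Put $b(A,B)=2\operatorname{Re}\operatorname{Tr}(A^*B)$ for $A,B\in M_d(\mathbb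 C)$ and $b(\mathbf L^\beta,\rho)=(b(L_1^\beta,\rho),\dots,b(L_r^\beta,\rho))^\top\in\mathbb R^r$. With $[A,B]=AB-BA$, $\{A,B\}=AB+BA$, put $$\mathcal L^\theta(\rho)=-i[H^\alpha,\rho]+\sum_{k=1}^r\Big(L_k^\beta\rho(L_k^\beta)^*-\tfrac12\{(L_k^\beta)^*L_k^\beta,\rho\}\Big),\qquad \mathcal H_k^\beta(\rho)=L_k^\beta\rho+\rho(L_k^\beta)^*-b(L_k^\beta,\rho)\rho.$$ Let $\mathbf W^{(1)},\mathbf W^{(2)},\dots$ be independent $r$-dimensional standard Wiener processes on $[0,T]$, $\mathbf W^{(i)}=(W^{(i,1)},\dots,W^{(i,r)})^\top$, and let $\rho_0\in M_d(\mathbb C)$ be a fixed (known) density matrix (positive semidefinite, trace one). For $\theta\in\Theta$, $i\ge1$, $\rho_t^{\theta,(i)}$ is the unique solution of $$d\rho_t^{\theta,(i)}=\mathcal L^\theta(\rho_t^{\theta,(i)})\,dt+\sum_{k=1}^r\mathcal H_k^\beta(\rho_t^{\theta,(i)})\,dW_t^{(i,k)},\qquad \rho_0^{\theta,(i)}=\rho_0;$$ it is known that it exists, is unique and is density-matrix valued. Put $\bar\rho_t^\theta=\mathbb E[\rho_t^{\theta,(i)}]$ (independent of $i$) and $h(t,\theta)=b(\mathbf L^\beta,\bar\rho_t^\theta)\in\mathbb R^r$. Observations: the records are generated under $\theta_0$, i.e. $d\mathbf Y^{(i)}_t=b(\mathbf L^{\beta_0},\rho_t^{\theta_0,(i)})\,dt+d\mathbf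 W^{(i)}_t$, $\mathbf Y_0^{(i)}=0$; $\overline{\mathbf Y}^N=\frac1N\sum_{i=1}^N\mathbf Y^{(i)}$. The random field $\theta\mapsto\int_0^Th(t,\theta)\cdot d\overline{\mathbf Y}^N_t$ is taken in its version continuous in $\theta\in\Theta$, and $\hat\theta_N$ is a measurable choice of a maximizer. *)

theory Defs
  imports "HOL-Probability.Probability"
begin

text \<open>The norm of \<^typ>\<open>complex^'d^'d\<close> is the Frobenius norm.\<close>

definition adj :: "complex^'d^'d \<Rightarrow> complex^'d^'d" where
  "adj B = (\<chi> j k. cnj (B $ k $ j))"

definition cscale :: "complex \<Rightarrow> complex^'d^'d \<Rightarrow> complex^'d^'d" where
  "cscale c B = (\<chi> j k. c * B $ j $ k)"

definition commutator :: "complex^'d^'d \<Rightarrow> complex^'d^'d \<Rightarrow> complex^'d^'d" where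
  "commutator B C = B ** C - C ** B"

definition anticommutator :: "complex^'d^'d \<Rightarrow> complex^'d^'d \<Rightarrow> complex^'d^'d" where
  "anticommutator B C = B ** C + C ** B"

definition density_matrix :: "complex^'d^'d \<Rightarrow> bool" where
  "density_matrix \<rho> \<longleftrightarrow> adj \<rho> = \<rho> \<and>
     (\<forall>x :: complex^'d. 0 \<le> Re (\<Sum>j\<in>UNIV. \<Sum>k\<in>UNIV. cnj (x $ j) * \<rho> $ j $ k * x $ k)) \<and>
     trace \<rho> = 1"

definition bform :: "complex^'d^'d \<Rightarrow> complex^'d^'d \<Rightarrow> real" where
  "bform B C = 2 * Re (trace (adj B ** C))"

definition bvec :: "('r::finite \<Rightarrow> complex^'d^'d) \<Rightarrow> complex^'d^'d \<Rightarrow> real^'r" where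
  "bvec Ls \<rho> = (\<chi> k. bform (Ls k) \<rho>)"

definition lindblad ::
    "complex^'d^'d \<Rightarrow> ('r::finite \<Rightarrow> complex^'d^'d) \<Rightarrow> complex^'d^'d \<Rightarrow> complex^'d^'d" where
  "lindblad Hm Ls \<rho> = cscale (- \<i>) (commutator Hm \<rho>) +
     (\<Sum>k\<in>UNIV. Ls k ** \<rho> ** adj (Ls k) - (1/2) *\<^sub>R anticommutator (adj (Ls k) ** Ls k) \<rho>)"

definition diffusion :: "complex^'d^'d \<Rightarrow> complex^'d^'d \<Rightarrow> complex^'d^'d" where
  "diffusion Lk \<rho> = Lk ** \<rho> + \<rho> ** adj Lk - bform Lk \<rho> *\<^sub>R \<rho>"

text \<open>A parameter \<open>\<theta> = (\<alpha>, \<beta>)\<close> is a vector whose coordinates in \<open>A\<close> form \<open>\<alpha>\<close> and whose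
  coordinates outside \<open>A\<close> form \<open>\<beta>\<close>; each part is stored in \<open>real^'p\<close>, padded with zeros.\<close>

definition alpha_part :: "'p::finite set \<Rightarrow> real^'p \<Rightarrow> real^'p" where
  "alpha_part A \<theta> = (\<chi> j. if j \<in> A then \<theta> $ j else 0)"

definition beta_part :: "'p::finite set \<Rightarrow> real^'p \<Rightarrow> real^'p" where
  "beta_part A \<theta> = (\<chi> j. if j \<in> A then 0 else \<theta> $ j)"

text \<open>Once continuously differentiable on the closure of the open set \<open>U\<close>: \<open>C\<^sup>1\<close> on \<open>U\<close>, and \<open>f\<close> and
  its derivative extend continuously to the closure. The values of \<open>f'\<close> outside \<open>U\<close> are the
  extension; the extension of \<open>f\<close> is \<open>f\<close> itself.\<close>

definition C1_on_closure ::
    "'a::real_normed_vector set \<Rightarrow> ('a \<Rightarrow> 'b::real_normed_vector) \<Rightarrow> bool" where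
  "C1_on_closure U f \<longleftrightarrow> continuous_on (closure U) f \<and>
     (\<exists>f' :: 'a \<Rightarrow> 'a \<Rightarrow>\<^sub>L 'b. continuous_on (closure U) f' \<and>
        (\<forall>x\<in>U. (f has_derivative blinfun_apply (f' x)) (at x)))"

text \<open>Standard \<open>r\<close>-dimensional Wiener process on \<open>[0,T]\<close>: in addition to starting at zero and having
  continuous paths, increments after time \<open>s\<close> are independent of the path up to \<open>s\<close>, and
  \<open>W\<^sub>t - W\<^sub>s\<close> has law \<open>N(0, (t - s) I\<^sub>r)\<close>.\<close>

definition wiener_process :: "'w measure \<Rightarrow> real \<Rightarrow> (real \<Rightarrow> 'w \<Rightarrow> real^'r) \<Rightarrow> bool" where
  "wiener_process M T W \<longleftrightarrow>
     (\<forall>t\<in>{0..T}. W t \<in> borel_measurable M) \<and>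
     (\<forall>\<omega>\<in>space M. W 0 \<omega> = 0 \<and> continuous_on {0..T} (\<lambda>t. W t \<omega>)) \<and>
     (\<forall>s t. 0 \<le> s \<longrightarrow> s < t \<longrightarrow> t \<le> T \<longrightarrow>
        prob_space.indep_set M
          (sigma_sets (space M) {W u -` B \<inter> space M | u B. u \<in> {0..s} \<and> B \<in> sets borel})
          {(\<lambda>\<omega>. W t \<omega> - W s \<omega>) -` B \<inter> space M | B. B \<in> sets borel} \<and>
        prob_space.indep_vars M (\<lambda>_. borel) (\<lambda>k \<omega>. (W t \<omega> - W s \<omega>) $ k) UNIV \<and>
        (\<forall>k. distributed M lborel (\<lambda>\<omega>. (W t \<omega> - W s \<omega>) $ k)
               (normal_density 0 (sqrt (t - s)))))"

definition independent_wiener ::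
    "'w measure \<Rightarrow> real \<Rightarrow> (nat \<Rightarrow> real \<Rightarrow> 'w \<Rightarrow> real^'r) \<Rightarrow> nat set \<Rightarrow> bool" where
  "independent_wiener M T W I \<longleftrightarrow>
     (\<forall>i\<in>I. wiener_process M T (W i)) \<and>
     prob_space.indep_vars M (\<lambda>_. Pi\<^sub>M {0..T} (\<lambda>_. borel)) (\<lambda>i \<omega>. \<lambda>t\<in>{0..T}. W i t \<omega>) I"

text \<open>The filtration generated by the processes \<open>W i\<close>, \<open>i \<in> I\<close>, augmented by the null sets.\<close>

definition aug_filtration ::
    "'w measure \<Rightarrow> (nat \<Rightarrow> real \<Rightarrow> 'w \<Rightarrow> real^'r) \<Rightarrow> nat set \<Rightarrow> real \<Rightarrow> 'w measure" where
  "aug_filtration M W I t = sigma (space M)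
     ({W i s -` B \<inter> space M | i s B. i \<in> I \<and> s \<in> {0..t} \<and> B \<in> sets borel} \<union> null_sets M)"

text \<open>The data \<open>(n, s, \<xi>)\<close> stand for the simple adapted process equal to \<open>\<xi> j\<close> on
  \<open>(s j, s (j + 1)]\<close> for \<open>j < n\<close>, and zero elsewhere.\<close>

type_synonym ('w, 'b) simple_data = "nat \<times> (nat \<Rightarrow> real) \<times> (nat \<Rightarrow> 'w \<Rightarrow> 'b)"

definition simple_adapted ::
    "'w measure \<Rightarrow> (real \<Rightarrow> 'w measure) \<Rightarrow> ('w, 'b::euclidean_space) simple_data \<Rightarrow> bool" where
  "simple_adapted M F S = (case S of (n, s, \<xi>) \<Rightarrow>
     0 \<le> s 0 \<and> (\<forall>j<n. s j \<le> s (Suc j)) \<and>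
     (\<forall>j<n. \<xi> j \<in> borel_measurable (F (s j)) \<and> (\<exists>C. \<forall>\<omega>\<in>space M. norm (\<xi> j \<omega>) \<le> C)))"

definition simple_process ::
    "('w, 'b::euclidean_space) simple_data \<Rightarrow> real \<Rightarrow> 'w \<Rightarrow> 'b" where
  "simple_process S t \<omega> = (case S of (n, s, \<xi>) \<Rightarrow>
     \<Sum>j<n. indicator {s j<..s (Suc j)} t *\<^sub>R \<xi> j \<omega>)"

definition simple_integral ::
    "('w, 'b::euclidean_space) simple_data \<Rightarrow> (real \<Rightarrow> 'w \<Rightarrow> real) \<Rightarrow> real \<Rightarrow> 'w \<Rightarrow> 'b" where
  "simple_integral S Z t \<omega> = (case S of (n, s, \<xi>) \<Rightarrow>
     \<Sum>j<n. (Z (min (s (Suc j)) t) \<omega> - Z (min (s j) t) \<omega>) *\<^sub>R \<xi> j \<omega>)"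

text \<open>\<open>J\<close> is (a version of) the Ito integral \<open>\<integral>\<^sub>0\<^sup>t X dZ\<close>: the \<open>L\<^sup>2\<close>-limit of the integrals of simple
  adapted processes that approximate \<open>X\<close> in \<open>L\<^sup>2(dt \<otimes> P)\<close>. This determines \<open>J\<close> almost surely
  whenever \<open>Z\<close> is a multiple of a Wiener process with respect to the filtration \<open>F\<close> plus a drift
  with bounded adapted density (so that simple integrals are continuous for the \<open>L\<^sup>2\<close>-norms); it is only
  used for such \<open>Z\<close>.\<close>

definition has_ito_integral ::
    "'w measure \<Rightarrow> (real \<Rightarrow> 'w measure) \<Rightarrow> (real \<Rightarrow> 'w \<Rightarrow> real) \<Rightarrow>
     (real \<Rightarrow> 'w \<Rightarrow> 'b::euclidean_space) \<Rightarrow> real \<Rightarrow> ('w \<Rightarrow> 'b) \<Rightarrow> bool" where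
  "has_ito_integral M F Z X t J \<longleftrightarrow>
     (\<lambda>(s, \<omega>). X s \<omega>) \<in> borel_measurable (restrict_space borel {0..t} \<Otimes>\<^sub>M M) \<and>
     J \<in> borel_measurable M \<and>
     (\<exists>S :: nat \<Rightarrow> ('w, 'b) simple_data. (\<forall>m. simple_adapted M F (S m)) \<and>
        (\<lambda>m. \<integral>\<^sup>+\<omega>. (\<integral>\<^sup>+s\<in>{0..t}. ennreal ((norm (simple_process (S m) s \<omega> - X s \<omega>))\<^sup>2) \<partial>lborel) \<partial>M)
          \<longlonglongrightarrow> 0 \<and>
        (\<lambda>m. \<integral>\<^sup>+\<omega>. ennreal ((norm (simple_integral (S m) Z t \<omega> - J \<omega>))\<^sup>2) \<partial>M) \<longlonglongrightarrow> 0)"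

text \<open>Integral \<open>\<integral>\<^sub>0\<^sup>t X \<cdot> dZ\<close> of a vector integrand against a vector integrator.\<close>

definition has_ito_integral_inner ::
    "'w measure \<Rightarrow> (real \<Rightarrow> 'w measure) \<Rightarrow> (real \<Rightarrow> 'w \<Rightarrow> real^'r) \<Rightarrow>
     (real \<Rightarrow> 'w \<Rightarrow> real^'r) \<Rightarrow> real \<Rightarrow> ('w \<Rightarrow> real) \<Rightarrow> bool" where
  "has_ito_integral_inner M F Z X t J \<longleftrightarrow> J \<in> borel_measurable M \<and>
     (\<exists>I. (\<forall>k. has_ito_integral M F (\<lambda>s \<omega>. Z s \<omega> $ k) (\<lambda>s \<omega>. X s \<omega> $ k) t (I k)) \<and>
          (AE \<omega> in M. J \<omega> = (\<Sum>k\<in>UNIV. I k \<omega>)))"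

text \<open>Continuous adapted solution of
  \<open>d\<rho> = lindblad Hm Ls \<rho> dt + (\<Sum>k. diffusion (Ls k) \<rho> dW\<^sup>k)\<close>, \<open>\<rho>(0) = \<rho>0\<close>, on \<open>[0,T]\<close>.\<close>

definition sme_solution ::
    "'w measure \<Rightarrow> real \<Rightarrow> (real \<Rightarrow> 'w measure) \<Rightarrow> (real \<Rightarrow> 'w \<Rightarrow> real^'r) \<Rightarrow>
     complex^'d^'d \<Rightarrow> ('r::finite \<Rightarrow> complex^'d^'d) \<Rightarrow> complex^'d^'d \<Rightarrow>
     (real \<Rightarrow> 'w \<Rightarrow> complex^'d^'d) \<Rightarrow> bool" where
  "sme_solution M T F W Hm Ls \<rho>0 \<rho> \<longleftrightarrow>
     (\<forall>t\<in>{0..T}. \<rho> t \<in> borel_measurable (F t)) \<and>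
     (\<forall>\<omega>\<in>space M. continuous_on {0..T} (\<lambda>t. \<rho> t \<omega>)) \<and>
     (\<forall>t\<in>{0..T}. \<exists>I.
        (\<forall>k. has_ito_integral M F (\<lambda>s \<omega>. W s \<omega> $ k) (\<lambda>s \<omega>. diffusion (Ls k) (\<rho> s \<omega>)) t (I k)) \<and>
        (AE \<omega> in M. \<rho> t \<omega> =
           \<rho>0 + integral {0..t} (\<lambda>s. lindblad Hm Ls (\<rho> s \<omega>)) + (\<Sum>k\<in>UNIV. I k \<omega>)))"

text \<open>Below, \<open>\<rho> \<theta> i t \<omega>\<close> is the state of the \<open>i\<close>-th trajectory, \<open>i \<ge> 1\<close>. The mean state does not
  depend on \<open>i\<close>, so it is defined from \<open>i = 1\<close>.\<close>

definition mean_state ::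
    "'w measure \<Rightarrow> (real^'p \<Rightarrow> nat \<Rightarrow> real \<Rightarrow> 'w \<Rightarrow> complex^'d^'d) \<Rightarrow> real^'p \<Rightarrow> real \<Rightarrow> complex^'d^'d"
  where "mean_state M \<rho> \<theta> t = (\<integral>\<omega>. \<rho> \<theta> 1 t \<omega> \<partial>M)"

definition mean_signal ::
    "'w measure \<Rightarrow> 'p::finite set \<Rightarrow> (real^'p \<Rightarrow> 'r::finite \<Rightarrow> complex^'d^'d) \<Rightarrow>
     (real^'p \<Rightarrow> nat \<Rightarrow> real \<Rightarrow> 'w \<Rightarrow> complex^'d^'d) \<Rightarrow> real \<Rightarrow> real^'p \<Rightarrow> real^'r" where
  "mean_signal M A L \<rho> t \<theta> = bvec (L (beta_part A \<theta>)) (mean_state M \<rho> \<theta> t)"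

definition obs_record ::
    "'p::finite set \<Rightarrow> (real^'p \<Rightarrow> 'r::finite \<Rightarrow> complex^'d^'d) \<Rightarrow> (nat \<Rightarrow> real \<Rightarrow> 'w \<Rightarrow> real^'r) \<Rightarrow>
     (real^'p \<Rightarrow> nat \<Rightarrow> real \<Rightarrow> 'w \<Rightarrow> complex^'d^'d) \<Rightarrow> real^'p \<Rightarrow> nat \<Rightarrow> real \<Rightarrow> 'w \<Rightarrow> real^'r" where
  "obs_record A L W \<rho> \<theta>0 i t \<omega> =
     integral {0..t} (\<lambda>s. bvec (L (beta_part A \<theta>0)) (\<rho> \<theta>0 i s \<omega>)) + W i t \<omega>"

definition mean_record ::
    "'p::finite set \<Rightarrow> (real^'p \<Rightarrow> 'r::finite \<Rightarrow> complex^'d^'d) \<Rightarrow> (nat \<Rightarrow> real \<Rightarrow> 'w \<Rightarrow> real^'r) \<Rightarrow>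
     (real^'p \<Rightarrow> nat \<Rightarrow> real \<Rightarrow> 'w \<Rightarrow> complex^'d^'d) \<Rightarrow> real^'p \<Rightarrow> nat \<Rightarrow> real \<Rightarrow> 'w \<Rightarrow> real^'r" where
  "mean_record A L W \<rho> \<theta>0 N t \<omega> = (1 / real N) *\<^sub>R (\<Sum>i=1..N. obs_record A L W \<rho> \<theta>0 i t \<omega>)"

text \<open>\<open>J N \<theta>\<close> plays the role of the integral of \<open>mean_signal\<close> against the mean record.\<close>

definition contrast ::
    "'w measure \<Rightarrow> real \<Rightarrow> 'p::finite set \<Rightarrow> (real^'p \<Rightarrow> 'r::finite \<Rightarrow> complex^'d^'d) \<Rightarrow>
     (real^'p \<Rightarrow> nat \<Rightarrow> real \<Rightarrow> 'w \<Rightarrow> complex^'d^'d) \<Rightarrow>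
     (nat \<Rightarrow> real^'p \<Rightarrow> 'w \<Rightarrow> real) \<Rightarrow> nat \<Rightarrow> 'w \<Rightarrow> real^'p \<Rightarrow> real" where
  "contrast M T A L \<rho> J N \<omega> \<theta> =
     J N \<theta> \<omega> - (1/2) * integral {0..T} (\<lambda>t. (norm (mean_signal M A L \<rho> t \<theta>))\<^sup>2)"

end

theory Submission
  imports Defs
begin

text \<open>The estimator maximizes a random function of the parameter. It is shown that these functions converge, almost
surely and uniformly on the compact parameter set, to a deterministic function that is maximal at
\<open>\<theta>0\<close> only; maximizers then have to converge to \<open>\<theta>0\<close>.

The mean signal. Ito integrals have mean zero (\<open>expectation_ito_integral\<close>) and the Lindblad operator is linear, so the mean
state solves a linear integral equation (\<open>mean_state_integral_equation\<close>). A Gronwall estimate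
(\<open>integral_equation_comparison\<close>) makes its solution unique and jointly continuous in parameter and time. Hence the
mean signal \<open>h \<theta> t\<close> is continuously differentiable in \<open>t\<close>, with \<open>h\<close> and its time
derivative \<open>h'\<close> jointly continuous.

The stochastic integral. The integrand is deterministic and smooth in time, so the Ito integral of \<open>h \<theta>\<close> against the
mean record \<open>Y N\<close> is almost surely equal to \<open>h \<theta> T \<bullet> Y N T - \<integral> h' \<theta> t \<bullet> Y N t dt\<close>
(\<open>ito_integral_by_parts\<close>). This expression is defined path by path and continuous in \<open>\<theta>\<close>. The version of
the integral that is continuous in \<open>\<theta>\<close> therefore agrees with it for all \<open>\<theta>\<close> at once, because it does so on
a countable dense set. All randomness of the contrast now sits in one path, which does not depend on \<open>\<theta>\<close>.

The law of large numbers. At each time the records are independent with fourth moments bounded uniformly in the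
time, so the fourth moment of their centred average is \<open>O(1/N\<^sup>2)\<close>, which is summable. By Fubini the centred average tends to zero almost
surely at time \<open>T\<close> and in \<open>L\<^sup>4\<close> over \<open>[0,T]\<close> (\<open>process_law_of_large_numbers\<close>). That is
enough for the uniform convergence of the contrast, since \<open>h\<close> and \<open>h'\<close> are bounded.

The limit. The mean of the records has derivative \<open>h \<theta>0\<close>, so undoing the integration by parts turns the limit into
\<open>\<integral> h \<theta> \<bullet> h \<theta>0 - 1/2 \<integral> |h \<theta>|\<^sup>2 = 1/2 \<integral> |h \<theta>0|\<^sup>2 - 1/2 \<integral> |h \<theta> - h \<theta>0|\<^sup>2\<close>.
By identifiability and continuity in time the last integral is positive unless \<open>\<theta> = \<theta>0\<close>
(\<open>contrast_maximizer_consistency\<close>).\<close>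

section \<open>Fourth moments of sums of independent variables\<close>

text \<open>The sum of the \<open>f n\<close> has finite expectation, so it is almost surely a convergent series.\<close>

lemma AE_tendsto_0_of_summable:
  fixes f :: "nat \<Rightarrow> 'a \<Rightarrow> real"
  assumes meas: "\<And>n. f n \<in> borel_measurable M"
    and nonneg: "\<And>n \<omega>. 0 \<le> f n \<omega>"
    and bound: "\<And>n. (\<integral>\<^sup>+\<omega>. ennreal (f n \<omega>) \<partial>M) \<le> ennreal (g n)"
    and g: "summable g" "\<And>n. 0 \<le> g n"
  shows "AE \<omega> in M. (\<lambda>n. f n \<omega>) \<longlonglongrightarrow> 0"
proof -
  have "(\<integral>\<^sup>+\<omega>. (\<Sum>n. ennreal (f n \<omega>)) \<partial>M) = (\<Sum>n. \<integral>\<^sup>+\<omega>. ennreal (f n \<omega>) \<partial>M)"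
    using meas by (intro nn_integral_suminf) auto
  also have "\<dots> \<le> (\<Sum>n. ennreal (g n))"
    by (intro suminf_le bound) auto
  also have "\<dots> < \<infinity>"
    using g by (simp add: suminf_ennreal2 less_top)
  finally have "AE \<omega> in M. (\<Sum>n. ennreal (f n \<omega>)) \<noteq> \<infinity>"
    using meas by (intro nn_integral_PInf_AE) auto
  then show ?thesis
  proof eventually_elim
    case (elim \<omega>)
    then have "summable (\<lambda>n. f n \<omega>)"
      using nonneg by (intro summable_suminf_not_top) auto
    then show ?case by (rule summable_LIMSEQ_zero)
  qed
qed

lemma (in prob_space) integrable_power_of_fourth:
  fixes X :: "'a \<Rightarrow> real"
  assumes [measurable]: "X \<in> borel_measurable M" and "integrable M (\<lambda>\<omega>. X \<omega> ^ 4)" and "k \<le> 4"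
  shows "integrable M (\<lambda>\<omega>. X \<omega> ^ k)"
proof (rule Bochner_Integration.integrable_bound)
  show "integrable M (\<lambda>\<omega>. 1 + X \<omega> ^ 4)" using assms by simp
  have "\<bar>x\<bar> ^ k \<le> 1 + x ^ 4" for x :: real
  proof (cases "\<bar>x\<bar> \<le> 1")
    case True
    then have "\<bar>x\<bar> ^ k \<le> 1" by (simp add: power_le_one)
    moreover have "0 \<le> x ^ 4" by simp
    ultimately show ?thesis by linarith
  next
    case False
    then have "\<bar>x\<bar> ^ k \<le> \<bar>x\<bar> ^ 4" using \<open>k \<le> 4\<close> by (intro power_increasing) auto
    then show ?thesis by (simp add: power_even_abs)
  qed
  then show "AE \<omega> in M. norm (X \<omega> ^ k) \<le> norm (1 + X \<omega> ^ 4)"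
    by (auto simp: power_abs)
qed simp

text \<open>Jensen's inequality, in the form \<open>x\<^sup>2 \<le> x\<^sup>4 / (2 c) + c / 2\<close> with \<open>c = sqrt K\<close>.\<close>

lemma (in prob_space) second_moment_le_sqrt_fourth:
  fixes X :: "'a \<Rightarrow> real"
  assumes [measurable]: "X \<in> borel_measurable M" and int: "integrable M (\<lambda>\<omega>. X \<omega> ^ 4)"
    and K: "expectation (\<lambda>\<omega>. X \<omega> ^ 4) \<le> K" "0 < K"
  shows "expectation (\<lambda>\<omega>. X \<omega> ^ 2) \<le> sqrt K"
proof -
  define c where "c = sqrt K"
  have c: "0 < c" "c * c = K" using K by (auto simp: c_def)
  have le: "x ^ 2 \<le> x ^ 4 / (2 * c) + c / 2" for x :: real
  proof -
    have "0 \<le> (x\<^sup>2 - c)\<^sup>2" by simp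
    then have "2 * c * x\<^sup>2 \<le> x ^ 4 + c * c"
      by (simp add: power2_diff power2_eq_square power4_eq_xxxx algebra_simps)
    then show ?thesis using c by (simp add: field_simps)
  qed
  have "expectation (\<lambda>\<omega>. X \<omega> ^ 2) \<le> expectation (\<lambda>\<omega>. X \<omega> ^ 4 / (2 * c) + c / 2)"
    using int integrable_power_of_fourth[of X 2] by (intro integral_mono le) auto
  also have "\<dots> = expectation (\<lambda>\<omega>. X \<omega> ^ 4) / (2 * c) + c / 2"
    using int by (simp add: prob_space)
  also have "\<dots> \<le> K / (2 * c) + c / 2"
    using K c by (intro add_right_mono divide_right_mono) auto
  also have "\<dots> = c" using c by (simp add: field_simps)
  finally show ?thesis by (simp add: c_def)
qed

lemma (in prob_space) indep_var_integral_powers: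
  fixes X Y :: "'a \<Rightarrow> real"
  assumes ind: "indep_var borel X borel Y"
    and X: "integrable M (\<lambda>\<omega>. X \<omega> ^ 4)" and Y: "integrable M (\<lambda>\<omega>. Y \<omega> ^ 4)"
    and "j \<le> 4" "k \<le> 4"
  shows "integrable M (\<lambda>\<omega>. X \<omega> ^ j * Y \<omega> ^ k)"
    and "expectation (\<lambda>\<omega>. X \<omega> ^ j * Y \<omega> ^ k) = expectation (\<lambda>\<omega>. X \<omega> ^ j) * expectation (\<lambda>\<omega>. Y \<omega> ^ k)"
proof -
  have [measurable]: "X \<in> borel_measurable M" "Y \<in> borel_measurable M"
    using ind by (auto simp: indep_var_rv1 indep_var_rv2 dest: indep_var_rv1 indep_var_rv2)
  have ind': "indep_var borel (\<lambda>\<omega>. X \<omega> ^ j) borel (\<lambda>\<omega>. Y \<omega> ^ k)"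
    using indep_var_compose[OF ind, of "\<lambda>x. x ^ j" borel "\<lambda>x. x ^ k" borel] by (simp add: comp_def)
  have i: "integrable M (\<lambda>\<omega>. X \<omega> ^ j)" "integrable M (\<lambda>\<omega>. Y \<omega> ^ k)"
    using assms by (auto intro: integrable_power_of_fourth)
  show "integrable M (\<lambda>\<omega>. X \<omega> ^ j * Y \<omega> ^ k)"
    by (rule indep_var_integrable[OF ind' i])
  show "expectation (\<lambda>\<omega>. X \<omega> ^ j * Y \<omega> ^ k) = expectation (\<lambda>\<omega>. X \<omega> ^ j) * expectation (\<lambda>\<omega>. Y \<omega> ^ k)"
    by (rule indep_var_lebesgue_integral[OF ind' i])
qed

text \<open>Independence and centring kill every term of the expanded fourth power in which some variable has
exponent one. What remains are \<open>N\<close> fourth moments and of the order of \<open>N\<^sup>2\<close> products of two second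
moments, so the growth is \<open>N\<^sup>2\<close> instead of \<open>N\<^sup>4\<close>. In the induction, the second moment of the partial sum has to be
carried along, since it multiplies the second moment of the new summand.\<close>

lemma (in prob_space) fourth_moment_sum_le:
  fixes X :: "nat \<Rightarrow> 'a \<Rightarrow> real"
  assumes ind: "indep_vars (\<lambda>_. borel) X {1..}"
    and int: "\<And>i. 1 \<le> i \<Longrightarrow> integrable M (\<lambda>\<omega>. X i \<omega> ^ 4)"
    and mean: "\<And>i. 1 \<le> i \<Longrightarrow> expectation (X i) = 0"
    and K: "\<And>i. 1 \<le> i \<Longrightarrow> expectation (\<lambda>\<omega>. X i \<omega> ^ 4) \<le> K" "0 < K"
  shows "integrable M (\<lambda>\<omega>. (\<Sum>i=1..N. X i \<omega>) ^ 4)"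
    and "expectation (\<lambda>\<omega>. (\<Sum>i=1..N. X i \<omega>) ^ 4) \<le> 3 * K * real N ^ 2"
proof -
  have meas: "X i \<in> borel_measurable M" if "1 \<le> i" for i
    using ind that by (auto simp: indep_vars_def)
  have "integrable M (\<lambda>\<omega>. (\<Sum>i=1..N. X i \<omega>) ^ 4) \<and> expectation (\<lambda>\<omega>. \<Sum>i=1..N. X i \<omega>) = 0 \<and>
     expectation (\<lambda>\<omega>. (\<Sum>i=1..N. X i \<omega>) ^ 2) \<le> N * sqrt K \<and>
     expectation (\<lambda>\<omega>. (\<Sum>i=1..N. X i \<omega>) ^ 4) \<le> 3 * K * real N ^ 2"
  proof (induction N)
    case 0
    show ?case by simp
  next
    case (Suc N)
    define S where "S = (\<lambda>\<omega>. \<Sum>i=1..N. X i \<omega>)"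
    define Y where "Y = X (Suc N)"
    have S: "integrable M (\<lambda>\<omega>. S \<omega> ^ 4)" "expectation S = 0"
      "expectation (\<lambda>\<omega>. S \<omega> ^ 2) \<le> N * sqrt K" "expectation (\<lambda>\<omega>. S \<omega> ^ 4) \<le> 3 * K * real N ^ 2"
      using Suc by (auto simp: S_def)
    have Y: "integrable M (\<lambda>\<omega>. Y \<omega> ^ 4)" "expectation Y = 0" "expectation (\<lambda>\<omega>. Y \<omega> ^ 4) \<le> K"
      using int mean K by (auto simp: Y_def)
    have [measurable]: "Y \<in> borel_measurable M" "S \<in> borel_measurable M"
      unfolding Y_def S_def using meas by (auto intro!: borel_measurable_sum)
    have "indep_var borel (X (Suc N)) borel (\<lambda>\<omega>. \<Sum>i\<in>{1..N}. X i \<omega>)"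
      by (intro indep_vars_sum indep_vars_subset[OF ind]) auto
    then have iv: "indep_var borel Y borel S" by (simp add: S_def Y_def)
    note P = indep_var_integral_powers[OF iv Y(1) S(1)]
    have p1: "integrable M (\<lambda>\<omega>. Y \<omega>)" "integrable M (\<lambda>\<omega>. S \<omega>)"
       "integrable M (\<lambda>\<omega>. Y \<omega>^2)" "integrable M (\<lambda>\<omega>. S \<omega>^2)"
      using P(1)[of 1 0] P(1)[of 0 1] P(1)[of 2 0] P(1)[of 0 2] by auto
    have p2: "integrable M (\<lambda>\<omega>. Y \<omega> * S \<omega>)" "expectation (\<lambda>\<omega>. Y \<omega> * S \<omega>) = 0"
      using P[of 1 1] Y(2) by auto
    have p3: "integrable M (\<lambda>\<omega>. Y \<omega> ^ 3 * S \<omega>)" "expectation (\<lambda>\<omega>. Y \<omega> ^ 3 * S \<omega>) = 0"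
      using P[of 3 1] S(2) by auto
    have p4: "integrable M (\<lambda>\<omega>. Y \<omega> * S \<omega> ^ 3)" "expectation (\<lambda>\<omega>. Y \<omega> * S \<omega> ^ 3) = 0"
      using P[of 1 3] Y(2) by auto
    have p5: "integrable M (\<lambda>\<omega>. Y \<omega> ^ 2 * S \<omega> ^ 2)"
      "expectation (\<lambda>\<omega>. Y \<omega> ^ 2 * S \<omega> ^ 2) = expectation (\<lambda>\<omega>. Y \<omega> ^ 2) * expectation (\<lambda>\<omega>. S \<omega> ^ 2)"
      using P[of 2 2] by auto
    have Y2: "expectation (\<lambda>\<omega>. Y \<omega> ^ 2) \<le> sqrt K"
      using Y K by (intro second_moment_le_sqrt_fourth) auto
    have e4: "(\<lambda>\<omega>. (S \<omega> + Y \<omega>) ^ 4) =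
       (\<lambda>\<omega>. S \<omega> ^ 4 + 4 * (Y \<omega> * S \<omega> ^ 3) + 6 * (Y \<omega> ^ 2 * S \<omega> ^ 2) + 4 * (Y \<omega> ^ 3 * S \<omega>) + Y \<omega> ^ 4)"
      by (rule ext) (simp add: power4_eq_xxxx power3_eq_cube power2_eq_square algebra_simps)
    have e2: "(\<lambda>\<omega>. (S \<omega> + Y \<omega>) ^ 2) = (\<lambda>\<omega>. S \<omega> ^ 2 + 2 * (Y \<omega> * S \<omega>) + Y \<omega> ^ 2)"
      by (rule ext) (simp add: power2_eq_square algebra_simps)
    have i4: "integrable M (\<lambda>\<omega>. (S \<omega> + Y \<omega>) ^ 4)"
      unfolding e4 using S Y p3 p4 p5 by (intro Bochner_Integration.integrable_add integrable_mult_right) auto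
    have "expectation (\<lambda>\<omega>. Y \<omega> ^ 2) * expectation (\<lambda>\<omega>. S \<omega> ^ 2) \<le> sqrt K * (N * sqrt K)"
      using Y2 S(3) K by (intro mult_mono) auto
    also have "\<dots> = N * K" using K by simp
    finally have p: "expectation (\<lambda>\<omega>. Y \<omega> ^ 2) * expectation (\<lambda>\<omega>. S \<omega> ^ 2) \<le> N * K" .
    have "expectation (\<lambda>\<omega>. (S \<omega> + Y \<omega>) ^ 4) =
       expectation (\<lambda>\<omega>. S \<omega> ^ 4) + 6 * (expectation (\<lambda>\<omega>. Y \<omega> ^ 2) * expectation (\<lambda>\<omega>. S \<omega> ^ 2)) + expectation (\<lambda>\<omega>. Y \<omega> ^ 4)"
      unfolding e4 using S(1) Y(1) p3 p4 p5 by simp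
    also have "\<dots> \<le> 3 * K * real N ^ 2 + 6 * (N * K) + K"
      using S(4) Y(3) p by linarith
    also have "\<dots> \<le> 3 * K * real (Suc N) ^ 2"
      using K by (simp add: power2_eq_square algebra_simps)
    finally have m4: "expectation (\<lambda>\<omega>. (S \<omega> + Y \<omega>) ^ 4) \<le> 3 * K * real (Suc N) ^ 2" .
    have "expectation (\<lambda>\<omega>. (S \<omega> + Y \<omega>) ^ 2) = expectation (\<lambda>\<omega>. S \<omega> ^ 2) + expectation (\<lambda>\<omega>. Y \<omega> ^ 2)"
      unfolding e2 using p1 p2 by simp
    also have "\<dots> \<le> Suc N * sqrt K" using S(3) Y2 by (simp add: algebra_simps)
    finally have m2: "expectation (\<lambda>\<omega>. (S \<omega> + Y \<omega>) ^ 2) \<le> Suc N * sqrt K" .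
    have m1: "expectation (\<lambda>\<omega>. S \<omega> + Y \<omega>) = 0" using p1 S Y by simp
    have "(\<Sum>i=1..Suc N. X i \<omega>) = S \<omega> + Y \<omega>" for \<omega> by (simp add: S_def Y_def)
    then show ?case using i4 m4 m2 m1 by simp
  qed
  then show "integrable M (\<lambda>\<omega>. (\<Sum>i=1..N. X i \<omega>) ^ 4)"
    "expectation (\<lambda>\<omega>. (\<Sum>i=1..N. X i \<omega>) ^ 4) \<le> 3 * K * real N ^ 2" by auto
qed

section \<open>Time integrals of continuous processes\<close>

text \<open>The process is the pointwise limit of the processes frozen at the last grid point
\<open>\<lfloor>t n\<rfloor> / n\<close>, which involve only countably many times. The space \<open>N\<close> is arbitrary so that it can also be
a \<sigma>-algebra of a filtration: time integrals of adapted processes are then seen to be adapted.\<close>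

lemma borel_measurable_continuous_process:
  fixes f :: "real \<Rightarrow> 'a \<Rightarrow> 'b::{second_countable_topology, real_normed_vector}"
  assumes T: "0 \<le> T"
    and meas: "\<And>t. t \<in> {0..T} \<Longrightarrow> f t \<in> borel_measurable N"
    and cont: "\<And>\<omega>. \<omega> \<in> space N \<Longrightarrow> continuous_on {0..T} (\<lambda>t. f t \<omega>)"
  shows "(\<lambda>(t, \<omega>). indicator {0..T} t *\<^sub>R f t \<omega>) \<in> borel_measurable (borel \<Otimes>\<^sub>M N)"
proof -
  define c where "c t = max 0 (min T t)" for t :: real
  define d where "d n t = real_of_int \<lfloor>t * real (Suc n)\<rfloor> / real (Suc n)" for n and t :: real
  have c: "c t \<in> {0..T}" for t using T by (auto simp: c_def)
  have d_lim: "(\<lambda>n. d n t) \<longlonglongrightarrow> t" for t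
  proof (rule real_tendsto_sandwich[where f = "\<lambda>n. t - 1 / real (Suc n)" and h = "\<lambda>n. t"])
    have "t - 1 / real (Suc n) \<le> d n t" for n
    proof -
      have "t * real (Suc n) - 1 \<le> real_of_int \<lfloor>t * real (Suc n)\<rfloor>" by linarith
      then have "(t * real (Suc n) - 1) / real (Suc n) \<le> d n t"
        unfolding d_def by (intro divide_right_mono) auto
      then show ?thesis by (simp add: diff_divide_distrib)
    qed
    then show "\<forall>\<^sub>F n in sequentially. t - 1 / real (Suc n) \<le> d n t" by simp
    have "d n t \<le> t" for n
    proof -
      have "d n t \<le> (t * real (Suc n)) / real (Suc n)"
        unfolding d_def by (intro divide_right_mono) auto
      then show ?thesis by simp
    qed
    then show "\<forall>\<^sub>F n in sequentially. d n t \<le> t" by simp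
    show "(\<lambda>n. t - 1 / real (Suc n)) \<longlonglongrightarrow> t"
      using tendsto_diff[OF tendsto_const[of t] LIMSEQ_inverse_real_of_nat] by (simp add: inverse_eq_divide)
  qed simp
  have "(\<lambda>(t, \<omega>). f (c t) \<omega>) \<in> borel_measurable (borel \<Otimes>\<^sub>M N)"
  proof (rule borel_measurable_LIMSEQ_metric)
    fix n :: nat
    have "(\<lambda>x. (\<lambda>i x. f (c (real_of_int i / real (Suc n))) (snd x)) (\<lfloor>fst x * real (Suc n)\<rfloor>) x)
      \<in> borel_measurable (borel \<Otimes>\<^sub>M N)"
    proof (rule measurable_compose_countable[where f = "\<lambda>i x. f (c (real_of_int i / real (Suc n))) (snd x)" and g = "\<lambda>x. \<lfloor>fst x * real (Suc n)\<rfloor>"])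
      fix i :: int
      have "f (c (real_of_int i / real (Suc n))) \<in> borel_measurable N"
        by (rule meas) (rule c)
      then show "(\<lambda>x. f (c (real_of_int i / real (Suc n))) (snd x)) \<in> borel_measurable (borel \<Otimes>\<^sub>M N)"
        by measurable
    qed measurable
    then show "(\<lambda>(t, \<omega>). f (c (d n t)) \<omega>) \<in> borel_measurable (borel \<Otimes>\<^sub>M N)"
      by (simp add: case_prod_beta' d_def)
  next
    fix x :: "real \<times> 'a" assume "x \<in> space (borel \<Otimes>\<^sub>M N)"
    then obtain t \<omega> where x: "x = (t, \<omega>)" "\<omega> \<in> space N" by (auto simp: space_pair_measure)
    have "(\<lambda>n. c (d n t)) \<longlonglongrightarrow> c t"
      unfolding c_def by (intro tendsto_intros d_lim)
    then have "(\<lambda>n. f (c (d n t)) \<omega>) \<longlonglongrightarrow> f (c t) \<omega>"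
      using continuous_on_tendsto_compose[OF cont[OF x(2)], of "\<lambda>n. c (d n t)" "c t" sequentially] c by auto
    then show "(\<lambda>n. (\<lambda>(t, \<omega>). f (c (d n t)) \<omega>) x) \<longlonglongrightarrow> (\<lambda>(t, \<omega>). f (c t) \<omega>) x"
      by (simp add: x)
  qed
  then have "(\<lambda>x. indicator {0..T} (fst x) *\<^sub>R (\<lambda>(t, \<omega>). f (c t) \<omega>) x) \<in> borel_measurable (borel \<Otimes>\<^sub>M N)"
    by measurable
  moreover have "indicator {0..T} (fst x) *\<^sub>R (\<lambda>(t, \<omega>). f (c t) \<omega>) x =
     (\<lambda>(t, \<omega>). indicator {0..T} t *\<^sub>R f t \<omega>) x" for x
    by (auto simp: indicator_def c_def split: prod.splits)
  ultimately show ?thesis by simp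
qed

lemma integral_eq_lborel_integral:
  fixes g :: "real \<Rightarrow> 'b::euclidean_space"
  assumes "continuous_on {a..b} g"
  shows "integral {a..b} g = (\<integral>t. indicator {a..b} t *\<^sub>R g t \<partial>lborel)"
  using set_borel_integral_eq_integral(2)[OF borel_integrable_atLeastAtMost'[OF assms]]
  by (simp add: set_lebesgue_integral_def)

lemma borel_measurable_integral_continuous_process:
  fixes f :: "real \<Rightarrow> 'a \<Rightarrow> 'b::euclidean_space"
  assumes T: "0 \<le> T"
    and meas: "\<And>t. t \<in> {0..T} \<Longrightarrow> f t \<in> borel_measurable N"
    and cont: "\<And>\<omega>. \<omega> \<in> space N \<Longrightarrow> continuous_on {0..T} (\<lambda>t. f t \<omega>)"
  shows "(\<lambda>\<omega>. integral {0..T} (\<lambda>t. f t \<omega>)) \<in> borel_measurable N"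
proof -
  have "(\<lambda>(t, \<omega>). indicator {0..T} t *\<^sub>R f t \<omega>) \<in> borel_measurable (borel \<Otimes>\<^sub>M N)"
    by (rule borel_measurable_continuous_process[OF T meas cont])
  then have "(\<lambda>(\<omega>, t). indicator {0..T} t *\<^sub>R f t \<omega>) \<in> borel_measurable (N \<Otimes>\<^sub>M borel)"
    by (subst (asm) measurable_pair_swap_iff) simp
  then have "(\<lambda>(\<omega>, t). indicator {0..T} t *\<^sub>R f t \<omega>) \<in> borel_measurable (N \<Otimes>\<^sub>M lborel)"
    by (simp cong: measurable_cong_sets)
  then have "(\<lambda>\<omega>. \<integral>t. indicator {0..T} t *\<^sub>R f t \<omega> \<partial>lborel) \<in> borel_measurable N"
    by (rule lborel.borel_measurable_lebesgue_integral)
  then show ?thesis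
    by (subst measurable_cong[OF integral_eq_lborel_integral]) (auto intro: cont)
qed

lemma (in prob_space) norm_expectation_le:
  fixes X :: "'a \<Rightarrow> 'b::{banach, second_countable_topology}"
  assumes [measurable]: "X \<in> borel_measurable M" and C: "AE \<omega> in M. norm (X \<omega>) \<le> C"
  shows "integrable M X" "norm (expectation X) \<le> C"
proof -
  show i: "integrable M X"
    by (rule integrable_const_bound[OF C]) simp
  have "norm (expectation X) \<le> expectation (\<lambda>\<omega>. norm (X \<omega>))" by (rule integral_norm_bound)
  also have "\<dots> \<le> expectation (\<lambda>\<omega>. C)" using i C by (intro integral_mono_AE) auto
  finally show "norm (expectation X) \<le> C" by (simp add: prob_space)
qed

lemma (in prob_space) expectation_integral_continuous_process:
  fixes f :: "real \<Rightarrow> 'a \<Rightarrow> 'b::euclidean_space"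
  assumes T: "0 \<le> T"
    and meas: "\<And>t. t \<in> {0..T} \<Longrightarrow> f t \<in> borel_measurable M"
    and cont: "\<And>\<omega>. \<omega> \<in> space M \<Longrightarrow> continuous_on {0..T} (\<lambda>t. f t \<omega>)"
    and C: "AE \<omega> in M. \<forall>t\<in>{0..T}. norm (f t \<omega>) \<le> C"
  shows "continuous_on {0..T} (\<lambda>t. expectation (f t))"
    and "expectation (\<lambda>\<omega>. integral {0..T} (\<lambda>t. f t \<omega>)) = integral {0..T} (\<lambda>t. expectation (f t))"
proof -
  have bd: "AE \<omega> in M. norm (f t \<omega>) \<le> C" if "t \<in> {0..T}" for t
    using C by eventually_elim (use that in auto)
  show ce: "continuous_on {0..T} (\<lambda>t. expectation (f t))"
    unfolding continuous_on_sequentially comp_def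
  proof (intro allI ballI impI, elim conjE)
    fix u t assume t: "t \<in> {0..T}" and u: "\<forall>n. u n \<in> {0..T}" "u \<longlonglongrightarrow> t"
    show "(\<lambda>n. expectation (f (u n))) \<longlonglongrightarrow> expectation (f t)"
    proof (rule integral_dominated_convergence[where w = "\<lambda>_. C"])
      show "AE \<omega> in M. (\<lambda>n. f (u n) \<omega>) \<longlonglongrightarrow> f t \<omega>"
        using continuous_on_tendsto_compose[OF cont, of _ u t sequentially] t u by (intro AE_I2) auto
    qed (use meas t u bd in auto)
  qed
  interpret P: pair_sigma_finite lborel M
    by unfold_locales
  define g where "g = (\<lambda>(t, \<omega>). indicator {0..T} t *\<^sub>R f t \<omega>)"
  have g: "g \<in> borel_measurable (lborel \<Otimes>\<^sub>M M)"
    using borel_measurable_continuous_process[OF T meas cont] unfolding g_def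
    by (simp cong: measurable_cong_sets)
  have "integrable (lborel \<Otimes>\<^sub>M M) g"
    unfolding integrable_iff_bounded
  proof (intro conjI g)
    have "(\<integral>\<^sup>+x. ennreal (norm (g x)) \<partial>(lborel \<Otimes>\<^sub>M M)) = (\<integral>\<^sup>+t. \<integral>\<^sup>+\<omega>. ennreal (norm (g (t, \<omega>))) \<partial>M \<partial>lborel)"
      using g by (subst nn_integral_fst[symmetric]) auto
    also have "\<dots> \<le> (\<integral>\<^sup>+t. ennreal C * indicator {0..T} t \<partial>lborel)"
    proof (intro nn_integral_mono)
      fix t
      show "(\<integral>\<^sup>+\<omega>. ennreal (norm (g (t, \<omega>))) \<partial>M) \<le> ennreal C * indicator {0..T} t"
      proof (cases "t \<in> {0..T}")
        case True
        have "(\<integral>\<^sup>+\<omega>. ennreal (norm (g (t, \<omega>))) \<partial>M) \<le> (\<integral>\<^sup>+\<omega>. ennreal C \<partial>M)"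
          by (rule nn_integral_mono_AE, use bd[OF True] in eventually_elim)
             (use True in \<open>auto simp: g_def intro: ennreal_leI\<close>)
        then show ?thesis using True by (simp add: emeasure_space_1)
      qed (simp add: g_def)
    qed
    also have "\<dots> = ennreal C * ennreal T" using T by (simp add: nn_integral_cmult_indicator)
    also have "\<dots> < \<infinity>" by (simp add: ennreal_mult_less_top)
    finally show "(\<integral>\<^sup>+x. ennreal (norm (g x)) \<partial>(lborel \<Otimes>\<^sub>M M)) < \<infinity>" .
  qed
  then have "integrable (lborel \<Otimes>\<^sub>M M) (\<lambda>(t, \<omega>). g (t, \<omega>))" by simp
  then have "(\<integral>\<omega>. (\<integral>t. g (t, \<omega>) \<partial>lborel) \<partial>M) = (\<integral>t. (\<integral>\<omega>. g (t, \<omega>) \<partial>M) \<partial>lborel)"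
    by (rule P.Fubini_integral)
  also have "(\<integral>\<omega>. (\<integral>t. g (t, \<omega>) \<partial>lborel) \<partial>M) = expectation (\<lambda>\<omega>. integral {0..T} (\<lambda>t. f t \<omega>))"
    by (intro Bochner_Integration.integral_cong refl)
       (simp add: g_def integral_eq_lborel_integral[OF cont])
  also have "(\<integral>t. (\<integral>\<omega>. g (t, \<omega>) \<partial>M) \<partial>lborel) = integral {0..T} (\<lambda>t. expectation (f t))"
    by (subst integral_eq_lborel_integral[OF ce]) (simp add: g_def)
  finally show "expectation (\<lambda>\<omega>. integral {0..T} (\<lambda>t. f t \<omega>)) = integral {0..T} (\<lambda>t. expectation (f t))" .
qed

lemma (in prob_space) nn_integral_integral_continuous_process_le:
  fixes f :: "real \<Rightarrow> 'a \<Rightarrow> real"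
  assumes T: "0 \<le> T"
    and meas: "\<And>t. t \<in> {0..T} \<Longrightarrow> f t \<in> borel_measurable M"
    and cont: "\<And>\<omega>. \<omega> \<in> space M \<Longrightarrow> continuous_on {0..T} (\<lambda>t. f t \<omega>)"
    and nonneg: "\<And>t \<omega>. 0 \<le> f t \<omega>"
    and C: "\<And>t. t \<in> {0..T} \<Longrightarrow> (\<integral>\<^sup>+\<omega>. ennreal (f t \<omega>) \<partial>M) \<le> ennreal C"
  shows "(\<integral>\<^sup>+\<omega>. ennreal (integral {0..T} (\<lambda>t. f t \<omega>)) \<partial>M) \<le> ennreal (C * T)"
proof -
  interpret P: pair_sigma_finite lborel M
    by unfold_locales
  define g where "g = (\<lambda>(t, \<omega>). indicator {0..T} t *\<^sub>R f t \<omega>)"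
  have g: "g \<in> borel_measurable (lborel \<Otimes>\<^sub>M M)"
    using borel_measurable_continuous_process[OF T meas cont] unfolding g_def
    by (simp cong: measurable_cong_sets)
  have "(\<integral>\<^sup>+\<omega>. ennreal (integral {0..T} (\<lambda>t. f t \<omega>)) \<partial>M) = (\<integral>\<^sup>+\<omega>. \<integral>\<^sup>+t. ennreal (g (t, \<omega>)) \<partial>lborel \<partial>M)"
  proof (rule nn_integral_cong)
    fix \<omega> assume \<omega>: "\<omega> \<in> space M"
    have "integrable lborel (\<lambda>t. g (t, \<omega>))"
      using borel_integrable_atLeastAtMost'[OF cont[OF \<omega>]] by (simp add: set_integrable_def g_def)
    then show "ennreal (integral {0..T} (\<lambda>t. f t \<omega>)) = (\<integral>\<^sup>+t. ennreal (g (t, \<omega>)) \<partial>lborel)"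
      by (subst nn_integral_eq_integral) (auto simp: g_def nonneg integral_eq_lborel_integral[OF cont[OF \<omega>]])
  qed
  also have "\<dots> = (\<integral>\<^sup>+t. \<integral>\<^sup>+\<omega>. ennreal (g (t, \<omega>)) \<partial>M \<partial>lborel)"
    using P.Fubini'[of "\<lambda>t \<omega>. ennreal (g (t, \<omega>))"] g by (simp add: case_prod_beta')
  also have "\<dots> \<le> (\<integral>\<^sup>+t. ennreal C * indicator {0..T} t \<partial>lborel)"
  proof (intro nn_integral_mono)
    fix t
    show "(\<integral>\<^sup>+\<omega>. ennreal (g (t, \<omega>)) \<partial>M) \<le> ennreal C * indicator {0..T} t"
      using C[of t] by (cases "t \<in> {0..T}") (auto simp: g_def)
  qed
  also have "\<dots> = ennreal (C * T)" using T by (simp add: nn_integral_cmult_indicator ennreal_mult'')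
  finally show ?thesis .
qed

section \<open>Wiener processes relative to a filtration\<close>

text \<open>Independence depends on events only up to null sets. Together with the next lemma this allows null sets to be added to
the \<sigma>-algebras of the Wiener processes.\<close>

lemma (in prob_space) indep_sets_AE_cong:
  assumes ind: "indep_sets E I"
    and ev: "\<And>i. i \<in> I \<Longrightarrow> E' i \<subseteq> events"
    and eq: "\<And>i A. i \<in> I \<Longrightarrow> A \<in> E' i \<Longrightarrow> \<exists>B\<in>E i. AE \<omega> in M. \<omega> \<in> A \<longleftrightarrow> \<omega> \<in> B"
  shows "indep_sets E' I"
proof (rule indep_setsI)
  fix A J assume J: "J \<noteq> {}" "J \<subseteq> I" "finite J" "\<forall>j\<in>J. A j \<in> E' j"
  have "\<forall>j\<in>J. \<exists>B. B \<in> E j \<and> (AE \<omega> in M. \<omega> \<in> A j \<longleftrightarrow> \<omega> \<in> B)"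
    using eq J by (meson subsetD)
  then obtain B where B: "\<And>j. j \<in> J \<Longrightarrow> B j \<in> E j" "\<And>j. j \<in> J \<Longrightarrow> AE \<omega> in M. \<omega> \<in> A j \<longleftrightarrow> \<omega> \<in> B j"
    by metis
  have Bev: "B j \<in> events" if "j \<in> J" for j
    using ind B(1)[OF that] that J by (auto simp: indep_sets_def)
  have Aev: "A j \<in> events" if "j \<in> J" for j
    using that J ev by blast
  have "AE \<omega> in M. \<forall>j\<in>J. \<omega> \<in> A j \<longleftrightarrow> \<omega> \<in> B j"
    using J B(2) by (intro AE_finite_allI) auto
  then have "prob (\<Inter>j\<in>J. A j) = prob (\<Inter>j\<in>J. B j)"
    using J Aev Bev by (intro finite_measure_eq_AE) (auto elim!: eventually_mono intro!: sets.finite_INT)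
  also have "\<dots> = (\<Prod>j\<in>J. prob (B j))"
    using J B by (intro indep_setsD[OF ind]) auto
  also have "\<dots> = (\<Prod>j\<in>J. prob (A j))"
  proof (intro prod.cong refl finite_measure_eq_AE)
    fix j assume "j \<in> J"
    then show "AE \<omega> in M. \<omega> \<in> B j \<longleftrightarrow> \<omega> \<in> A j" using B(2)[of j] by (auto elim!: eventually_mono)
  qed (use Aev Bev in auto)
  finally show "prob (\<Inter>j\<in>J. A j) = (\<Prod>j\<in>J. prob (A j))" .
qed (use ev in auto)

text \<open>The events that agree almost everywhere with an event of the \<sigma>-algebra generated by \<open>G\<close> are closed under the
operations of a \<sigma>-algebra.\<close>

lemma sigma_sets_null_sets_AE_eq:
  assumes "A \<in> sigma_sets (space M) (G \<union> null_sets M)"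
  shows "\<exists>B\<in>sigma_sets (space M) G. AE \<omega> in M. \<omega> \<in> A \<longleftrightarrow> \<omega> \<in> B"
  using assms
proof induction
  case (Basic a)
  show ?case
  proof (cases "a \<in> G")
    case False
    then have "a \<in> null_sets M" using Basic by auto
    then have "AE \<omega> in M. \<omega> \<notin> a" by (rule AE_not_in)
    then show ?thesis by (intro bexI[of _ "{}"]) (auto intro: sigma_sets.Empty)
  qed (auto intro: sigma_sets.Basic)
next
  case Empty
  show ?case by (intro bexI[of _ "{}"]) (auto intro: sigma_sets.Empty)
next
  case (Compl a)
  then obtain B where B: "B \<in> sigma_sets (space M) G" "AE \<omega> in M. \<omega> \<in> a \<longleftrightarrow> \<omega> \<in> B" by auto
  then show ?case
    by (intro bexI[of _ "space M - B"]) (auto intro: sigma_sets.Compl elim!: eventually_mono)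
next
  case (Union a)
  then obtain B where B: "\<And>i::nat. B i \<in> sigma_sets (space M) G" "\<And>i. AE \<omega> in M. \<omega> \<in> a i \<longleftrightarrow> \<omega> \<in> B i"
    by metis
  have "AE \<omega> in M. \<forall>i. \<omega> \<in> a i \<longleftrightarrow> \<omega> \<in> B i" using B(2) by (subst AE_all_countable) auto
  then show ?case
    by (intro bexI[of _ "\<Union>i. B i"]) (auto intro!: sigma_sets.Union B(1) elim!: eventually_mono)
qed

lemma (in prob_space) normal_increment_moments:
  fixes X :: "'a \<Rightarrow> real"
  assumes D: "distributed M lborel X (normal_density 0 (sqrt v))" and v: "0 < v"
  shows "integrable M (\<lambda>\<omega>. X \<omega> ^ 4)" "expectation X = 0" "expectation (\<lambda>\<omega>. X \<omega> ^ 2) = v"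
    "expectation (\<lambda>\<omega>. X \<omega> ^ 4) = 3 * v\<^sup>2"
proof -
  have s: "0 < sqrt v" using v by simp
  have int: "expectation (\<lambda>\<omega>. X \<omega> ^ k) = (\<integral>x. normal_density 0 (sqrt v) x * x ^ k \<partial>lborel)" for k
    by (subst distributed_integral[OF D, symmetric]) auto
  have eq: "integrable M (\<lambda>\<omega>. X \<omega> ^ k)" for k
    by (subst distributed_integrable[OF D, symmetric])
       (use integrable_normal_moment[OF s, of 0 k] in auto)
  show "integrable M (\<lambda>\<omega>. X \<omega> ^ 4)" by (rule eq)
  show "expectation X = 0"
    using int[of 1] integral_normal_moment_nz_1[OF s, of 0] by simp
  show "expectation (\<lambda>\<omega>. X \<omega> ^ 2) = v"
    using int[of 2] integral_normal_moment_even[OF s, of 0 1] v by simp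
  show "expectation (\<lambda>\<omega>. X \<omega> ^ 4) = 3 * v\<^sup>2"
  proof -
    have "fact (2 * 2) / ((2 / v) ^ 2 * fact 2) = 3 * (v\<^sup>2::real)"
      using v by (simp add: fact_numeral power2_eq_square field_simps)
    then show ?thesis using int[of 4] integral_normal_moment_even[OF s, of 0 2] v by simp
  qed
qed

text \<open>One real coordinate \<open>B\<close> of a Wiener process, relative to a filtration \<open>F\<close> that may be larger than the
one of \<open>B\<close>: below, \<open>F\<close> is generated by several processes, and \<open>B\<close> belongs to one of them.\<close>

locale filtered_wiener = prob_space M for M :: "'w measure" +
  fixes T :: real and F :: "real \<Rightarrow> 'w measure" and B :: "real \<Rightarrow> 'w \<Rightarrow> real"
  assumes space_F: "\<And>t. t \<in> {0..T} \<Longrightarrow> space (F t) = space M"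
    and sets_F: "\<And>t. t \<in> {0..T} \<Longrightarrow> sets (F t) \<subseteq> sets M"
    and F_mono: "\<And>s t. 0 \<le> s \<Longrightarrow> s \<le> t \<Longrightarrow> t \<le> T \<Longrightarrow> sets (F s) \<subseteq> sets (F t)"
    and adapted: "\<And>t. t \<in> {0..T} \<Longrightarrow> B t \<in> borel_measurable (F t)"
    and indep_increment: "\<And>s t. 0 \<le> s \<Longrightarrow> s < t \<Longrightarrow> t \<le> T \<Longrightarrow>
      indep_set (sets (F s)) {(\<lambda>\<omega>. B t \<omega> - B s \<omega>) -` A \<inter> space M | A. A \<in> sets borel}"
    and normal_increment: "\<And>s t. 0 \<le> s \<Longrightarrow> s < t \<Longrightarrow> t \<le> T \<Longrightarrow>
      distributed M lborel (\<lambda>\<omega>. B t \<omega> - B s \<omega>) (normal_density 0 (sqrt (t - s)))"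
begin

lemma measurable_from_F:
  assumes "X \<in> measurable (F t) N" "t \<in> {0..T}"
  shows "X \<in> measurable M N"
  using measurable_mono[OF order.refl refl sets_F[OF assms(2)] space_F[OF assms(2)], of N] assms(1) by auto

lemma measurable_F_mono:
  assumes "X \<in> measurable (F s) N" "0 \<le> s" "s \<le> t" "t \<le> T"
  shows "X \<in> measurable (F t) N"
  using measurable_mono[OF order.refl refl F_mono[OF assms(2-4)], of N] assms space_F[of s] space_F[of t] by auto

lemma indep_var_increment:
  assumes \<xi>: "\<xi> \<in> borel_measurable (F s)" and "0 \<le> s" "s < t" "t \<le> T"
  shows "indep_var borel \<xi> borel (\<lambda>\<omega>. B t \<omega> - B s \<omega>)"
proof -
  have st: "s \<in> {0..T}" "t \<in> {0..T}" using assms by auto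
  have B: "B s \<in> borel_measurable M" "B t \<in> borel_measurable M"
    using measurable_from_F[OF adapted] st by auto
  have "indep_sets (case_bool (sets (F s)) {(\<lambda>\<omega>. B t \<omega> - B s \<omega>) -` A \<inter> space M | A. A \<in> sets borel}) UNIV"
    using indep_increment[OF assms(2-4)] by (simp add: indep_set_def)
  then have "indep_sets (\<lambda>i. {case_bool \<xi> (\<lambda>\<omega>. B t \<omega> - B s \<omega>) i -` A \<inter> space M |A. A \<in> sets (case_bool borel borel i)}) UNIV"
    by (rule indep_sets_mono_sets)
       (use measurable_sets[OF \<xi>] space_F[OF st(1)] in \<open>auto split: bool.splits\<close>)
  moreover have "\<xi> \<in> borel_measurable M" using measurable_from_F[OF \<xi> st(1)] .
  ultimately show ?thesis
    unfolding indep_var_def indep_vars_def2 using B by (auto split: bool.splits)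
qed

lemma increment_moments:
  assumes "0 \<le> s" "s \<le> t" "t \<le> T"
  shows "integrable M (\<lambda>\<omega>. (B t \<omega> - B s \<omega>) ^ 4)" "integrable M (\<lambda>\<omega>. (B t \<omega> - B s \<omega>) ^ 2)"
    "integrable M (\<lambda>\<omega>. B t \<omega> - B s \<omega>)"
    "expectation (\<lambda>\<omega>. B t \<omega> - B s \<omega>) = 0" "expectation (\<lambda>\<omega>. (B t \<omega> - B s \<omega>) ^ 2) = t - s"
    "expectation (\<lambda>\<omega>. (B t \<omega> - B s \<omega>) ^ 4) = 3 * (t - s)\<^sup>2"
proof -
  have B: "B s \<in> borel_measurable M" "B t \<in> borel_measurable M"
    using measurable_from_F[OF adapted] assms by auto
  have *: "integrable M (\<lambda>\<omega>. (B t \<omega> - B s \<omega>) ^ 4) \<and> expectation (\<lambda>\<omega>. B t \<omega> - B s \<omega>) = 0 \<and>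
    expectation (\<lambda>\<omega>. (B t \<omega> - B s \<omega>) ^ 2) = t - s \<and> expectation (\<lambda>\<omega>. (B t \<omega> - B s \<omega>) ^ 4) = 3 * (t - s)\<^sup>2"
  proof (cases "s = t")
    case False
    then show ?thesis using normal_increment_moments[OF normal_increment[of s t]] assms by auto
  qed simp
  then show "integrable M (\<lambda>\<omega>. (B t \<omega> - B s \<omega>) ^ 4)"
    "expectation (\<lambda>\<omega>. B t \<omega> - B s \<omega>) = 0" "expectation (\<lambda>\<omega>. (B t \<omega> - B s \<omega>) ^ 2) = t - s"
    "expectation (\<lambda>\<omega>. (B t \<omega> - B s \<omega>) ^ 4) = 3 * (t - s)\<^sup>2" by auto
  show "integrable M (\<lambda>\<omega>. (B t \<omega> - B s \<omega>) ^ 2)" "integrable M (\<lambda>\<omega>. B t \<omega> - B s \<omega>)"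
    using * B integrable_power_of_fourth[of "\<lambda>\<omega>. B t \<omega> - B s \<omega>" 2] integrable_power_of_fourth[of "\<lambda>\<omega>. B t \<omega> - B s \<omega>" 1]
    by auto
qed

lemma expectation_mult_increment:
  assumes \<xi>: "\<xi> \<in> borel_measurable (F s)" "integrable M \<xi>" and st: "0 \<le> s" "s \<le> t" "t \<le> T"
  shows "integrable M (\<lambda>\<omega>. \<xi> \<omega> * (B t \<omega> - B s \<omega>))" "expectation (\<lambda>\<omega>. \<xi> \<omega> * (B t \<omega> - B s \<omega>)) = 0"
proof -
  have "integrable M (\<lambda>\<omega>. \<xi> \<omega> * (B t \<omega> - B s \<omega>)) \<and> expectation (\<lambda>\<omega>. \<xi> \<omega> * (B t \<omega> - B s \<omega>)) = 0"
  proof (cases "s = t")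
    case False
    then have iv: "indep_var borel \<xi> borel (\<lambda>\<omega>. B t \<omega> - B s \<omega>)"
      using \<xi> st by (intro indep_var_increment) auto
    show ?thesis
      using indep_var_integrable[OF iv \<xi>(2)] indep_var_lebesgue_integral[OF iv \<xi>(2)] increment_moments[OF st] by auto
  qed simp
  then show "integrable M (\<lambda>\<omega>. \<xi> \<omega> * (B t \<omega> - B s \<omega>))" "expectation (\<lambda>\<omega>. \<xi> \<omega> * (B t \<omega> - B s \<omega>)) = 0"
    by auto
qed

lemma expectation_mult_increment_square:
  assumes \<xi>: "\<xi> \<in> borel_measurable (F s)" "integrable M (\<lambda>\<omega>. \<xi> \<omega> ^ 2)" and st: "0 \<le> s" "s \<le> t" "t \<le> T"
  shows "integrable M (\<lambda>\<omega>. (\<xi> \<omega> * (B t \<omega> - B s \<omega>)) ^ 2)"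
    "expectation (\<lambda>\<omega>. (\<xi> \<omega> * (B t \<omega> - B s \<omega>)) ^ 2) = expectation (\<lambda>\<omega>. \<xi> \<omega> ^ 2) * (t - s)"
proof -
  have "integrable M (\<lambda>\<omega>. (\<xi> \<omega> * (B t \<omega> - B s \<omega>)) ^ 2) \<and>
    expectation (\<lambda>\<omega>. (\<xi> \<omega> * (B t \<omega> - B s \<omega>)) ^ 2) = expectation (\<lambda>\<omega>. \<xi> \<omega> ^ 2) * (t - s)"
  proof (cases "s = t")
    case False
    then have "indep_var borel \<xi> borel (\<lambda>\<omega>. B t \<omega> - B s \<omega>)"
      using \<xi> st by (intro indep_var_increment) auto
    then have iv: "indep_var borel (\<lambda>\<omega>. \<xi> \<omega> ^ 2) borel (\<lambda>\<omega>. (B t \<omega> - B s \<omega>) ^ 2)"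
      using indep_var_compose[of borel \<xi> borel "\<lambda>\<omega>. B t \<omega> - B s \<omega>" "\<lambda>x. x ^ 2" borel "\<lambda>x. x ^ 2" borel] by (simp add: comp_def)
    show ?thesis
      using indep_var_integrable[OF iv \<xi>(2)] indep_var_lebesgue_integral[OF iv \<xi>(2)] increment_moments[OF st]
      by (auto simp: power_mult_distrib)
  qed simp
  then show "integrable M (\<lambda>\<omega>. (\<xi> \<omega> * (B t \<omega> - B s \<omega>)) ^ 2)"
    "expectation (\<lambda>\<omega>. (\<xi> \<omega> * (B t \<omega> - B s \<omega>)) ^ 2) = expectation (\<lambda>\<omega>. \<xi> \<omega> ^ 2) * (t - s)" by auto
qed

text \<open>The Ito isometry. In a mixed term, the increment over the later interval has mean zero and is independent of the three
other factors. The index set carries no order, so that the pairs of cells of two partitions can serve as indices.\<close>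

lemma isometry_disjoint_intervals:
  fixes a b :: "'i \<Rightarrow> real" and \<eta> :: "'i \<Rightarrow> 'w \<Rightarrow> real"
  assumes fin: "finite I"
    and ab: "\<And>i. i \<in> I \<Longrightarrow> 0 \<le> a i" "\<And>i. i \<in> I \<Longrightarrow> a i \<le> b i" "\<And>i. i \<in> I \<Longrightarrow> b i \<le> T"
    and disj: "\<And>i j. i \<in> I \<Longrightarrow> j \<in> I \<Longrightarrow> i \<noteq> j \<Longrightarrow> b i \<le> a j \<or> b j \<le> a i"
    and \<eta>: "\<And>i. i \<in> I \<Longrightarrow> \<eta> i \<in> borel_measurable (F (a i))" "\<And>i. i \<in> I \<Longrightarrow> integrable M (\<lambda>\<omega>. \<eta> i \<omega> ^ 2)"
  shows "integrable M (\<lambda>\<omega>. (\<Sum>i\<in>I. \<eta> i \<omega> * (B (b i) \<omega> - B (a i) \<omega>)) ^ 2)"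
    "expectation (\<lambda>\<omega>. (\<Sum>i\<in>I. \<eta> i \<omega> * (B (b i) \<omega> - B (a i) \<omega>)) ^ 2) =
      (\<Sum>i\<in>I. expectation (\<lambda>\<omega>. \<eta> i \<omega> ^ 2) * (b i - a i))"
proof -
  define X where "X i \<omega> = \<eta> i \<omega> * (B (b i) \<omega> - B (a i) \<omega>)" for i \<omega>
  have aT: "a i \<in> {0..T}" "b i \<in> {0..T}" if "i \<in> I" for i using ab[OF that] by auto
  have X2: "integrable M (\<lambda>\<omega>. X i \<omega> ^ 2)" "expectation (\<lambda>\<omega>. X i \<omega> ^ 2) = expectation (\<lambda>\<omega>. \<eta> i \<omega> ^ 2) * (b i - a i)"
    if "i \<in> I" for i
    using expectation_mult_increment_square[OF \<eta>[OF that] ab[OF that]] by (auto simp: X_def)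
  have Xb: "X i \<in> borel_measurable (F (b i))" if "i \<in> I" for i
    unfolding X_def using that ab[OF that] \<eta> aT[OF that]
    by (auto intro!: borel_measurable_times borel_measurable_diff adapted
          measurable_F_mono[of _ "a i" _ "b i"])
  have Xm: "X i \<in> borel_measurable M" if "i \<in> I" for i
    using measurable_from_F[OF Xb aT(2)] that by auto
  have \<eta>m: "\<eta> i \<in> borel_measurable M" if "i \<in> I" for i
    using measurable_from_F[OF \<eta>(1) aT(1)] that by auto
  have ip: "integrable M (\<lambda>\<omega>. U \<omega> * V \<omega>)"
    if m: "U \<in> borel_measurable M" "V \<in> borel_measurable M"
      and s: "integrable M (\<lambda>\<omega>. U \<omega> ^ 2)" "integrable M (\<lambda>\<omega>. V \<omega> ^ 2)" for U V :: "'w \<Rightarrow> real"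
  proof (rule Bochner_Integration.integrable_bound[where f = "\<lambda>\<omega>. U \<omega> ^ 2 + V \<omega> ^ 2"])
    have "\<bar>x * y\<bar> \<le> x\<^sup>2 + y\<^sup>2" for x y :: real
    proof -
      have "2 * \<bar>x * y\<bar> \<le> x\<^sup>2 + y\<^sup>2" using sum_squares_bound[of "\<bar>x\<bar>" "\<bar>y\<bar>"] by (simp add: abs_mult)
      then show ?thesis using abs_ge_zero[of "x * y"] by linarith
    qed
    then show "AE \<omega> in M. norm (U \<omega> * V \<omega>) \<le> norm (U \<omega> ^ 2 + V \<omega> ^ 2)" by simp
  qed (use m s in auto)
  have XX: "integrable M (\<lambda>\<omega>. X i \<omega> * X j \<omega>)" if "i \<in> I" "j \<in> I" for i j
    using that by (intro ip Xm X2)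
  have orth1: "expectation (\<lambda>\<omega>. X i \<omega> * X j \<omega>) = 0" if ij: "i \<in> I" "j \<in> I" "b i \<le> a j" for i j
  proof -
    have "X i \<in> borel_measurable (F (a j))"
      using ij ab[of i] ab[of j] by (intro measurable_F_mono[OF Xb]) auto
    then have "(\<lambda>\<omega>. X i \<omega> * \<eta> j \<omega>) \<in> borel_measurable (F (a j))"
      using \<eta> ij by auto
    moreover have "integrable M (\<lambda>\<omega>. X i \<omega> * \<eta> j \<omega>)"
      using ij by (intro ip Xm \<eta>m X2 \<eta>)
    ultimately have "expectation (\<lambda>\<omega>. X i \<omega> * \<eta> j \<omega> * (B (b j) \<omega> - B (a j) \<omega>)) = 0"
      using ab ij by (intro expectation_mult_increment) auto
    then show ?thesis by (simp add: X_def mult.assoc)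
  qed
  have orth: "expectation (\<lambda>\<omega>. X i \<omega> * X j \<omega>) = 0" if ij: "i \<in> I" "j \<in> I" "i \<noteq> j" for i j
    using disj[OF ij] orth1[of i j] orth1[of j i] ij by (auto simp: mult.commute)
  have eq: "(\<Sum>i\<in>I. X i \<omega>) ^ 2 = (\<Sum>i\<in>I. \<Sum>j\<in>I. X i \<omega> * X j \<omega>)" for \<omega>
    by (simp add: power2_eq_square sum_product)
  have "integrable M (\<lambda>\<omega>. (\<Sum>i\<in>I. X i \<omega>) ^ 2)"
    unfolding eq using XX by (intro Bochner_Integration.integrable_sum)
  then show "integrable M (\<lambda>\<omega>. (\<Sum>i\<in>I. \<eta> i \<omega> * (B (b i) \<omega> - B (a i) \<omega>)) ^ 2)"
    by (simp add: X_def)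
  have "expectation (\<lambda>\<omega>. (\<Sum>i\<in>I. X i \<omega>) ^ 2) = (\<Sum>i\<in>I. \<Sum>j\<in>I. expectation (\<lambda>\<omega>. X i \<omega> * X j \<omega>))"
    unfolding eq using XX by (simp add: Bochner_Integration.integral_sum)
  also have "\<dots> = (\<Sum>i\<in>I. \<Sum>j\<in>I. if j = i then expectation (\<lambda>\<omega>. X i \<omega> ^ 2) else 0)"
    by (intro sum.cong refl) (auto simp: orth power2_eq_square)
  also have "\<dots> = (\<Sum>i\<in>I. expectation (\<lambda>\<omega>. X i \<omega> ^ 2))"
    using fin by (simp add: sum.delta)
  also have "\<dots> = (\<Sum>i\<in>I. expectation (\<lambda>\<omega>. \<eta> i \<omega> ^ 2) * (b i - a i))"
    using X2 by simp
  finally show "expectation (\<lambda>\<omega>. (\<Sum>i\<in>I. \<eta> i \<omega> * (B (b i) \<omega> - B (a i) \<omega>)) ^ 2) =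
      (\<Sum>i\<in>I. expectation (\<lambda>\<omega>. \<eta> i \<omega> ^ 2) * (b i - a i))"
    by (simp add: X_def)
qed

end

section \<open>Independence of the augmented filtrations\<close>

definition past_events :: "'w measure \<Rightarrow> (real \<Rightarrow> 'w \<Rightarrow> real^'r) \<Rightarrow> real \<Rightarrow> 'w set set" where
  "past_events M X t = {X u -` B \<inter> space M | u B. u \<in> {0..t} \<and> B \<in> sets borel}"

lemma past_events_mono: "s \<le> t \<Longrightarrow> past_events M X s \<subseteq> past_events M X t"
  by (force simp: past_events_def)

lemma past_events_subset_Pow: "past_events M X t \<subseteq> Pow (space M)"
  by (auto simp: past_events_def)

lemma measurable_past:
  assumes "u \<in> {0..t}"
  shows "X u \<in> borel_measurable (sigma (space M) (past_events M X t))"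
  using assms past_events_subset_Pow[of M X t]
  by (intro measurableI) (auto simp: sets_measure_of past_events_def intro!: sigma_sets.Basic)

lemma increment_past_event:
  assumes "0 \<le> s" "s \<le> t" "t \<le> T" "A \<in> sets borel"
  shows "(\<lambda>\<omega>. X t \<omega> - X s \<omega>) -` A \<inter> space M \<in> sigma_sets (space M) (past_events M X T)"
proof -
  have "(\<lambda>\<omega>. X t \<omega> - X s \<omega>) \<in> borel_measurable (sigma (space M) (past_events M X T))"
    using assms by (intro borel_measurable_diff measurable_past) auto
  from measurable_sets[OF this assms(4)] show ?thesis
    using past_events_subset_Pow[of M X T] by (simp add: sets_measure_of space_measure_of)
qed

lemma aug_filtration_eq:
  "aug_filtration M W I t = sigma (space M) ((\<Union>i\<in>I. past_events M (W i) t) \<union> null_sets M)"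
proof -
  have "{W i s -` B \<inter> space M | i s B. i \<in> I \<and> s \<in> {0..t} \<and> B \<in> sets borel} = (\<Union>i\<in>I. past_events M (W i) t)"
    by (auto simp: past_events_def)
  then show ?thesis by (simp add: aug_filtration_def)
qed

lemma aug_filtration_gen_subset_Pow: "(\<Union>i\<in>I. past_events M (W i) t) \<union> null_sets M \<subseteq> Pow (space M)"
  using past_events_subset_Pow sets.sets_into_space[of _ M] by (fastforce simp: null_sets_def)

lemma space_aug_filtration: "space (aug_filtration M W I t) = space M"
  by (simp add: aug_filtration_eq space_measure_of[OF aug_filtration_gen_subset_Pow])

lemma sets_aug_filtration:
  "sets (aug_filtration M W I t) = sigma_sets (space M) ((\<Union>i\<in>I. past_events M (W i) t) \<union> null_sets M)"
  by (simp add: aug_filtration_eq sets_measure_of[OF aug_filtration_gen_subset_Pow])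

lemma sets_aug_filtration_mono:
  "I \<subseteq> I' \<Longrightarrow> s \<le> t \<Longrightarrow> sets (aug_filtration M W I s) \<subseteq> sets (aug_filtration M W I' t)"
  unfolding sets_aug_filtration using past_events_mono[of s t M] by (intro sigma_sets_mono') fast

context prob_space
begin

lemma sets_aug_filtration_subset:
  assumes W: "\<And>i. i \<in> I \<Longrightarrow> wiener_process M T (W i)" and "t \<le> T"
  shows "sets (aug_filtration M W I t) \<subseteq> events"
  unfolding sets_aug_filtration
proof (intro sets.sigma_sets_subset Un_least UN_least)
  fix i assume "i \<in> I"
  then show "past_events M (W i) t \<subseteq> events"
    using W[of i] \<open>t \<le> T\<close> by (auto simp: past_events_def wiener_process_def intro!: measurable_sets)
qed auto

text \<open>Evaluation at a time is measurable on the space of paths, so independence of the paths passes to the events of the past.\<close>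

lemma indep_past_events:
  assumes W: "independent_wiener M T W I"
  shows "indep_sets (\<lambda>i. sigma_sets (space M) (past_events M (W i) T)) I"
proof -
  let ?P = "\<lambda>i \<omega>. \<lambda>t\<in>{0..T}. W i t \<omega>"
  have iv: "indep_vars (\<lambda>_. Pi\<^sub>M {0..T} (\<lambda>_. borel)) ?P I"
    using W by (simp add: independent_wiener_def)
  then have "indep_sets (\<lambda>i. sigma_sets (space M) {?P i -` A \<inter> space M | A. A \<in> sets (Pi\<^sub>M {0..T} (\<lambda>_. borel))}) I"
    by (simp add: indep_vars_def)
  then show ?thesis
  proof (rule indep_sets_mono_sets)
    fix i assume "i \<in> I"
    show "sigma_sets (space M) (past_events M (W i) T) \<subseteq>
      sigma_sets (space M) {?P i -` A \<inter> space M | A. A \<in> sets (Pi\<^sub>M {0..T} (\<lambda>_. borel))}"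
    proof (rule sigma_sets_mono, rule subsetI)
      fix x assume "x \<in> past_events M (W i) T"
      then obtain u B where x: "x = W i u -` B \<inter> space M" "u \<in> {0..T}" "B \<in> sets borel"
        by (auto simp: past_events_def)
      define A where "A = (\<lambda>f. f u) -` B \<inter> space (Pi\<^sub>M {0..T} (\<lambda>_. borel :: (real^'b) measure))"
      have "A \<in> sets (Pi\<^sub>M {0..T} (\<lambda>_. borel))"
        unfolding A_def using x by (intro measurable_sets[OF measurable_component_singleton]) auto
      moreover have "x = ?P i -` A \<inter> space M"
        using x by (auto simp: A_def space_PiM)
      ultimately show "x \<in> sigma_sets (space M) {?P i -` A \<inter> space M | A. A \<in> sets (Pi\<^sub>M {0..T} (\<lambda>_. borel))}"
        by (intro sigma_sets.Basic) auto
    qed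
  qed
qed

lemma indep_aug_filtration_singletons:
  assumes W: "independent_wiener M T W I"
  shows "indep_sets (\<lambda>i. sets (aug_filtration M W {i} T)) I"
proof (rule indep_sets_AE_cong[OF indep_past_events[OF W]])
  fix i assume "i \<in> I"
  then show "sets (aug_filtration M W {i} T) \<subseteq> events"
    using W by (intro sets_aug_filtration_subset) (auto simp: independent_wiener_def)
  fix A assume "A \<in> sets (aug_filtration M W {i} T)"
  then show "\<exists>B\<in>sigma_sets (space M) (past_events M (W i) T). AE \<omega> in M. \<omega> \<in> A \<longleftrightarrow> \<omega> \<in> B"
    using sigma_sets_null_sets_AE_eq[of A M "past_events M (W i) T"] by (simp add: sets_aug_filtration)
qed

text \<open>The index 0 belongs to no process and is given to the increment, so that it becomes one more member of the family of
pasts. This family is independent: the Wiener property separates the increment from the past of its own process, and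
independence of the paths separates different processes. Generating \<sigma>-algebras by groups of the family, with the increment as a group of its
own, gives the claim before augmentation, and null sets do no harm.\<close>

lemma indep_aug_filtration_increment:
  assumes W: "independent_wiener M T W {1..}" and I: "I \<subseteq> {1..}" and i: "i \<in> I"
    and st: "0 \<le> s" "s < t" "t \<le> T"
  shows "indep_set (sets (aug_filtration M W I s)) {(\<lambda>\<omega>. W i t \<omega> - W i s \<omega>) -` A \<inter> space M | A. A \<in> sets borel}"
proof -
  have wi: "wiener_process M T (W j)" if "j \<in> I" for j
    using W I that by (auto simp: independent_wiener_def)
  define D where "D = {(\<lambda>\<omega>. W i t \<omega> - W i s \<omega>) -` A \<inter> space M | A. A \<in> sets borel}"
  define P where "P j = sigma_sets (space M) (past_events M (W j) s)" for j
  define E where "E j = (if j = 0 then D else P j)" for j :: nat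
  have ind: "indep_sets (\<lambda>j. sigma_sets (space M) (past_events M (W j) T)) I"
    using indep_sets_mono_index[OF I indep_past_events[OF W]] .
  have PT: "P j \<subseteq> sigma_sets (space M) (past_events M (W j) T)" for j
    unfolding P_def using st by (intro sigma_sets_mono' past_events_mono) auto
  have DT: "D \<subseteq> sigma_sets (space M) (past_events M (W i) T)"
    unfolding D_def using st by (auto intro!: increment_past_event)
  have Tev: "sigma_sets (space M) (past_events M (W j) T) \<subseteq> events" if "j \<in> I" for j
    using ind that by (auto simp: indep_sets_def)
  have indD: "indep_set (P i) D"
    using wi[OF i] st unfolding wiener_process_def P_def D_def past_events_def by auto
  have prodD: "prob (a \<inter> b) = prob a * prob b" if "a \<in> P i" "b \<in> D" for a b
    using indD that by (simp add: indep_sets2_eq)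
  have "indep_sets E (insert 0 I)"
  proof (rule indep_setsI)
    fix j assume "j \<in> insert 0 I"
    then have "j = 0 \<or> j \<in> I" by simp
    then show "E j \<subseteq> events"
      using order_trans[OF PT[of j] Tev[of j]] order_trans[OF DT Tev[OF i]] by (auto simp: E_def)
  next
    fix A J assume J: "J \<noteq> {}" "J \<subseteq> insert 0 I" "finite J" "\<forall>j\<in>J. A j \<in> E j"
    show "prob (\<Inter>j\<in>J. A j) = (\<Prod>j\<in>J. prob (A j))"
    proof (cases "0 \<in> J")
      case False
      then have "J \<subseteq> I" using J by auto
      moreover have "A j \<in> P j" if "j \<in> J" for j
        using J(4) that False by (cases "j = 0") (auto simp: E_def)
      ultimately show ?thesis using J PT by (intro indep_setsD[OF ind]) blast+
    next
      case True
      \<comment> \<open>The indices \<open>0\<close> and \<open>i\<close> are merged into one event of the process \<open>i\<close>; if \<open>i\<close> is not in \<open>J\<close>, the whole space stands in for its event.\<close>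
      define K where "K = J - {0, i}"
      define b where "b = A 0"
      define a where "a = (if i \<in> J then A i else space M)"
      have i0: "i \<noteq> 0" using i I by auto
      have b: "b \<in> D" using J True by (auto simp: E_def b_def)
      have a: "a \<in> P i" using J i0 by (auto simp: E_def a_def P_def sigma_sets_top)
      have K: "finite K" "K \<subseteq> I" "i \<notin> K" "\<forall>j\<in>K. A j \<in> P j" using J by (auto simp: K_def E_def)
      have abT: "a \<inter> b \<in> sigma_sets (space M) (past_events M (W i) T)"
      proof -
        interpret S: sigma_algebra "space M" "sigma_sets (space M) (past_events M (W i) T)"
          by (intro sigma_algebra_sigma_sets past_events_subset_Pow)
        show ?thesis using a b PT DT by blast
      qed
      have ss: "b \<subseteq> space M" using b by (auto simp: D_def)
      have eq: "(\<Inter>j\<in>J. A j) = (\<Inter>j\<in>insert i K. (A(i := a \<inter> b)) j)"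
      proof -
        have "J = insert 0 ((if i \<in> J then {i} else {}) \<union> K)"
          using True by (auto simp: K_def)
        then have "(\<Inter>j\<in>J. A j) = A 0 \<inter> (if i \<in> J then A i else UNIV) \<inter> (\<Inter>j\<in>K. A j)"
          by (smt (verit) INT_Un INT_insert INF_empty Int_assoc empty_iff inf_top.left_neutral insert_is_Un)
        also have "\<dots> = a \<inter> b \<inter> (\<Inter>j\<in>K. A j)" using ss by (auto simp: a_def b_def)
        also have "(\<Inter>j\<in>K. A j) = (\<Inter>j\<in>K. (A(i := a \<inter> b)) j)" using K(3) by (intro INF_cong refl) (metis fun_upd_other)
        finally show ?thesis by (simp only: INF_insert fun_upd_same)
      qed
      have "prob (\<Inter>j\<in>insert i K. (A(i := a \<inter> b)) j) = (\<Prod>j\<in>insert i K. prob ((A(i := a \<inter> b)) j))"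
        using K abT i PT by (intro indep_setsD[OF ind]) auto
      also have "\<dots> = prob (a \<inter> b) * (\<Prod>j\<in>K. prob (A j))"
        using K by (subst prod.insert) (auto intro!: prod.cong)
      also have "prob (a \<inter> b) = prob a * prob b" using prodD a b .
      also have "prob a * prob b * (\<Prod>j\<in>K. prob (A j)) = (\<Prod>j\<in>J. prob (A j))"
      proof -
        have pa: "prob a = (\<Prod>j\<in>J \<inter> {i}. prob (A j))" by (auto simp: a_def prob_space)
        have "J = insert 0 (K \<union> (J \<inter> {i}))" using True by (auto simp: K_def)
        then have "(\<Prod>j\<in>J. prob (A j)) = (\<Prod>j\<in>insert 0 (K \<union> (J \<inter> {i})). prob (A j))" by simp
        also have "\<dots> = prob (A 0) * ((\<Prod>j\<in>K. prob (A j)) * (\<Prod>j\<in>J \<inter> {i}. prob (A j)))"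
          using K i0 J by (subst prod.insert; (subst prod.union_disjoint)?) (auto simp: K_def)
        finally show ?thesis using pa by (simp add: b_def)
      qed
      finally show ?thesis using eq by (simp only:)
    qed
  qed
  then have "indep_sets E (\<Union>b\<in>UNIV. case_bool I {0} b)"
    by (rule back_subst[of "indep_sets E"]) (auto simp: UNIV_bool)
  then have "indep_sets (\<lambda>b. sigma_sets (space M) (\<Union>i\<in>case_bool I {0} b. E i)) UNIV"
  proof (rule indep_sets_collect_sigma)
    have "Int_stable D"
      unfolding D_def Int_stable_def
    proof (intro ballI, clarify)
      fix A A' :: "(real^'b) set" assume "A \<in> sets borel" "A' \<in> sets borel"
      then show "\<exists>C. (\<lambda>\<omega>. W i t \<omega> - W i s \<omega>) -` A \<inter> space M \<inter> ((\<lambda>\<omega>. W i t \<omega> - W i s \<omega>) -` A' \<inter> space M) =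
        (\<lambda>\<omega>. W i t \<omega> - W i s \<omega>) -` C \<inter> space M \<and> C \<in> sets borel"
        by (intro exI[of _ "A \<inter> A'"]) auto
    qed
    moreover have "Int_stable (P j)" for j
    proof -
      interpret S: sigma_algebra "space M" "P j"
        unfolding P_def by (intro sigma_algebra_sigma_sets past_events_subset_Pow)
      show ?thesis by (auto simp: Int_stable_def)
    qed
    ultimately show "Int_stable (E i)" for i by (auto simp: E_def)
    show "disjoint_family_on (case_bool I {0}) UNIV"
      using I by (auto simp: disjoint_family_on_def split: bool.splits)
  qed
  then have ind2: "indep_sets (\<lambda>b. sigma_sets (space M) (\<Union>i\<in>case_bool I {0} b. E i)) UNIV" .
  have "indep_sets (case_bool (sets (aug_filtration M W I s)) D) UNIV"
  proof (rule indep_sets_AE_cong[OF ind2])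
    fix c :: bool
    show "(case c of True \<Rightarrow> sets (aug_filtration M W I s) | False \<Rightarrow> D) \<subseteq> events"
      using sets_aug_filtration_subset[of I T W s] wi st DT Tev[OF i] by (auto split: bool.splits)
    fix A assume A: "A \<in> (case c of True \<Rightarrow> sets (aug_filtration M W I s) | False \<Rightarrow> D)"
    show "\<exists>B\<in>sigma_sets (space M) (\<Union>i\<in>case c of True \<Rightarrow> I | False \<Rightarrow> {0}. E i). AE \<omega> in M. (\<omega> \<in> A) = (\<omega> \<in> B)"
    proof (cases c)
      case True
      then have "A \<in> sigma_sets (space M) ((\<Union>i\<in>I. past_events M (W i) s) \<union> null_sets M)"
        using A by (simp add: sets_aug_filtration)
      from sigma_sets_null_sets_AE_eq[OF this] obtain B where
        B: "B \<in> sigma_sets (space M) (\<Union>i\<in>I. past_events M (W i) s)" "AE \<omega> in M. (\<omega> \<in> A) = (\<omega> \<in> B)" by auto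
      have "past_events M (W j) s \<subseteq> E j" if "j \<in> I" for j
        using that I by (auto simp: E_def P_def intro: sigma_sets.Basic)
      then have "sigma_sets (space M) (\<Union>i\<in>I. past_events M (W i) s) \<subseteq> sigma_sets (space M) (\<Union>i\<in>I. E i)"
        by (intro sigma_sets_mono') blast
      then show ?thesis using B True by auto
    next
      case False
      then show ?thesis using A by (intro bexI[of _ A]) (auto simp: E_def intro: sigma_sets.Basic)
    qed
  qed
  then show ?thesis by (simp add: indep_set_def D_def)
qed

lemma filtered_wiener_component:
  assumes W: "independent_wiener M T W {1..}" and I: "I \<subseteq> {1..}" and i: "i \<in> I"
  shows "filtered_wiener M T (aug_filtration M W I) (\<lambda>t \<omega>. W i t \<omega> $ k)"
proof unfold_locales
  have wi: "wiener_process M T (W j)" if "j \<in> I" for j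
    using W I that by (auto simp: independent_wiener_def)
  show "space (aug_filtration M W I t) = space M" for t
    by (rule space_aug_filtration)
  show "sets (aug_filtration M W I t) \<subseteq> events" if "t \<in> {0..T}" for t
    using that wi by (intro sets_aug_filtration_subset) auto
  show "sets (aug_filtration M W I s) \<subseteq> sets (aug_filtration M W I t)" if "s \<le> t" for s t
    using that by (intro sets_aug_filtration_mono) auto
  show "(\<lambda>\<omega>. W i t \<omega> $ k) \<in> borel_measurable (aug_filtration M W I t)" if "t \<in> {0..T}" for t
  proof -
    have "W i t \<in> borel_measurable (sigma (space M) (past_events M (W i) t))"
      using that by (intro measurable_past) auto
    moreover have "sets (sigma (space M) (past_events M (W i) t)) \<subseteq> sets (aug_filtration M W I t)"
      using i past_events_subset_Pow[of M "W i" t]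
      by (simp add: sets_aug_filtration sets_measure_of) (intro sigma_sets_mono', auto)
    ultimately have "W i t \<in> borel_measurable (aug_filtration M W I t)"
      using measurable_mono[of borel borel "sigma (space M) (past_events M (W i) t)" "aug_filtration M W I t"]
        past_events_subset_Pow[of M "W i" t]
      by (auto simp: space_aug_filtration space_measure_of)
    then show ?thesis by (rule measurable_compose[OF _ borel_measurable_continuous_onI]) (intro continuous_intros)
  qed
  fix s t assume st: "0 \<le> s" "s < t" "t \<le> T"
  have "indep_sets (case_bool (sets (aug_filtration M W I s)) {(\<lambda>\<omega>. W i t \<omega> - W i s \<omega>) -` A \<inter> space M | A. A \<in> sets borel}) UNIV"
    using indep_aug_filtration_increment[OF W I i st] by (simp add: indep_set_def)
  then have "indep_sets (case_bool (sets (aug_filtration M W I s)) {(\<lambda>\<omega>. W i t \<omega> $ k - W i s \<omega> $ k) -` A \<inter> space M | A. A \<in> sets borel}) UNIV"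
  proof (rule indep_sets_mono_sets)
    fix c :: bool
    have "{(\<lambda>\<omega>. W i t \<omega> $ k - W i s \<omega> $ k) -` A \<inter> space M | A. A \<in> sets borel}
      \<subseteq> {(\<lambda>\<omega>. W i t \<omega> - W i s \<omega>) -` A \<inter> space M | A. A \<in> sets borel}"
    proof
      fix x assume "x \<in> {(\<lambda>\<omega>. W i t \<omega> $ k - W i s \<omega> $ k) -` A \<inter> space M | A. A \<in> sets borel}"
      then obtain A where A: "A \<in> sets borel" "x = (\<lambda>\<omega>. W i t \<omega> $ k - W i s \<omega> $ k) -` A \<inter> space M" by auto
      have "(\<lambda>v::real^'b. v $ k) -` A \<inter> space borel \<in> sets borel"
        using A(1) by (intro measurable_sets[of _ borel borel]) auto
      then show "x \<in> {(\<lambda>\<omega>. W i t \<omega> - W i s \<omega>) -` A \<inter> space M | A. A \<in> sets borel}"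
        using A(2) by (auto intro!: exI[of _ "(\<lambda>v. v $ k) -` A"])
    qed
    then show "(case c of True \<Rightarrow> sets (aug_filtration M W I s) | False \<Rightarrow> {(\<lambda>\<omega>. W i t \<omega> $ k - W i s \<omega> $ k) -` A \<inter> space M | A. A \<in> sets borel})
     \<subseteq> (case c of True \<Rightarrow> sets (aug_filtration M W I s) | False \<Rightarrow> {(\<lambda>\<omega>. W i t \<omega> - W i s \<omega>) -` A \<inter> space M | A. A \<in> sets borel})"
      by (cases c) auto
  qed
  then show "indep_set (sets (aug_filtration M W I s)) {(\<lambda>\<omega>. W i t \<omega> $ k - W i s \<omega> $ k) -` A \<inter> space M | A. A \<in> sets borel}"
    by (simp add: indep_set_def)
  show "distributed M lborel (\<lambda>\<omega>. W i t \<omega> $ k - W i s \<omega> $ k) (normal_density 0 (sqrt (t - s)))"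
    using wi[OF i] st unfolding wiener_process_def by simp
qed

end

section \<open>Ito integrals have mean zero\<close>

text \<open>Convergence in \<open>L\<^sup>2\<close> of a probability space implies convergence of the means, here through
\<open>x \<le> e / 2 + x\<^sup>2 / (2 e)\<close>.\<close>

lemma (in prob_space) L2_limit_expectation_zero:
  fixes J :: "'a \<Rightarrow> 'b::euclidean_space"
  assumes J[measurable]: "J \<in> borel_measurable M"
    and X: "\<And>m. integrable M (X m)" "\<And>m. expectation (X m) = 0"
    and lim: "(\<lambda>m. \<integral>\<^sup>+\<omega>. ennreal ((norm (X m \<omega> - J \<omega>))\<^sup>2) \<partial>M) \<longlonglongrightarrow> 0"
  shows "integrable M J" "expectation J = 0"
proof -
  have [measurable]: "X m \<in> borel_measurable M" for m using X(1) by (rule borel_measurable_integrable)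
  have key: "\<exists>m. integrable M (\<lambda>\<omega>. X m \<omega> - J \<omega>) \<and> norm (expectation (\<lambda>\<omega>. X m \<omega> - J \<omega>)) \<le> e" if e: "0 < e" for e
  proof -
    have "\<forall>\<^sub>F m in sequentially. (\<integral>\<^sup>+\<omega>. ennreal ((norm (X m \<omega> - J \<omega>))\<^sup>2) \<partial>M) < ennreal (e\<^sup>2)"
      using e by (intro order_tendstoD(2)[OF lim]) auto
    then obtain m where m: "(\<integral>\<^sup>+\<omega>. ennreal ((norm (X m \<omega> - J \<omega>))\<^sup>2) \<partial>M) < ennreal (e\<^sup>2)"
      using eventually_happens'[OF sequentially_bot] by blast
    define D where "D \<omega> = X m \<omega> - J \<omega>" for \<omega>
    have [measurable]: "D \<in> borel_measurable M" unfolding D_def by measurable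
    have D2: "integrable M (\<lambda>\<omega>. (norm (D \<omega>))\<^sup>2)"
    proof (rule integrableI_bounded)
      show "(\<integral>\<^sup>+\<omega>. ennreal (norm ((norm (D \<omega>))\<^sup>2)) \<partial>M) < \<infinity>"
        using less_trans[OF m ennreal_less_top] by (simp add: D_def)
    qed simp
    have D2e: "expectation (\<lambda>\<omega>. (norm (D \<omega>))\<^sup>2) \<le> e\<^sup>2"
    proof -
      have "ennreal (expectation (\<lambda>\<omega>. (norm (D \<omega>))\<^sup>2)) < ennreal (e\<^sup>2)"
        using m by (subst nn_integral_eq_integral[OF D2, symmetric]) (simp_all add: D_def)
      then show ?thesis by (simp add: ennreal_less_iff)
    qed
    have le: "x \<le> e / 2 + x\<^sup>2 / (2 * e)" for x :: real
    proof -
      have "0 \<le> (x - e)\<^sup>2" by simp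
      then have "x * (2 * e) \<le> e * e + x\<^sup>2" by (simp add: power2_diff power2_eq_square algebra_simps)
      then have "x \<le> (e * e + x\<^sup>2) / (2 * e)" using e by (subst pos_le_divide_eq) auto
      also have "\<dots> = e / 2 + x\<^sup>2 / (2 * e)" using e by (simp add: add_divide_distrib)
      finally show ?thesis .
    qed
    have iD: "integrable M D"
    proof (rule Bochner_Integration.integrable_bound[where f = "\<lambda>\<omega>. e / 2 + (norm (D \<omega>))\<^sup>2 / (2 * e)"])
      show "AE \<omega> in M. norm (D \<omega>) \<le> norm (e / 2 + (norm (D \<omega>))\<^sup>2 / (2 * e))"
        by (intro AE_I2) (unfold real_norm_def, rule order_trans[OF le abs_ge_self])
    qed (use D2 in auto)
    have "norm (expectation D) \<le> expectation (\<lambda>\<omega>. norm (D \<omega>))" by (rule integral_norm_bound)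
    also have "\<dots> \<le> expectation (\<lambda>\<omega>. e / 2 + (norm (D \<omega>))\<^sup>2 / (2 * e))"
    proof (intro integral_mono le)
      show "integrable M (\<lambda>\<omega>. norm (D \<omega>))" using iD by (rule integrable_norm)
      show "integrable M (\<lambda>\<omega>. e / 2 + (norm (D \<omega>))\<^sup>2 / (2 * e))" using D2 by simp
    qed
    also have "\<dots> = e / 2 + expectation (\<lambda>\<omega>. (norm (D \<omega>))\<^sup>2) / (2 * e)"
      using D2 by (simp add: prob_space)
    also have "\<dots> \<le> e / 2 + e\<^sup>2 / (2 * e)"
      using D2e e by (intro add_left_mono divide_right_mono) auto
    also have "\<dots> = e" using e by (simp add: power2_eq_square)
    finally have "integrable M D \<and> norm (expectation D) \<le> e" using iD by blast
    then show ?thesis unfolding D_def[abs_def] by (rule exI)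
  qed
  from key[OF zero_less_one] obtain m where "integrable M (\<lambda>\<omega>. X m \<omega> - J \<omega>)" by (elim exE conjE)
  from Bochner_Integration.integrable_diff[OF X(1)[of m] this]
  show iJ: "integrable M J" by (simp only: diff_diff_eq2 add_diff_cancel_left')
  have le: "norm (expectation J) \<le> e" if e: "0 < e" for e
  proof -
    from key[OF e] obtain m where m: "norm (expectation (\<lambda>\<omega>. X m \<omega> - J \<omega>)) \<le> e" by (elim exE conjE)
    have "expectation (\<lambda>\<omega>. X m \<omega> - J \<omega>) = - expectation J"
      unfolding Bochner_Integration.integral_diff[OF X(1) iJ] X(2) by (rule diff_0)
    then show ?thesis using m by (simp only: norm_minus_cancel)
  qed
  have "norm (expectation J) \<le> 0" by (rule field_le_epsilon) (simp only: add_0 le)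
  then show "expectation J = 0" by (simp only: norm_le_zero_iff)
qed

context filtered_wiener
begin

text \<open>Each coefficient is independent of the increment that it multiplies, which has mean zero. Terms that start after the time
\<open>t\<close> vanish, which matters because their coefficients may fail to be random variables if they start after \<open>T\<close>.\<close>

lemma expectation_simple_integral:
  fixes S :: "('w, 'b::euclidean_space) simple_data"
  assumes S: "simple_adapted M F S" and t: "0 \<le> t" "t \<le> T"
  shows "integrable M (simple_integral S B t)" "expectation (simple_integral S B t) = 0"
proof -
  obtain n s \<xi> where Seq: "S = (n, s, \<xi>)" by (cases S)
  have s0: "0 \<le> s 0" and mono: "\<And>j. j < n \<Longrightarrow> s j \<le> s (Suc j)"
    and \<xi>m: "\<And>j. j < n \<Longrightarrow> \<xi> j \<in> borel_measurable (F (s j))"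
    and \<xi>b: "\<And>j. j < n \<Longrightarrow> \<exists>C. \<forall>\<omega>\<in>space M. norm (\<xi> j \<omega>) \<le> C"
    using S by (auto simp: simple_adapted_def Seq)
  have pos: "0 \<le> s j" if "j \<le> n" for j
    using that
  proof (induction j)
    case (Suc j)
    then show ?case using mono[of j] by simp
  qed (use s0 in simp)
  define X where "X j \<omega> = (B (min (s (Suc j)) t) \<omega> - B (min (s j) t) \<omega>) *\<^sub>R \<xi> j \<omega>" for j \<omega>
  have X: "integrable M (X j) \<and> expectation (X j) = 0" if j: "j < n" for j
  proof (cases "s j < t")
    case False
    then have "min (s j) t = t" "min (s (Suc j)) t = t" using mono[OF j] by auto
    then have "X j = (\<lambda>_. 0)" by (simp add: X_def fun_eq_iff)
    then show ?thesis by simp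
  next
    case True
    define q where "q = min (s (Suc j)) t"
    have q: "0 \<le> s j" "s j \<le> q" "q \<le> T" using True pos[of j] j mono[OF j] t by (auto simp: q_def)
    have Xeq: "X j \<omega> = (B q \<omega> - B (s j) \<omega>) *\<^sub>R \<xi> j \<omega>" for \<omega>
      using True by (simp add: X_def q_def)
    obtain C where C: "\<forall>\<omega>\<in>space M. norm (\<xi> j \<omega>) \<le> C" using \<xi>b[OF j] by auto
    have \<xi>M: "\<xi> j \<in> borel_measurable M" using \<xi>m[OF j] q by (intro measurable_from_F[of _ "s j"]) auto
    have Bm: "B q \<in> borel_measurable M" "B (s j) \<in> borel_measurable M"
      using q by (auto intro!: measurable_from_F[OF adapted])
    have iX: "integrable M (X j)"
    proof (rule Bochner_Integration.integrable_bound[where f = "\<lambda>\<omega>. C * (B q \<omega> - B (s j) \<omega>)"])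
      show "integrable M (\<lambda>\<omega>. C * (B q \<omega> - B (s j) \<omega>))" using increment_moments(3)[OF q] by simp
      show "X j \<in> borel_measurable M" unfolding Xeq using \<xi>M Bm by measurable
      have "norm (X j \<omega>) \<le> norm (C * (B q \<omega> - B (s j) \<omega>))" if "\<omega> \<in> space M" for \<omega>
      proof -
        have "norm (\<xi> j \<omega>) \<le> C" using C that by auto
        moreover have "0 \<le> C" using order_trans[OF norm_ge_zero calculation] .
        ultimately show ?thesis
          unfolding Xeq norm_scaleR real_norm_def abs_mult by (simp add: mult.commute mult_right_mono)
      qed
      then show "AE \<omega> in M. norm (X j \<omega>) \<le> norm (C * (B q \<omega> - B (s j) \<omega>))" by (rule AE_I2)
    qed
    have "expectation (X j) = 0"
    proof (rule euclidean_eqI)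
      fix e :: 'b assume e: "e \<in> Basis"
      have i1: "(\<lambda>\<omega>. \<xi> j \<omega> \<bullet> e) \<in> borel_measurable (F (s j))" using \<xi>m[OF j] by measurable
      have i2: "integrable M (\<lambda>\<omega>. \<xi> j \<omega> \<bullet> e)"
      proof (rule integrable_const_bound[where B = C])
        show "AE \<omega> in M. norm (\<xi> j \<omega> \<bullet> e) \<le> C"
          using C order_trans[OF Basis_le_norm[OF e]] by (intro AE_I2) auto
      qed (use \<xi>M in measurable)
      have "expectation (X j) \<bullet> e = expectation (\<lambda>\<omega>. X j \<omega> \<bullet> e)"
        using iX by simp
      also have "\<dots> = expectation (\<lambda>\<omega>. (\<xi> j \<omega> \<bullet> e) * (B q \<omega> - B (s j) \<omega>))"
        by (intro Bochner_Integration.integral_cong refl) (simp only: Xeq inner_scaleR_left mult.commute)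
      also have "\<dots> = 0" by (rule expectation_mult_increment(2)[OF i1 i2 q])
      finally show "expectation (X j) \<bullet> e = 0 \<bullet> e" by simp
    qed
    with iX show ?thesis by simp
  qed
  have eq: "simple_integral S B t = (\<lambda>\<omega>. \<Sum>j<n. X j \<omega>)"
    by (rule ext) (simp add: simple_integral_def Seq X_def)
  have i: "integrable M (X j)" if "j \<in> {..<n}" for j using X that by simp
  show "integrable M (simple_integral S B t)"
    unfolding eq by (rule Bochner_Integration.integrable_sum[OF i])
  have "expectation (\<lambda>\<omega>. \<Sum>j<n. X j \<omega>) = (\<Sum>j<n. expectation (X j))"
    by (rule Bochner_Integration.integral_sum[OF i])
  also have "\<dots> = 0" using X by simp
  finally show "expectation (simple_integral S B t) = 0" by (simp only: eq)
qed

lemma expectation_ito_integral: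
  fixes J :: "'w \<Rightarrow> 'b::euclidean_space"
  assumes J: "has_ito_integral M F B X t J" and t: "0 \<le> t" "t \<le> T"
  shows "integrable M J" "expectation J = 0"
proof -
  obtain S :: "nat \<Rightarrow> ('w, 'b) simple_data" where S: "\<And>m. simple_adapted M F (S m)"
    "(\<lambda>m. \<integral>\<^sup>+\<omega>. ennreal ((norm (simple_integral (S m) B t \<omega> - J \<omega>))\<^sup>2) \<partial>M) \<longlonglongrightarrow> 0"
    using J by (auto simp: has_ito_integral_def)
  have "J \<in> borel_measurable M" using J by (simp add: has_ito_integral_def)
  note L2_limit_expectation_zero[OF this expectation_simple_integral[OF S(1) t] S(2)]
  then show "integrable M J" "expectation J = 0" by auto
qed

end

section \<open>Ito integrals of deterministic integrands\<close>

text \<open>The term \<open>max (p j) (min x (p (Suc j)))\<close> is the point of the cell \<open>[p j, p (Suc j)]\<close> closest to \<open>x\<close>.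
Clamping a second partition into the cells of the first one yields their common refinement without sorting the points.\<close>

lemma sum_telescope_clamped:
  fixes f :: "real \<Rightarrow> 'b::ab_group_add"
  assumes "\<And>j. j < m \<Longrightarrow> p j \<le> p (Suc j)" and "p 0 \<le> x" "x \<le> p m"
  shows "(\<Sum>j<m. f (max (p j) (min x (p (Suc j)))) - f (p j)) = f x - f (p 0)"
proof -
  have "f (max (p j) (min x (p (Suc j)))) - f (p j) = f (min x (p (Suc j))) - f (min x (p j))" if "j < m" for j
    using assms(1)[OF that] by (cases "x \<le> p j") (auto simp: min_def max_def)
  then have "(\<Sum>j<m. f (max (p j) (min x (p (Suc j)))) - f (p j)) = (\<Sum>j<m. f (min x (p (Suc j))) - f (min x (p j)))"
    by (intro sum.cong) auto
  also have "\<dots> = f (min x (p m)) - f (min x (p 0))" by (rule sum_lessThan_telescope)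
  finally show ?thesis using assms by (simp add: min_absorb1 min_absorb2)
qed

lemma sum_telescope_refined:
  fixes f :: "real \<Rightarrow> 'b::ab_group_add"
  assumes p: "\<And>j. j < m \<Longrightarrow> p j \<le> p (Suc j)" and x: "p 0 \<le> x" "x \<le> y" "y \<le> p m"
  shows "(\<Sum>j<m. f (max (p j) (min y (p (Suc j)))) - f (max (p j) (min x (p (Suc j))))) = f y - f x"
proof -
  have "(\<Sum>j<m. f (max (p j) (min y (p (Suc j)))) - f (max (p j) (min x (p (Suc j))))) =
    (\<Sum>j<m. (f (max (p j) (min y (p (Suc j)))) - f (p j)) - (f (max (p j) (min x (p (Suc j)))) - f (p j)))"
    by (intro sum.cong) auto
  also have "\<dots> = f y - f x"
    unfolding sum_subtractf[of "\<lambda>j. f (max (p j) (min y (p (Suc j)))) - f (p j)"]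
    using sum_telescope_clamped[of m p y f] sum_telescope_clamped[of m p x f] p x by simp
  finally show ?thesis .
qed

text \<open>Let \<open>\<Psi>\<close> be the primitive \<open>x t * z t - \<integral>\<^sub>0\<^sup>t x' z\<close>. On one cell the summand differs from the
increment of \<open>\<Psi>\<close> by the integral of \<open>x' s * (z s - z v)\<close>, with \<open>v\<close> the right end of the cell. Uniform continuity
of \<open>z\<close> makes the sum of these errors small even if \<open>z\<close> has unbounded variation, as Wiener paths do.\<close>

lemma riemann_stieltjes_by_parts_limit:
  fixes x x' z :: "real \<Rightarrow> real"
  assumes T: "0 < T"
    and x: "\<And>t. t \<in> {0..T} \<Longrightarrow> (x has_vector_derivative x' t) (at t within {0..T})"
    and x': "continuous_on {0..T} x'" and z: "continuous_on {0..T} z" "z 0 = 0"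
  defines "u K k \<equiv> real k * T / real K"
  shows "(\<lambda>K. \<Sum>k<Suc K. x (u (Suc K) k) * (z (u (Suc K) (Suc k)) - z (u (Suc K) k)))
    \<longlonglongrightarrow> x T * z T - integral {0..T} (\<lambda>t. x' t * z t)"
proof -
  obtain C where C: "0 < C" "\<And>t. t \<in> {0..T} \<Longrightarrow> \<bar>x' t\<bar> \<le> C"
  proof -
    have "bounded (x' ` {0..T})" by (intro compact_imp_bounded compact_continuous_image x') auto
    then obtain a where "0 < a" "\<forall>y\<in>x' ` {0..T}. norm y \<le> a" by (auto simp: bounded_pos)
    then show ?thesis by (intro that[of a]) auto
  qed
  have cx: "continuous_on {0..T} x"
    unfolding continuous_on_eq_continuous_within using x has_vector_derivative_continuous by blast
  have cxz: "continuous_on {0..T} (\<lambda>t. x' t * z t)" using x' z by (intro continuous_intros)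
  define \<Psi> where "\<Psi> t = x t * z t - integral {0..t} (\<lambda>t. x' t * z t)" for t
  show ?thesis
  proof (rule LIMSEQ_I)
    fix r :: real assume r: "0 < r"
    define e where "e = r / (2 * C * T)"
    have e: "0 < e" using r C T by (simp add: e_def)
    have "uniformly_continuous_on {0..T} z" using z by (intro compact_uniformly_continuous) auto
    then obtain d where d: "0 < d" "\<And>s t. s \<in> {0..T} \<Longrightarrow> t \<in> {0..T} \<Longrightarrow> \<bar>t - s\<bar> < d \<Longrightarrow> \<bar>z t - z s\<bar> < e"
      using e unfolding uniformly_continuous_on_def dist_real_def by metis
    obtain N where N: "T / d < real N" using reals_Archimedean2 by blast
    have "norm ((\<Sum>k<Suc K. x (u (Suc K) k) * (z (u (Suc K) (Suc k)) - z (u (Suc K) k))) -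
        (x T * z T - integral {0..T} (\<lambda>t. x' t * z t))) < r" if K: "N \<le> K" for K
    proof -
      define v where "v k = u (Suc K) k" for k
      have v0: "v 0 = 0" "v (Suc K) = T" by (auto simp: v_def u_def)
      have vS: "v (Suc k) = v k + T / Suc K" for k by (simp add: v_def u_def add_divide_distrib distrib_right)
      have TK: "0 < T / Suc K" "T / Suc K < d"
      proof -
        show "0 < T / Suc K" using T by simp
        have "T / d < Suc K" using N K by simp
        then show "T / Suc K < d" using d(1) by (simp add: field_simps)
      qed
      have v_in: "v k \<in> {0..T}" if "k \<le> Suc K" for k
      proof -
        have "real k * T \<le> real (Suc K) * T" using that T by (intro mult_right_mono) auto
        then show ?thesis using T by (auto simp: v_def u_def divide_le_eq mult.commute)
      qed
      have piece: "\<bar>x (v k) * (z (v (Suc k)) - z (v k)) - (\<Psi> (v (Suc k)) - \<Psi> (v k))\<bar> \<le> C * e * (T / Suc K)"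
        if k: "k < Suc K" for k
      proof -
        have vv: "0 \<le> v k" "v k \<le> v (Suc k)" "v (Suc k) \<le> T"
          using v_in[of k] v_in[of "Suc k"] k vS[of k] TK by auto
        have sub: "{v k..v (Suc k)} \<subseteq> {0..T}" using vv by auto
        have ix: "(x' has_integral (x (v (Suc k)) - x (v k))) {v k..v (Suc k)}"
          using vv x sub by (intro fundamental_theorem_of_calculus)
            (auto intro: has_vector_derivative_within_subset[OF _ sub])
        have ii: "(\<lambda>t. x' t * z t) integrable_on {0..v (Suc k)}"
          using vv by (intro integrable_continuous_interval continuous_on_subset[OF cxz]) auto
        have I: "integral {0..v (Suc k)} (\<lambda>t. x' t * z t) = integral {0..v k} (\<lambda>t. x' t * z t) + integral {v k..v (Suc k)} (\<lambda>t. x' t * z t)"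
          by (rule Henstock_Kurzweil_Integration.integral_combine[OF vv(1,2) ii, symmetric])
        have ii2: "(\<lambda>t. x' t * z t) integrable_on {v k..v (Suc k)}"
          using sub by (intro integrable_continuous_interval continuous_on_subset[OF cxz])
        have "((\<lambda>t. x' t * z t - x' t * z (v (Suc k))) has_integral
            (integral {v k..v (Suc k)} (\<lambda>t. x' t * z t) - (x (v (Suc k)) - x (v k)) * z (v (Suc k)))) {v k..v (Suc k)}"
          by (intro has_integral_diff has_integral_mult_left ix integrable_integral ii2)
        then have "norm (integral {v k..v (Suc k)} (\<lambda>t. x' t * z t) - (x (v (Suc k)) - x (v k)) * z (v (Suc k)))
           \<le> C * e * measure lborel {v k..v (Suc k)}"
        proof (rule has_integral_bound_real[rotated 2])
          show "0 \<le> C * e" using C e by simp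
          show "finite ({} :: real set)" by simp
          fix t assume "t \<in> {v k..v (Suc k)} - {}"
          then have t: "t \<in> {0..T}" "\<bar>t - v (Suc k)\<bar> < d" using sub vS[of k] TK by auto
          have "\<bar>z t - z (v (Suc k))\<bar> \<le> e" using d(2)[of "v (Suc k)" t] t v_in[of "Suc k"] k by auto
          then have "\<bar>x' t\<bar> * \<bar>z t - z (v (Suc k))\<bar> \<le> C * e" using C(2)[OF t(1)] C(1) by (intro mult_mono) auto
          then show "norm (x' t * z t - x' t * z (v (Suc k))) \<le> C * e"
            by (simp add: abs_mult[symmetric] right_diff_distrib)
        qed
        moreover have "x (v k) * (z (v (Suc k)) - z (v k)) - (\<Psi> (v (Suc k)) - \<Psi> (v k)) =
          integral {v k..v (Suc k)} (\<lambda>t. x' t * z t) - (x (v (Suc k)) - x (v k)) * z (v (Suc k))"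
          unfolding \<Psi>_def I by (simp add: algebra_simps)
        ultimately show ?thesis using vv vS[of k] by simp
      qed
      have "(\<Sum>k<Suc K. \<Psi> (v (Suc k)) - \<Psi> (v k)) = \<Psi> T - \<Psi> 0"
        using sum_lessThan_telescope[of "\<lambda>k. \<Psi> (v k)" "Suc K"] by (simp only: v0)
      also have "\<Psi> T - \<Psi> 0 = x T * z T - integral {0..T} (\<lambda>t. x' t * z t)" using z by (simp add: \<Psi>_def)
      finally have tel: "x T * z T - integral {0..T} (\<lambda>t. x' t * z t) = (\<Sum>k<Suc K. \<Psi> (v (Suc k)) - \<Psi> (v k))" ..
      have "norm ((\<Sum>k<Suc K. x (v k) * (z (v (Suc k)) - z (v k))) - (x T * z T - integral {0..T} (\<lambda>t. x' t * z t)))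
        = norm (\<Sum>k<Suc K. x (v k) * (z (v (Suc k)) - z (v k)) - (\<Psi> (v (Suc k)) - \<Psi> (v k)))"
        unfolding tel by (simp only: sum_subtractf)
      also have "\<dots> \<le> (\<Sum>k<Suc K. C * e * (T / Suc K))"
        by (rule order_trans[OF norm_sum], rule sum_mono) (use piece in auto)
      also have "\<dots> = C * e * T" by simp
      also have "\<dots> < r" using r C T by (simp add: e_def)
      finally show ?thesis by (simp only: v_def)
    qed
    then show "\<exists>no. \<forall>n\<ge>no. norm ((\<Sum>k<Suc n. x (u (Suc n) k) * (z (u (Suc n) (Suc k)) - z (u (Suc n) k))) -
        (x T * z T - integral {0..T} (\<lambda>t. x' t * z t))) < r" by blast
  qed
qed

text \<open>The property of an integrator that makes the integral of a deterministic function unique: integrals of simple processes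
are bounded in \<open>L\<^sup>2\<close> by the \<open>L\<^sup>2\<close>-norm of the process. Indices are pairs of natural numbers, one for the cell
of a simple process and one for the cell of a uniform grid.\<close>

locale l2_integrator = prob_space M for M :: "'w measure" +
  fixes T :: real and F :: "real \<Rightarrow> 'w measure" and Z :: "real \<Rightarrow> 'w \<Rightarrow> real" and C :: real
  assumes T_pos: "0 < T"
    and F_meas: "\<And>(X :: 'w \<Rightarrow> real) t. X \<in> borel_measurable (F t) \<Longrightarrow> t \<in> {0..T} \<Longrightarrow> X \<in> borel_measurable M"
    and F_incr: "\<And>(X :: 'w \<Rightarrow> real) s t. X \<in> borel_measurable (F s) \<Longrightarrow> 0 \<le> s \<Longrightarrow> s \<le> t \<Longrightarrow> t \<le> T \<Longrightarrow>
      X \<in> borel_measurable (F t)"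
    and Z_meas: "\<And>t. t \<in> {0..T} \<Longrightarrow> Z t \<in> borel_measurable M"
    and Z_cont: "\<And>\<omega>. \<omega> \<in> space M \<Longrightarrow> continuous_on {0..T} (\<lambda>t. Z t \<omega>)"
    and Z_0: "\<And>\<omega>. \<omega> \<in> space M \<Longrightarrow> Z 0 \<omega> = 0"
    and l2_bound: "\<And>(I :: (nat \<times> nat) set) a b \<eta>. finite I \<Longrightarrow>
      (\<And>i. i \<in> I \<Longrightarrow> 0 \<le> a i \<and> a i \<le> b i \<and> b i \<le> T) \<Longrightarrow>
      (\<And>i j. i \<in> I \<Longrightarrow> j \<in> I \<Longrightarrow> i \<noteq> j \<Longrightarrow> b i \<le> a j \<or> b j \<le> a i) \<Longrightarrow>
      (\<Sum>i\<in>I. b i - a i) \<le> T \<Longrightarrow>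
      (\<And>i. i \<in> I \<Longrightarrow> \<eta> i \<in> borel_measurable (F (a i))) \<Longrightarrow>
      (\<And>i. i \<in> I \<Longrightarrow> \<exists>c. \<forall>\<omega>\<in>space M. \<bar>\<eta> i \<omega>\<bar> \<le> c) \<Longrightarrow>
      (\<integral>\<^sup>+\<omega>. ennreal ((\<Sum>i\<in>I. \<eta> i \<omega> * (Z (b i) \<omega> - Z (a i) \<omega>))\<^sup>2) \<partial>M)
        \<le> ennreal C * (\<integral>\<^sup>+\<omega>. ennreal (\<Sum>i\<in>I. (\<eta> i \<omega>)\<^sup>2 * (b i - a i)) \<partial>M)"
begin

text \<open>A simple process may start late, stop early or run beyond \<open>T\<close>. Cutting its time points at \<open>T\<close> and padding with
zero on both sides turns them into a partition of all of \<open>[0,T]\<close>. Coefficients that belong to times after \<open>T\<close> are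
replaced by zero; they act on empty cells only.\<close>

lemma simple_data_full_partition:
  fixes S :: "('w, real) simple_data"
  assumes S: "simple_adapted M F S"
  obtains m p \<zeta> where "p 0 = (0::real)" "p m = T" "\<And>j. j < m \<Longrightarrow> p j \<le> p (Suc j)"
    "\<And>j. j < m \<Longrightarrow> \<zeta> j \<in> borel_measurable (F (p j))"
    "\<And>j. j < m \<Longrightarrow> \<exists>c. \<forall>\<omega>\<in>space M. \<bar>\<zeta> j \<omega>\<bar> \<le> (c::real)"
    "\<And>\<omega>. simple_integral S Z T \<omega> = (\<Sum>j<m. \<zeta> j \<omega> * (Z (p (Suc j)) \<omega> - Z (p j) \<omega>))"
    "\<And>j t \<omega>. j < m \<Longrightarrow> p j < t \<Longrightarrow> t \<le> p (Suc j) \<Longrightarrow> simple_process S t \<omega> = \<zeta> j \<omega>"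
proof -
  obtain n s \<xi> where Seq: "S = (n, s, \<xi>)" by (cases S)
  have s0: "0 \<le> s 0" and mono: "\<And>j. j < n \<Longrightarrow> s j \<le> s (Suc j)"
    and \<xi>m: "\<And>j. j < n \<Longrightarrow> \<xi> j \<in> borel_measurable (F (s j))"
    and \<xi>b: "\<And>j. j < n \<Longrightarrow> \<exists>C. \<forall>\<omega>\<in>space M. \<bar>\<xi> j \<omega>\<bar> \<le> C"
    using S by (auto simp: simple_adapted_def Seq)
  have smono: "s i \<le> s j" if "i \<le> j" "j \<le> n" for i j
    using that
  proof (induction j rule: dec_induct)
    case (step k)
    then show ?case using mono[of k] by simp
  qed simp
  define p where "p j = (if j = 0 then 0 else if j \<le> Suc n then min (s (j - 1)) T else T)" for j
  \<comment> \<open>The shift by one makes room for the cell from \<open>0\<close> to \<open>s 0\<close>, on which the process vanishes.\<close>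
  define \<zeta> where "\<zeta> j \<omega> = (if 0 < j \<and> j \<le> n \<and> s (j - 1) < T then \<xi> (j - 1) \<omega> else 0)" for j \<omega>
  show thesis
  proof (rule that[of p "Suc (Suc n)" \<zeta>])
    show "p 0 = 0" "p (Suc (Suc n)) = T" by (auto simp: p_def)
    have pS: "p (Suc j) = min (s j) T" if "j \<le> n" for j using that by (simp add: p_def)
    show "p j \<le> p (Suc j)" if "j < Suc (Suc n)" for j
    proof (cases j)
      case 0
      then show ?thesis using s0 T_pos by (simp add: p_def)
    next
      case (Suc i)
      then show ?thesis
        using that mono[of i] by (cases "i = n") (auto simp: p_def min_def)
    qed
    show "\<zeta> j \<in> borel_measurable (F (p j))" if "j < Suc (Suc n)" for j
    proof (cases "0 < j \<and> j \<le> n \<and> s (j - 1) < T")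
      case True
      then obtain i where "j = Suc i" by (cases j) auto
      then show ?thesis using True \<xi>m[of i] by (auto simp: \<zeta>_def[abs_def] p_def min_def)
    next
      case False
      then have "\<zeta> j = (\<lambda>_. 0)" by (auto simp: \<zeta>_def fun_eq_iff)
      then show ?thesis by simp
    qed
    show "\<exists>c. \<forall>\<omega>\<in>space M. \<bar>\<zeta> j \<omega>\<bar> \<le> c" if "j < Suc (Suc n)" for j
    proof (cases "0 < j \<and> j \<le> n \<and> s (j - 1) < T")
      case True
      then obtain i where i: "j = Suc i" by (cases j) auto
      then have "\<zeta> j = \<xi> i" "i < n" using True by (auto simp: \<zeta>_def fun_eq_iff)
      then show ?thesis using \<xi>b by simp
    next
      case False
      then have "\<zeta> j = (\<lambda>_. 0)" by (auto simp: \<zeta>_def fun_eq_iff)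
      then show ?thesis by auto
    qed
    show "simple_integral S Z T \<omega> = (\<Sum>j<Suc (Suc n). \<zeta> j \<omega> * (Z (p (Suc j)) \<omega> - Z (p j) \<omega>))" for \<omega>
    proof -
      have "(\<Sum>j<Suc (Suc n). \<zeta> j \<omega> * (Z (p (Suc j)) \<omega> - Z (p j) \<omega>)) =
        (\<Sum>j<Suc n. \<zeta> j \<omega> * (Z (p (Suc j)) \<omega> - Z (p j) \<omega>))"
        by (simp add: \<zeta>_def)
      also have "\<dots> = (\<Sum>j<n. \<zeta> (Suc j) \<omega> * (Z (p (Suc (Suc j))) \<omega> - Z (p (Suc j)) \<omega>))"
        unfolding sum.lessThan_Suc_shift by (simp add: \<zeta>_def)
      also have "\<dots> = (\<Sum>j<n. (Z (min (s (Suc j)) T) \<omega> - Z (min (s j) T) \<omega>) *\<^sub>R \<xi> j \<omega>)"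
      proof (intro sum.cong refl)
        fix j assume "j \<in> {..<n}"
        then have j: "j < n" by simp
        show "\<zeta> (Suc j) \<omega> * (Z (p (Suc (Suc j))) \<omega> - Z (p (Suc j)) \<omega>) =
          (Z (min (s (Suc j)) T) \<omega> - Z (min (s j) T) \<omega>) *\<^sub>R \<xi> j \<omega>"
        proof (cases "s j < T")
          case True
          then show ?thesis using j pS[of j] pS[of "Suc j"] by (simp add: \<zeta>_def)
        next
          case False
          then have "min (s j) T = T" "min (s (Suc j)) T = T" using mono[OF j] by auto
          then show ?thesis using j pS[of j] pS[of "Suc j"] by simp
        qed
      qed
      finally show ?thesis by (simp add: simple_integral_def Seq)
    qed
    show "simple_process S t \<omega> = \<zeta> j \<omega>" if j: "j < Suc (Suc n)" "p j < t" "t \<le> p (Suc j)" for j t \<omega>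
    proof -
      have tT: "t \<le> T" using j by (auto simp: p_def split: if_splits)
      have sp: "simple_process S t \<omega> = (\<Sum>i<n. indicator {s i<..s (Suc i)} t *\<^sub>R \<xi> i \<omega>)"
        by (simp add: simple_process_def Seq)
      show ?thesis
      proof (cases "0 < j \<and> j \<le> n")
        case True
        then obtain i where i: "j = Suc i" "i < n" by (cases j) auto
        have b: "s i < t" "t \<le> s (Suc i)" using j i tT pS[of i] pS[of "Suc i"] by (auto simp: min_def split: if_splits)
        have "indicator {s l<..s (Suc l)} t *\<^sub>R \<xi> l \<omega> = (if l = i then \<xi> i \<omega> else 0)" if l: "l < n" for l
        proof (cases l i rule: linorder_cases)
          case less
          then have "s (Suc l) \<le> s i" using i by (intro smono) auto
          then show ?thesis using b less by auto
        next
          case greater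
          then have "s (Suc i) \<le> s l" using l by (intro smono) auto
          then show ?thesis using b greater by auto
        qed (use b in auto)
        then have "simple_process S t \<omega> = (\<Sum>l<n. if l = i then \<xi> i \<omega> else 0)"
          unfolding sp by (intro sum.cong) auto
        then show ?thesis using i b tT by (simp add: \<zeta>_def)
      next
        case False
        have "indicator {s l<..s (Suc l)} t *\<^sub>R \<xi> l \<omega> = 0" if l: "l < n" for l
        proof (cases "j = 0")
          case True
          then have "t \<le> s 0" using j by (auto simp: p_def)
          also have "s 0 \<le> s l" using l by (intro smono) auto
          finally show ?thesis by simp
        next
          case F: False
          then have "j = Suc n" using False j by auto
          then have "s n < t" using j tT by (auto simp: p_def min_def split: if_splits)
          moreover have "s (Suc l) \<le> s n" using l by (intro smono) auto
          ultimately show ?thesis by simp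
        qed
        then have "simple_process S t \<omega> = 0" unfolding sp by (intro sum.neutral) auto
        then show ?thesis using False by (auto simp: \<zeta>_def)
      qed
    qed
  qed
qed

end

lemma power2_sum_le: "(p + q)\<^sup>2 \<le> 2 * p\<^sup>2 + 2 * (q :: real)\<^sup>2"
proof -
  have "0 \<le> (p - q)\<^sup>2" by simp
  then show ?thesis by (simp add: power2_sum power2_diff)
qed

context l2_integrator
begin

lemma simple_integral_measurable:
  assumes S: "simple_adapted M F S"
  shows "(\<lambda>\<omega>. simple_integral S Z T \<omega> :: real) \<in> borel_measurable M"
proof -
  obtain m p \<zeta> where
    p: "p 0 = (0::real)" "p m = T" "\<And>j. j < m \<Longrightarrow> p j \<le> p (Suc j)"
    and \<zeta>m: "\<And>j. j < m \<Longrightarrow> \<zeta> j \<in> borel_measurable (F (p j))"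
    and "\<And>j. j < m \<Longrightarrow> \<exists>c. \<forall>\<omega>\<in>space M. \<bar>\<zeta> j \<omega>\<bar> \<le> (c::real)"
    and eq: "\<And>\<omega>. simple_integral S Z T \<omega> = (\<Sum>j<m. \<zeta> j \<omega> * (Z (p (Suc j)) \<omega> - Z (p j) \<omega>))"
    and "\<And>j t \<omega>. j < m \<Longrightarrow> p j < t \<Longrightarrow> t \<le> p (Suc j) \<Longrightarrow> simple_process S t \<omega> = \<zeta> j \<omega>"
    by (rule simple_data_full_partition[OF S], rule that)
  have pr: "p j \<in> {0..T}" if "j \<le> m" for j
  proof -
    have "p 0 \<le> p j" using that
    proof (induction j)
      case (Suc j) then show ?case using p(3)[of j] by simp
    qed simp
    moreover have "p j \<le> p m" using that
    proof (induction j rule: inc_induct)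
      case (step n) then show ?case using p(3)[of n] by simp
    qed simp
    ultimately show ?thesis using p by simp
  qed
  show ?thesis unfolding eq
  proof (intro borel_measurable_sum borel_measurable_times borel_measurable_diff)
    fix j assume "j \<in> {..<m}"
    then have j: "j < m" by simp
    show "\<zeta> j \<in> borel_measurable M" by (rule F_meas[OF \<zeta>m[OF j] pr]) (use j in simp)
    show "Z (p (Suc j)) \<in> borel_measurable M" "Z (p j) \<in> borel_measurable M"
      by (rule Z_meas[OF pr], use j in simp)+
  qed
qed

text \<open>The simple process and the left-point step function of \<open>x\<close> live on different partitions. On the common refinement their
difference is again simple, with value \<open>\<eta> i\<close> on the cell \<open>(a i, b i]\<close>, so the \<open>L\<^sup>2\<close>-bound applies to it. The
difference splits into simple process minus \<open>x\<close>, which is the error of the approximation, and \<open>x\<close> minus its value at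
the grid point, which the modulus of continuity controls.\<close>

lemma simple_integral_minus_step_bound:
  fixes x :: "real \<Rightarrow> real"
  assumes S: "simple_adapted M F S" and x: "continuous_on {0..T} x" and K: "0 < K"
    and osc: "\<And>s t. s \<in> {0..T} \<Longrightarrow> t \<in> {0..T} \<Longrightarrow> \<bar>t - s\<bar> \<le> T / real K \<Longrightarrow> \<bar>x t - x s\<bar> \<le> \<epsilon>"
  defines "u k \<equiv> real k * T / real K"
  shows "(\<integral>\<^sup>+\<omega>. ennreal ((simple_integral S Z T \<omega> - (\<Sum>k<K. x (u k) * (Z (u (Suc k)) \<omega> - Z (u k) \<omega>)))\<^sup>2) \<partial>M)
    \<le> ennreal C * (2 * (\<integral>\<^sup>+\<omega>. (\<integral>\<^sup>+s\<in>{0..T}. ennreal ((norm (simple_process S s \<omega> - x s))\<^sup>2) \<partial>lborel) \<partial>M) + ennreal (2 * \<epsilon>\<^sup>2 * T))"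
proof -
  obtain m p \<zeta> where
    p0: "p 0 = (0::real)" and pm: "p m = T" and pmono: "\<And>j. j < m \<Longrightarrow> p j \<le> p (Suc j)"
    and \<zeta>m: "\<And>j. j < m \<Longrightarrow> \<zeta> j \<in> borel_measurable (F (p j))"
    and \<zeta>b: "\<And>j. j < m \<Longrightarrow> \<exists>c. \<forall>\<omega>\<in>space M. \<bar>\<zeta> j \<omega>\<bar> \<le> (c::real)"
    and Seq: "\<And>\<omega>. simple_integral S Z T \<omega> = (\<Sum>j<m. \<zeta> j \<omega> * (Z (p (Suc j)) \<omega> - Z (p j) \<omega>))"
    and Sval: "\<And>j t \<omega>. j < m \<Longrightarrow> p j < t \<Longrightarrow> t \<le> p (Suc j) \<Longrightarrow> simple_process S t \<omega> = \<zeta> j \<omega>"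
    by (rule simple_data_full_partition[OF S], rule that)
  have pm': "p i \<le> p j" if "i \<le> j" "j \<le> m" for i j
    using that
  proof (induction j rule: dec_induct)
    case (step n) then show ?case using pmono[of n] by simp
  qed simp
  have pr: "0 \<le> p j" "p j \<le> T" if "j \<le> m" for j
    using pm'[of 0 j] pm'[of j m] that p0 pm by auto
  have u0: "u 0 = 0" "u K = T" using K by (auto simp: u_def)
  have uS: "u (Suc k) = u k + T / K" for k by (simp add: u_def add_divide_distrib distrib_right)
  have um: "u i \<le> u j" if "i \<le> j" for i j
    unfolding u_def using that T_pos by (intro divide_right_mono mult_right_mono) auto
  have ur: "0 \<le> u k" "u k \<le> T" if "k \<le> K" for k
    using um[of 0 k] um[of k K] that u0 by auto
  define cl where "cl j y = max (p j) (min y (p (Suc j)))" for j y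
  define I where "I = {..<m} \<times> {..<K}"
  define a where "a i = cl (fst i) (u (snd i))" for i
  define b where "b i = cl (fst i) (u (Suc (snd i)))" for i
  define \<eta> where "\<eta> i \<omega> = \<zeta> (fst i) \<omega> - x (u (snd i))" for i \<omega>
  have clm: "cl j y \<le> cl j z" if "y \<le> z" for j y z using that by (auto simp: cl_def)
  have cl_lo: "p j \<le> cl j y" for j y by (simp add: cl_def)
  have cl_hi: "cl j y \<le> p (Suc j)" if "j < m" for j y using pmono[OF that] by (simp add: cl_def)
  have fin: "finite I" by (simp add: I_def)
  have inI: "fst i < m" "snd i < K" if "i \<in> I" for i using that by (auto simp: I_def)
  have ab: "p (fst i) \<le> a i" "0 \<le> a i" "a i \<le> b i" "b i \<le> T" "b i \<le> p (Suc (fst i))" if "i \<in> I" for i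
  proof -
    show "p (fst i) \<le> a i" by (simp add: a_def cl_lo)
    then show "0 \<le> a i" using pr(1)[of "fst i"] inI[OF that] by simp
    show "a i \<le> b i" unfolding a_def b_def by (intro clm um) simp
    show 1: "b i \<le> p (Suc (fst i))" unfolding b_def by (intro cl_hi inI that)
    then show "b i \<le> T" using pr(2)[of "Suc (fst i)"] inI[OF that] by simp
  qed
  have disj1: "b i \<le> a j" if "i \<in> I" "j \<in> I" "fst i < fst j \<or> (fst i = fst j \<and> snd i < snd j)" for i j
    using that(3)
  proof
    assume l: "fst i < fst j"
    have "b i \<le> p (Suc (fst i))" using ab that by auto
    also have "\<dots> \<le> p (fst j)" using l inI[OF that(2)] by (intro pm') auto
    also have "\<dots> \<le> a j" using ab that by auto
    finally show ?thesis .
  next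
    assume l: "fst i = fst j \<and> snd i < snd j"
    then show ?thesis unfolding a_def b_def by (auto intro!: clm um)
  qed
  have disj: "b i \<le> a j \<or> b j \<le> a i" if "i \<in> I" "j \<in> I" "i \<noteq> j" for i j
  proof -
    have "fst i \<noteq> fst j \<or> snd i \<noteq> snd j" using that(3) by (simp add: prod_eq_iff)
    then have "(fst i < fst j \<or> (fst i = fst j \<and> snd i < snd j)) \<or> (fst j < fst i \<or> (fst j = fst i \<and> snd j < snd i))"
      by linarith
    then show ?thesis using disj1[OF that(1,2)] disj1[OF that(2,1)] by blast
  qed
  have telk: "(\<Sum>k<K. f (cl j (u (Suc k))) - f (cl j (u k))) = f (p (Suc j)) - f (p j)" if "j < m" for j and f :: "real \<Rightarrow> real"
  proof -
    have "(\<Sum>k<K. f (cl j (u (Suc k))) - f (cl j (u k))) = f (cl j (u K)) - f (cl j (u 0))"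
      by (rule sum_lessThan_telescope[of "\<lambda>k. f (cl j (u k))"])
    also have "cl j (u K) = p (Suc j)" using that pr[of "Suc j"] pmono[OF that] u0 by (simp add: cl_def)
    also have "cl j (u 0) = p j" using that pr[of j] pr[of "Suc j"] u0 by (simp add: cl_def)
    finally show ?thesis .
  qed
  have telj: "(\<Sum>j<m. f (cl j (u (Suc k))) - f (cl j (u k))) = f (u (Suc k)) - f (u k)" if "k < K" for k and f :: "real \<Rightarrow> real"
    unfolding cl_def using that ur[of k] ur[of "Suc k"] um[of k "Suc k"] p0 pm
    by (intro sum_telescope_refined pmono) auto
  have tel: "(\<Sum>i\<in>I. f (b i) - f (a i)) = f T - f 0" for f :: "real \<Rightarrow> real"
  proof -
    have "(\<Sum>i\<in>I. f (b i) - f (a i)) = (\<Sum>j<m. \<Sum>k<K. f (cl j (u (Suc k))) - f (cl j (u k)))"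
      unfolding I_def sum.cartesian_product by (intro sum.cong refl) (auto simp: a_def b_def)
    also have "\<dots> = (\<Sum>j<m. f (p (Suc j)) - f (p j))" using telk by (intro sum.cong refl) auto
    also have "\<dots> = f T - f 0"
      using sum_lessThan_telescope[of "\<lambda>j. f (p j)" m] by (simp only: p0 pm)
    finally show ?thesis .
  qed
  have diff: "simple_integral S Z T \<omega> - (\<Sum>k<K. x (u k) * (Z (u (Suc k)) \<omega> - Z (u k) \<omega>)) =
     (\<Sum>i\<in>I. \<eta> i \<omega> * (Z (b i) \<omega> - Z (a i) \<omega>))" for \<omega>
  proof -
    let ?D = "\<lambda>j k. Z (cl j (u (Suc k))) \<omega> - Z (cl j (u k)) \<omega>"
    have "(\<Sum>i\<in>I. \<eta> i \<omega> * (Z (b i) \<omega> - Z (a i) \<omega>)) = (\<Sum>j<m. \<Sum>k<K. (\<zeta> j \<omega> - x (u k)) * ?D j k)"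
      unfolding I_def sum.cartesian_product by (intro sum.cong refl) (auto simp: a_def b_def \<eta>_def)
    also have "\<dots> = (\<Sum>j<m. \<Sum>k<K. \<zeta> j \<omega> * ?D j k) - (\<Sum>j<m. \<Sum>k<K. x (u k) * ?D j k)"
      by (simp only: left_diff_distrib sum_subtractf)
    also have "(\<Sum>j<m. \<Sum>k<K. \<zeta> j \<omega> * ?D j k) = (\<Sum>j<m. \<zeta> j \<omega> * (Z (p (Suc j)) \<omega> - Z (p j) \<omega>))"
      using telk[of _ "\<lambda>t. Z t \<omega>"] by (intro sum.cong refl) (simp add: sum_distrib_left[symmetric])
    also have "(\<Sum>j<m. \<Sum>k<K. x (u k) * ?D j k) = (\<Sum>k<K. \<Sum>j<m. x (u k) * ?D j k)"
      by (rule sum.swap)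
    also have "\<dots> = (\<Sum>k<K. x (u k) * (Z (u (Suc k)) \<omega> - Z (u k) \<omega>))"
      using telj[of _ "\<lambda>t. Z t \<omega>"] by (intro sum.cong refl) (simp add: sum_distrib_left[symmetric])
    finally show ?thesis by (simp only: Seq)
  qed
  have point: "ennreal (\<Sum>i\<in>I. (\<eta> i \<omega>)\<^sup>2 * (b i - a i)) \<le>
      2 * (\<integral>\<^sup>+s\<in>{0..T}. ennreal ((norm (simple_process S s \<omega> - x s))\<^sup>2) \<partial>lborel) + ennreal (2 * \<epsilon>\<^sup>2 * T)" for \<omega>
  proof -
    define x0 where "x0 t = indicator {0..T} t * x t" for t
    have x0[measurable]: "x0 \<in> borel_measurable borel"
      using borel_measurable_continuous_on_indicator[OF _ x] unfolding x0_def by simp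
    have x0_eq: "x0 t = x t" if "t \<in> {0..T}" for t using that by (simp add: x0_def)
    have Sm[measurable]: "(\<lambda>t. simple_process S t \<omega>) \<in> borel_measurable borel"
    proof -
      obtain n s \<xi> where "S = (n, s, \<xi>)" by (cases S)
      then have "(\<lambda>t. simple_process S t \<omega>) = (\<lambda>t. \<Sum>j<n. indicator {s j<..s (Suc j)} t *\<^sub>R \<xi> j \<omega>)"
        by (intro ext) (simp only: simple_process_def prod.case)
      then show ?thesis by (simp only:) measurable
    qed
    define g where "g t = 2 * ennreal ((simple_process S t \<omega> - x0 t)\<^sup>2) + ennreal (2 * \<epsilon>\<^sup>2)" for t
    have [measurable]: "g \<in> borel_measurable borel" unfolding g_def by measurable
    have le: "ennreal ((\<eta> i \<omega>)\<^sup>2 * (b i - a i)) \<le> (\<integral>\<^sup>+t. g t * ennreal (indicator {a i<..b i} t) \<partial>lborel)" if i: "i \<in> I" for i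
    proof -
      have "ennreal ((\<eta> i \<omega>)\<^sup>2 * (b i - a i)) = (\<integral>\<^sup>+t. ennreal ((\<eta> i \<omega>)\<^sup>2) * indicator {a i<..b i} t \<partial>lborel)"
        using ab[OF i] by (simp add: nn_integral_cmult_indicator ennreal_mult)
      also have "\<dots> \<le> (\<integral>\<^sup>+t. g t * ennreal (indicator {a i<..b i} t) \<partial>lborel)"
      proof (rule nn_integral_mono)
        fix t
        show "ennreal ((\<eta> i \<omega>)\<^sup>2) * indicator {a i<..b i} t \<le> g t * ennreal (indicator {a i<..b i} t)"
        proof (cases "t \<in> {a i<..b i}")
          case True
          have t: "p (fst i) < t" "t \<le> p (Suc (fst i))" "t \<in> {0..T}" using True ab[OF i] by auto
          have "u (snd i) \<le> t \<and> t \<le> u (Suc (snd i))"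
            using True t by (auto simp: a_def b_def cl_def max_def min_def split: if_splits)
          then have d: "\<bar>t - u (snd i)\<bar> \<le> T / K" using uS[of "snd i"] by auto
          have "\<bar>x t - x (u (snd i))\<bar> \<le> \<epsilon>"
            using ur[of "snd i"] inI[OF i] by (intro osc t(3) d) auto
          then have e: "(x t - x (u (snd i)))\<^sup>2 \<le> \<epsilon>\<^sup>2" by (subst power2_abs[symmetric]) (rule power_mono, auto)
          have "(\<eta> i \<omega>)\<^sup>2 = ((simple_process S t \<omega> - x0 t) + (x t - x (u (snd i))))\<^sup>2"
            using Sval[OF inI(1)[OF i] t(1,2)] x0_eq[OF t(3)] by (simp add: \<eta>_def)
          also have "\<dots> \<le> 2 * (simple_process S t \<omega> - x0 t)\<^sup>2 + 2 * (x t - x (u (snd i)))\<^sup>2"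
            by (rule power2_sum_le)
          also have "\<dots> \<le> 2 * (simple_process S t \<omega> - x0 t)\<^sup>2 + 2 * \<epsilon>\<^sup>2" using e by simp
          finally have "ennreal ((\<eta> i \<omega>)\<^sup>2) \<le> ennreal (2 * (simple_process S t \<omega> - x0 t)\<^sup>2 + 2 * \<epsilon>\<^sup>2)"
            by (rule ennreal_leI)
          also have "\<dots> = g t" by (simp add: g_def ennreal_mult)
          finally show ?thesis using True by simp
        qed simp
      qed
      finally show ?thesis .
    qed
    \<comment> \<open>The cells partition \<open>(0,T]\<close>: telescoping applied to the step function with jump at \<open>t\<close>.\<close>
    have ind: "(\<Sum>i\<in>I. ennreal (indicator {a i<..b i} t)) = indicator {0<..T} t" for t
    proof -
      let ?f = "\<lambda>y. if t \<le> y then 1 else 0 :: real"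
      have "(\<Sum>i\<in>I. ennreal (indicator {a i<..b i} t)) = ennreal (\<Sum>i\<in>I. indicator {a i<..b i} t)"
        by (rule sum_ennreal) simp
      also have "(\<Sum>i\<in>I. indicator {a i<..b i} t) = (\<Sum>i\<in>I. ?f (b i) - ?f (a i))"
        by (intro sum.cong refl) (use ab in \<open>fastforce simp: indicator_def\<close>)
      also have "\<dots> = ?f T - ?f 0" by (rule tel)
      also have "\<dots> = indicator {0<..T} t" using T_pos by (auto simp: indicator_def)
      finally show ?thesis by (simp add: indicator_def)
    qed
    have "ennreal (\<Sum>i\<in>I. (\<eta> i \<omega>)\<^sup>2 * (b i - a i)) = (\<Sum>i\<in>I. ennreal ((\<eta> i \<omega>)\<^sup>2 * (b i - a i)))"
      using ab by (subst sum_ennreal) auto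
    also have "\<dots> \<le> (\<Sum>i\<in>I. \<integral>\<^sup>+t. g t * ennreal (indicator {a i<..b i} t) \<partial>lborel)"
      by (rule sum_mono) (rule le)
    also have "\<dots> = (\<integral>\<^sup>+t. (\<Sum>i\<in>I. g t * ennreal (indicator {a i<..b i} t)) \<partial>lborel)"
      by (subst nn_integral_sum) auto
    also have "\<dots> = (\<integral>\<^sup>+t. g t * indicator {0<..T} t \<partial>lborel)"
      by (simp only: sum_distrib_left[symmetric] ind)
    also have "\<dots> \<le> (\<integral>\<^sup>+t. 2 * (ennreal ((norm (simple_process S t \<omega> - x0 t))\<^sup>2) * indicator {0..T} t) + ennreal (2 * \<epsilon>\<^sup>2) * indicator {0..T} t \<partial>lborel)"
      by (intro nn_integral_mono) (auto simp: g_def indicator_def)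
    also have "\<dots> = 2 * (\<integral>\<^sup>+t\<in>{0..T}. ennreal ((norm (simple_process S t \<omega> - x0 t))\<^sup>2) \<partial>lborel) + ennreal (2 * \<epsilon>\<^sup>2) * ennreal T"
      using T_pos by (simp add: nn_integral_add nn_integral_cmult nn_integral_cmult_indicator)
    also have "(\<integral>\<^sup>+t\<in>{0..T}. ennreal ((norm (simple_process S t \<omega> - x0 t))\<^sup>2) \<partial>lborel) =
      (\<integral>\<^sup>+t\<in>{0..T}. ennreal ((norm (simple_process S t \<omega> - x t))\<^sup>2) \<partial>lborel)"
      by (intro nn_integral_cong) (auto simp: x0_def indicator_def)
    also have "ennreal (2 * \<epsilon>\<^sup>2) * ennreal T = ennreal (2 * \<epsilon>\<^sup>2 * T)" using T_pos by (simp add: ennreal_mult)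
    finally show ?thesis .
  qed
  have l2: "(\<integral>\<^sup>+\<omega>. ennreal ((\<Sum>i\<in>I. \<eta> i \<omega> * (Z (b i) \<omega> - Z (a i) \<omega>))\<^sup>2) \<partial>M)
      \<le> ennreal C * (\<integral>\<^sup>+\<omega>. ennreal (\<Sum>i\<in>I. (\<eta> i \<omega>)\<^sup>2 * (b i - a i)) \<partial>M)"
  proof (rule l2_bound[OF fin])
    show "(\<Sum>i\<in>I. b i - a i) \<le> T" using tel[of "\<lambda>y. y"] by simp
    fix i assume i: "i \<in> I"
    show "0 \<le> a i \<and> a i \<le> b i \<and> b i \<le> T" using ab[OF i] by simp
    have "\<zeta> (fst i) \<in> borel_measurable (F (a i))"
      using inI[OF i] pr[of "fst i"] ab[OF i] by (intro F_incr[OF \<zeta>m]) auto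
    then show "\<eta> i \<in> borel_measurable (F (a i))"
      unfolding \<eta>_def[abs_def] by (intro borel_measurable_diff) auto
    obtain c where c: "\<forall>\<omega>\<in>space M. \<bar>\<zeta> (fst i) \<omega>\<bar> \<le> c" using \<zeta>b inI[OF i] by blast
    have "\<forall>\<omega>\<in>space M. \<bar>\<eta> i \<omega>\<bar> \<le> c + \<bar>x (u (snd i))\<bar>"
    proof
      fix \<omega> assume "\<omega> \<in> space M"
      then show "\<bar>\<eta> i \<omega>\<bar> \<le> c + \<bar>x (u (snd i))\<bar>" using c[rule_format, of \<omega>] by (simp add: \<eta>_def)
    qed
    then show "\<exists>c. \<forall>\<omega>\<in>space M. \<bar>\<eta> i \<omega>\<bar> \<le> c" by blast
  qed (rule disj)
  have "(\<integral>\<^sup>+\<omega>. ennreal (\<Sum>i\<in>I. (\<eta> i \<omega>)\<^sup>2 * (b i - a i)) \<partial>M) \<le>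
    (\<integral>\<^sup>+\<omega>. 2 * (\<integral>\<^sup>+s\<in>{0..T}. ennreal ((norm (simple_process S s \<omega> - x s))\<^sup>2) \<partial>lborel) + ennreal (2 * \<epsilon>\<^sup>2 * T) \<partial>M)"
    by (intro nn_integral_mono point)
  also have "\<dots> = 2 * (\<integral>\<^sup>+\<omega>. (\<integral>\<^sup>+s\<in>{0..T}. ennreal ((norm (simple_process S s \<omega> - x s))\<^sup>2) \<partial>lborel) \<partial>M) + ennreal (2 * \<epsilon>\<^sup>2 * T)"
  proof -
    \<comment> \<open>A jointly measurable form of the simple process on \<open>(0,T]\<close>, needed to split the integral of the sum.\<close>
    define Q where "Q t \<omega> = (\<Sum>j<m. indicator {p j<..p (Suc j)} t * \<zeta> j \<omega>)" for t \<omega>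
    have Q: "simple_process S t \<omega> = Q t \<omega>" if t: "0 < t" "t \<le> T" for t \<omega>
    proof -
      let ?f = "\<lambda>y. if t \<le> y then 1 else 0 :: real"
      have "Q t \<omega> = (\<Sum>j<m. indicator {p j<..p (Suc j)} t * simple_process S t \<omega>)"
        unfolding Q_def by (intro sum.cong refl) (auto simp: indicator_def Sval)
      also have "\<dots> = (\<Sum>j<m. ?f (p (Suc j)) - ?f (p j)) * simple_process S t \<omega>"
        unfolding sum_distrib_right using pmono by (intro sum.cong refl) (fastforce simp: indicator_def)
      also have "(\<Sum>j<m. ?f (p (Suc j)) - ?f (p j)) = ?f T - ?f 0"
        using sum_lessThan_telescope[of "\<lambda>j. ?f (p j)" m] by (simp only: p0 pm)
      finally show ?thesis using t by simp
    qed
    define x0 where "x0 t = indicator {0..T} t * x t" for t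
    have x0[measurable]: "x0 \<in> borel_measurable borel"
      using borel_measurable_continuous_on_indicator[OF _ x] unfolding x0_def by simp
    have \<zeta>M: "\<zeta> j \<in> borel_measurable M" if "j < m" for j
      by (rule F_meas[OF \<zeta>m[OF that]]) (use pr[of j] that in auto)
    have "(\<lambda>(t, \<omega>). Q t \<omega>) \<in> borel_measurable (lborel \<Otimes>\<^sub>M M)"
      unfolding Q_def case_prod_beta'
    proof (intro borel_measurable_sum borel_measurable_times)
      fix j assume j: "j \<in> {..<m}"
      show "(\<lambda>z. indicator {p j<..p (Suc j)} (fst z)) \<in> borel_measurable (lborel \<Otimes>\<^sub>M M)" by measurable
      show "(\<lambda>z. \<zeta> j (snd z)) \<in> borel_measurable (lborel \<Otimes>\<^sub>M M)"
        using \<zeta>M[of j] j by (intro measurable_compose[OF measurable_snd]) auto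
    qed
    then have "(\<lambda>(\<omega>, t). Q t \<omega>) \<in> borel_measurable (M \<Otimes>\<^sub>M lborel)"
      by (subst (asm) measurable_pair_swap_iff) simp
    then have "(\<lambda>z. Q (snd z) (fst z)) \<in> borel_measurable (M \<Otimes>\<^sub>M lborel)"
      by (simp add: case_prod_beta')
    then have "(\<lambda>(\<omega>, t). ennreal ((norm (Q t \<omega> - x0 t))\<^sup>2) * indicator {0<..T} t) \<in> borel_measurable (M \<Otimes>\<^sub>M lborel)"
      unfolding case_prod_beta' by measurable
    then have meas: "(\<lambda>\<omega>. \<integral>\<^sup>+t. ennreal ((norm (Q t \<omega> - x0 t))\<^sup>2) * indicator {0<..T} t \<partial>lborel) \<in> borel_measurable M"
      by (rule lborel.borel_measurable_nn_integral)
    have eq: "(\<integral>\<^sup>+t. ennreal ((norm (Q t \<omega> - x0 t))\<^sup>2) * indicator {0<..T} t \<partial>lborel) =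
      (\<integral>\<^sup>+s\<in>{0..T}. ennreal ((norm (simple_process S s \<omega> - x s))\<^sup>2) \<partial>lborel)" for \<omega>
    proof (rule nn_integral_cong_AE)
      have "AE t in lborel. t \<noteq> (0::real)" by (rule AE_lborel_singleton)
      then show "AE t in lborel. ennreal ((norm (Q t \<omega> - x0 t))\<^sup>2) * indicator {0<..T} t =
        ennreal ((norm (simple_process S t \<omega> - x t))\<^sup>2) * indicator {0..T} t"
        by eventually_elim (auto simp: indicator_def x0_def Q)
    qed
    show ?thesis
      using meas unfolding eq by (subst nn_integral_add) (auto simp: nn_integral_cmult emeasure_space_1)
  qed
  finally show ?thesis
    unfolding diff by (intro order_trans[OF l2] mult_left_mono) auto
qed

end

lemma ennreal_two_mult: "0 \<le> p \<Longrightarrow> 0 \<le> q \<Longrightarrow> 2 * (ennreal p * ennreal q) = ennreal (2 * (p * q))"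
  by (simp add: ennreal_mult)

context l2_integrator
begin

text \<open>Letting the simple processes tend to the integrand removes them from the previous bound.\<close>

lemma ito_integral_minus_step_bound:
  fixes x :: "real \<Rightarrow> real"
  assumes J: "has_ito_integral M F Z (\<lambda>t \<omega>. x t) T J" and x: "continuous_on {0..T} x" and K: "0 < K"
    and osc: "\<And>s t. s \<in> {0..T} \<Longrightarrow> t \<in> {0..T} \<Longrightarrow> \<bar>t - s\<bar> \<le> T / real K \<Longrightarrow> \<bar>x t - x s\<bar> \<le> \<epsilon>"
  defines "u k \<equiv> real k * T / real K"
  shows "(\<integral>\<^sup>+\<omega>. ennreal (((\<Sum>k<K. x (u k) * (Z (u (Suc k)) \<omega> - Z (u k) \<omega>)) - J \<omega>)\<^sup>2) \<partial>M)
    \<le> 2 * (ennreal C * ennreal (2 * \<epsilon>\<^sup>2 * T))"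
proof -
  define D where "D \<omega> = (\<Sum>k<K. x (u k) * (Z (u (Suc k)) \<omega> - Z (u k) \<omega>))" for \<omega>
  have Jm[measurable]: "J \<in> borel_measurable M" using J by (simp add: has_ito_integral_def)
  obtain S :: "nat \<Rightarrow> ('w, real) simple_data" where S: "\<And>m. simple_adapted M F (S m)"
    and r: "(\<lambda>m. \<integral>\<^sup>+\<omega>. (\<integral>\<^sup>+s\<in>{0..T}. ennreal ((norm (simple_process (S m) s \<omega> - x s))\<^sup>2) \<partial>lborel) \<partial>M) \<longlonglongrightarrow> 0"
      (is "?r \<longlonglongrightarrow> 0")
    and q: "(\<lambda>m. \<integral>\<^sup>+\<omega>. ennreal ((norm (simple_integral (S m) Z T \<omega> - J \<omega>))\<^sup>2) \<partial>M) \<longlonglongrightarrow> 0" (is "?q \<longlonglongrightarrow> 0")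
    using J unfolding has_ito_integral_def by blast
  have um: "u k \<in> {0..T}" if "k \<le> K" for k
  proof -
    have "real k * T \<le> real K * T" using that T_pos by (intro mult_right_mono) auto
    then show ?thesis using T_pos K by (auto simp: u_def divide_le_eq mult.commute)
  qed
  have Dm[measurable]: "D \<in> borel_measurable M"
    unfolding D_def
  proof (intro borel_measurable_sum borel_measurable_times borel_measurable_diff borel_measurable_const)
    fix k assume "k \<in> {..<K}"
    then have "Suc k \<le> K" "k \<le> K" by auto
    then show "Z (u (Suc k)) \<in> borel_measurable M" "Z (u k) \<in> borel_measurable M" by (intro Z_meas um, simp)+
  qed
  have bound: "(\<integral>\<^sup>+\<omega>. ennreal ((D \<omega> - J \<omega>)\<^sup>2) \<partial>M) \<le> 2 * ?q m + 2 * (ennreal C * (2 * ?r m + ennreal (2 * \<epsilon>\<^sup>2 * T)))" for m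
  proof -
    let ?I = "\<lambda>\<omega>. simple_integral (S m) Z T \<omega>"
    have Im[measurable]: "?I \<in> borel_measurable M" by (rule simple_integral_measurable[OF S])
    have "ennreal ((D \<omega> - J \<omega>)\<^sup>2) \<le> 2 * ennreal ((norm (?I \<omega> - J \<omega>))\<^sup>2) + 2 * ennreal ((?I \<omega> - D \<omega>)\<^sup>2)" for \<omega>
    proof -
      have "(D \<omega> - J \<omega>)\<^sup>2 = ((?I \<omega> - J \<omega>) + (- (?I \<omega> - D \<omega>)))\<^sup>2" by simp
      also have "\<dots> \<le> 2 * (?I \<omega> - J \<omega>)\<^sup>2 + 2 * (- (?I \<omega> - D \<omega>))\<^sup>2" by (rule power2_sum_le)
      finally have "ennreal ((D \<omega> - J \<omega>)\<^sup>2) \<le> ennreal (2 * (?I \<omega> - J \<omega>)\<^sup>2 + 2 * (?I \<omega> - D \<omega>)\<^sup>2)"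
        by (intro ennreal_leI) (simp only: power2_minus)
      then show ?thesis by (simp add: ennreal_mult)
    qed
    then have "(\<integral>\<^sup>+\<omega>. ennreal ((D \<omega> - J \<omega>)\<^sup>2) \<partial>M) \<le>
       (\<integral>\<^sup>+\<omega>. 2 * ennreal ((norm (?I \<omega> - J \<omega>))\<^sup>2) + 2 * ennreal ((?I \<omega> - D \<omega>)\<^sup>2) \<partial>M)"
      by (rule nn_integral_mono)
    also have "\<dots> = 2 * ?q m + 2 * (\<integral>\<^sup>+\<omega>. ennreal ((?I \<omega> - D \<omega>)\<^sup>2) \<partial>M)"
      by (subst nn_integral_add) (simp_all add: nn_integral_cmult)
    also have "\<dots> \<le> 2 * ?q m + 2 * (ennreal C * (2 * ?r m + ennreal (2 * \<epsilon>\<^sup>2 * T)))"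
      unfolding D_def u_def by (intro add_left_mono mult_left_mono simple_integral_minus_step_bound[OF S x K osc]) auto
    finally show ?thesis .
  qed
  have lim: "(\<lambda>m. 2 * ?q m + 2 * (ennreal C * (2 * ?r m + ennreal (2 * \<epsilon>\<^sup>2 * T)))) \<longlonglongrightarrow>
     2 * 0 + 2 * (ennreal C * (2 * 0 + ennreal (2 * \<epsilon>\<^sup>2 * T)))"
    by (intro tendsto_add ennreal_tendsto_cmult q r tendsto_const) auto
  have "(\<integral>\<^sup>+\<omega>. ennreal ((D \<omega> - J \<omega>)\<^sup>2) \<partial>M) \<le> 2 * 0 + 2 * (ennreal C * (2 * 0 + ennreal (2 * \<epsilon>\<^sup>2 * T)))"
    by (rule LIMSEQ_le_const[OF lim]) (use bound in blast)
  then show ?thesis by (simp add: D_def)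
qed

text \<open>Left-point sums of \<open>x\<close> converge to \<open>J\<close> in \<open>L\<^sup>2\<close> and to the right-hand side along every path. By Fatou's
lemma the two limits coincide almost surely.\<close>

theorem ito_integral_by_parts:
  fixes x x' :: "real \<Rightarrow> real"
  assumes J: "has_ito_integral M F Z (\<lambda>t \<omega>. x t) T J"
    and x: "\<And>t. t \<in> {0..T} \<Longrightarrow> (x has_vector_derivative x' t) (at t within {0..T})"
    and x': "continuous_on {0..T} x'"
  shows "AE \<omega> in M. J \<omega> = x T * Z T \<omega> - integral {0..T} (\<lambda>t. x' t * Z t \<omega>)"
proof -
  define u where "u K k = real k * T / real K" for K k
  define D where "D K \<omega> = (\<Sum>k<Suc K. x (u (Suc K) k) * (Z (u (Suc K) (Suc k)) \<omega> - Z (u (Suc K) k) \<omega>))" for K \<omega>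
  define G where "G \<omega> = x T * Z T \<omega> - integral {0..T} (\<lambda>t. x' t * Z t \<omega>)" for \<omega>
  have Jm[measurable]: "J \<in> borel_measurable M" using J by (simp add: has_ito_integral_def)
  have cx: "continuous_on {0..T} x"
    unfolding continuous_on_eq_continuous_within using x has_vector_derivative_continuous by blast
  have um: "u (Suc K) k \<in> {0..T}" if "k \<le> Suc K" for K k
  proof -
    have "real k * T \<le> real (Suc K) * T" using that T_pos by (intro mult_right_mono) auto
    then show ?thesis using T_pos by (auto simp: u_def divide_le_eq mult.commute)
  qed
  have Dm[measurable]: "D K \<in> borel_measurable M" for K
    unfolding D_def
  proof (intro borel_measurable_sum borel_measurable_times borel_measurable_diff borel_measurable_const)
    fix k assume "k \<in> {..<Suc K}"
    then have "Suc k \<le> Suc K" "k \<le> Suc K" by auto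
    then show "Z (u (Suc K) (Suc k)) \<in> borel_measurable M" "Z (u (Suc K) k) \<in> borel_measurable M"
      by (intro Z_meas um, simp)+
  qed
  have DG: "(\<lambda>K. D K \<omega>) \<longlonglongrightarrow> G \<omega>" if "\<omega> \<in> space M" for \<omega>
    unfolding D_def G_def u_def
    by (rule riemann_stieltjes_by_parts_limit[OF T_pos x x' Z_cont[OF that] Z_0[OF that]])
  have lim0: "(\<lambda>K. \<integral>\<^sup>+\<omega>. ennreal ((D K \<omega> - J \<omega>)\<^sup>2) \<partial>M) \<longlonglongrightarrow> 0"
  proof (rule order_tendstoI)
    fix e :: ennreal assume "0 < e"
    then obtain y where y: "0 < y" "y < e" using dense by blast
    then obtain r where "y = ennreal r" "0 \<le> r" by (cases y) auto
    with y have r: "0 < r" "ennreal r < e" by auto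
    define \<epsilon> where "\<epsilon> = sqrt (r / (4 * (\<bar>C\<bar> + 1) * T))"
    have e2: "\<epsilon>\<^sup>2 = r / (4 * (\<bar>C\<bar> + 1) * T)" "0 < \<epsilon>" using r T_pos by (auto simp: \<epsilon>_def)
    have "uniformly_continuous_on {0..T} x" using cx by (intro compact_uniformly_continuous) auto
    then obtain d where d: "0 < d" "\<And>s t. s \<in> {0..T} \<Longrightarrow> t \<in> {0..T} \<Longrightarrow> \<bar>t - s\<bar> < d \<Longrightarrow> \<bar>x t - x s\<bar> < \<epsilon>"
      using e2 unfolding uniformly_continuous_on_def dist_real_def by metis
    obtain N where N: "T / d < real N" using reals_Archimedean2 by blast
    have "(\<integral>\<^sup>+\<omega>. ennreal ((D K \<omega> - J \<omega>)\<^sup>2) \<partial>M) < e" if K: "N \<le> K" for K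
    proof -
      have "T / d < Suc K" using N K by simp
      then have "T / Suc K < d" using d(1) by (simp add: field_simps)
      then have osc: "\<bar>x t - x s\<bar> \<le> \<epsilon>" if "s \<in> {0..T}" "t \<in> {0..T}" "\<bar>t - s\<bar> \<le> T / Suc K" for s t
        using d(2)[of s t] that by simp
      have "(\<integral>\<^sup>+\<omega>. ennreal ((D K \<omega> - J \<omega>)\<^sup>2) \<partial>M) \<le> 2 * (ennreal C * ennreal (2 * \<epsilon>\<^sup>2 * T))"
        unfolding D_def u_def by (intro ito_integral_minus_step_bound[OF J cx] osc) auto
      also have "\<dots> \<le> 2 * (ennreal (\<bar>C\<bar> + 1) * ennreal (2 * \<epsilon>\<^sup>2 * T))"
        by (intro mult_left_mono mult_right_mono ennreal_leI) auto
      also have "\<dots> = ennreal (2 * ((\<bar>C\<bar> + 1) * (2 * \<epsilon>\<^sup>2 * T)))"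
        using T_pos by (intro ennreal_two_mult) auto
      also have "2 * ((\<bar>C\<bar> + 1) * (2 * \<epsilon>\<^sup>2 * T)) = r"
        unfolding e2 using T_pos by (simp add: divide_simps)
      also have "ennreal r < e" by (rule r)
      finally show ?thesis .
    qed
    then show "\<forall>\<^sub>F K in sequentially. (\<integral>\<^sup>+\<omega>. ennreal ((D K \<omega> - J \<omega>)\<^sup>2) \<partial>M) < e"
      by (auto simp: eventually_sequentially)
  qed simp
  have Gm[measurable]: "G \<in> borel_measurable M" by (rule borel_measurable_LIMSEQ_metric[OF Dm DG])
  have "(\<integral>\<^sup>+\<omega>. ennreal ((G \<omega> - J \<omega>)\<^sup>2) \<partial>M) = (\<integral>\<^sup>+\<omega>. liminf (\<lambda>K. ennreal ((D K \<omega> - J \<omega>)\<^sup>2)) \<partial>M)"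
  proof (rule nn_integral_cong)
    fix \<omega> assume "\<omega> \<in> space M"
    then have "(\<lambda>K. ennreal ((D K \<omega> - J \<omega>)\<^sup>2)) \<longlonglongrightarrow> ennreal ((G \<omega> - J \<omega>)\<^sup>2)"
      by (intro tendsto_intros DG)
    then show "ennreal ((G \<omega> - J \<omega>)\<^sup>2) = liminf (\<lambda>K. ennreal ((D K \<omega> - J \<omega>)\<^sup>2))"
      by (intro lim_imp_Liminf[symmetric]) auto
  qed
  also have "\<dots> \<le> liminf (\<lambda>K. \<integral>\<^sup>+\<omega>. ennreal ((D K \<omega> - J \<omega>)\<^sup>2) \<partial>M)"
    by (rule nn_integral_liminf) measurable
  also have "\<dots> = 0" using lim0 by (intro lim_imp_Liminf) auto
  finally have "(\<integral>\<^sup>+\<omega>. ennreal ((G \<omega> - J \<omega>)\<^sup>2) \<partial>M) = 0" by simp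
  then have "AE \<omega> in M. ennreal ((G \<omega> - J \<omega>)\<^sup>2) = 0"
    by (subst (asm) nn_integral_0_iff_AE) auto
  then show ?thesis
  proof eventually_elim
    case (elim \<omega>)
    then have "G \<omega> = J \<omega>" by (simp add: ennreal_eq_0_iff)
    then show ?case by (simp add: G_def)
  qed
qed

end

text \<open>The Lipschitz drift is estimated by Cauchy-Schwarz in time. For the average of the Wiener processes, convexity of the
square reduces to single processes, each of which satisfies the Ito isometry with respect to the common filtration.\<close>

lemma (in prob_space) l2_integrator_drift_plus_average:
  fixes B :: "nat \<Rightarrow> real \<Rightarrow> 'a \<Rightarrow> real" and V :: "real \<Rightarrow> 'a \<Rightarrow> real"
  assumes T: "0 < T" and N: "1 \<le> N"
    and B: "\<And>i. i \<in> {1..N} \<Longrightarrow> filtered_wiener M T F (B i)"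
    and B_cont: "\<And>i \<omega>. i \<in> {1..N} \<Longrightarrow> \<omega> \<in> space M \<Longrightarrow> continuous_on {0..T} (\<lambda>t. B i t \<omega>)"
    and B_0: "\<And>i \<omega>. i \<in> {1..N} \<Longrightarrow> \<omega> \<in> space M \<Longrightarrow> B i 0 \<omega> = 0"
    and V_meas: "\<And>t. t \<in> {0..T} \<Longrightarrow> V t \<in> borel_measurable M"
    and V_cont: "\<And>\<omega>. \<omega> \<in> space M \<Longrightarrow> continuous_on {0..T} (\<lambda>t. V t \<omega>)"
    and V_0: "\<And>\<omega>. \<omega> \<in> space M \<Longrightarrow> V 0 \<omega> = 0"
    and V_lip: "AE \<omega> in M. \<forall>s\<in>{0..T}. \<forall>t\<in>{0..T}. \<bar>V t \<omega> - V s \<omega>\<bar> \<le> c * \<bar>t - s\<bar>"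
    and c: "0 \<le> c"
  shows "l2_integrator M T F (\<lambda>t \<omega>. V t \<omega> + (1 / real N) * (\<Sum>i=1..N. B i t \<omega>)) (2 * c\<^sup>2 * T + 2)"
proof -
  interpret B1: filtered_wiener M T F "B 1" using B[of 1] N by simp
  have BM: "B i t \<in> borel_measurable M" if "i \<in> {1..N}" "t \<in> {0..T}" for i t
    using filtered_wiener.measurable_from_F[OF B[OF that(1)] filtered_wiener.adapted[OF B[OF that(1)] that(2)] that(2)] .
  show ?thesis
  proof
    show "0 < T" by (rule T)
    show "X \<in> borel_measurable M" if "X \<in> borel_measurable (F t)" "t \<in> {0..T}" for X :: "'a \<Rightarrow> real" and t
      using B1.measurable_from_F that .
    show "X \<in> borel_measurable (F t)" if "X \<in> borel_measurable (F s)" "0 \<le> s" "s \<le> t" "t \<le> T" for X :: "'a \<Rightarrow> real" and s t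
      using B1.measurable_F_mono that .
    show "(\<lambda>\<omega>. V t \<omega> + (1 / real N) * (\<Sum>i=1..N. B i t \<omega>)) \<in> borel_measurable M" if "t \<in> {0..T}" for t
      using that by (intro borel_measurable_add borel_measurable_times borel_measurable_sum V_meas BM) auto
    show "continuous_on {0..T} (\<lambda>t. V t \<omega> + (1 / real N) * (\<Sum>i=1..N. B i t \<omega>))" if "\<omega> \<in> space M" for \<omega>
      using that by (intro continuous_intros V_cont B_cont) auto
    show "V 0 \<omega> + (1 / real N) * (\<Sum>i=1..N. B i 0 \<omega>) = 0" if "\<omega> \<in> space M" for \<omega>
      using that by (simp add: V_0 B_0)
    fix I :: "(nat \<times> nat) set" and a b :: "nat \<times> nat \<Rightarrow> real" and \<eta> :: "nat \<times> nat \<Rightarrow> 'a \<Rightarrow> real"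
    assume fin: "finite I" and ab: "\<And>i. i \<in> I \<Longrightarrow> 0 \<le> a i \<and> a i \<le> b i \<and> b i \<le> T"
      and disj: "\<And>i j. i \<in> I \<Longrightarrow> j \<in> I \<Longrightarrow> i \<noteq> j \<Longrightarrow> b i \<le> a j \<or> b j \<le> a i"
      and sumT: "(\<Sum>i\<in>I. b i - a i) \<le> T"
      and \<eta>F: "\<And>i. i \<in> I \<Longrightarrow> \<eta> i \<in> borel_measurable (F (a i))"
      and \<eta>b: "\<And>i. i \<in> I \<Longrightarrow> \<exists>c. \<forall>\<omega>\<in>space M. \<bar>\<eta> i \<omega>\<bar> \<le> c"
    define X where "X i \<omega> = (\<Sum>j\<in>I. \<eta> j \<omega> * (B i (b j) \<omega> - B i (a j) \<omega>))" for i \<omega>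
    define U where "U \<omega> = (\<Sum>j\<in>I. \<eta> j \<omega> * (V (b j) \<omega> - V (a j) \<omega>))" for \<omega>
    define Q where "Q \<omega> = (\<Sum>j\<in>I. (\<eta> j \<omega>)\<^sup>2 * (b j - a j))" for \<omega>
    have \<eta>M: "\<eta> j \<in> borel_measurable M" if "j \<in> I" for j
      using B1.measurable_from_F[OF \<eta>F[OF that]] ab[OF that] by simp
    have \<eta>2: "integrable M (\<lambda>\<omega>. (\<eta> j \<omega>)\<^sup>2)" if j: "j \<in> I" for j
    proof -
      obtain k where k: "\<forall>\<omega>\<in>space M. \<bar>\<eta> j \<omega>\<bar> \<le> k" using \<eta>b[OF j] by blast
      have "norm ((\<eta> j \<omega>)\<^sup>2) \<le> k\<^sup>2" if "\<omega> \<in> space M" for \<omega>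
        using power_mono[of "\<bar>\<eta> j \<omega>\<bar>" k 2] k that by simp
      then show ?thesis using \<eta>M[OF j] by (intro integrable_const_bound[where B = "k\<^sup>2"] AE_I2) auto
    qed
    have Q_int: "integrable M Q"
      unfolding Q_def using \<eta>2 by (intro Bochner_Integration.integrable_sum integrable_mult_left)
    have Q_exp: "expectation Q = (\<Sum>j\<in>I. expectation (\<lambda>\<omega>. (\<eta> j \<omega>)\<^sup>2) * (b j - a j))"
      unfolding Q_def using \<eta>2 by (subst Bochner_Integration.integral_sum) auto
    have Q0: "0 \<le> Q \<omega>" for \<omega> unfolding Q_def using ab by (intro sum_nonneg) auto
    have X2: "integrable M (\<lambda>\<omega>. (X i \<omega>)\<^sup>2)" "expectation (\<lambda>\<omega>. (X i \<omega>)\<^sup>2) = expectation Q" if i: "i \<in> {1..N}" for i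
    proof -
      interpret Bi: filtered_wiener M T F "B i" by (rule B[OF i])
      show "integrable M (\<lambda>\<omega>. (X i \<omega>)\<^sup>2)"
        unfolding X_def using ab disj by (intro Bi.isometry_disjoint_intervals(1) fin \<eta>F \<eta>2) auto
      show "expectation (\<lambda>\<omega>. (X i \<omega>)\<^sup>2) = expectation Q"
        unfolding X_def Q_exp using ab disj by (intro Bi.isometry_disjoint_intervals(2) fin \<eta>F \<eta>2) auto
    qed
    have AEle: "AE \<omega> in M. ((\<Sum>j\<in>I. \<eta> j \<omega> * ((V (b j) \<omega> + (1 / real N) * (\<Sum>i=1..N. B i (b j) \<omega>)) - (V (a j) \<omega> + (1 / real N) * (\<Sum>i=1..N. B i (a j) \<omega>)))))\<^sup>2
        \<le> 2 * c\<^sup>2 * T * Q \<omega> + (2 / real N) * (\<Sum>i=1..N. (X i \<omega>)\<^sup>2)"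
      using V_lip
    proof eventually_elim
      case (elim \<omega>)
      have split: "(\<Sum>j\<in>I. \<eta> j \<omega> * ((V (b j) \<omega> + (1 / real N) * (\<Sum>i=1..N. B i (b j) \<omega>)) - (V (a j) \<omega> + (1 / real N) * (\<Sum>i=1..N. B i (a j) \<omega>))))
        = U \<omega> + (1 / real N) * (\<Sum>i=1..N. X i \<omega>)"
      proof -
        have "(\<Sum>i=1..N. X i \<omega>) = (\<Sum>j\<in>I. \<eta> j \<omega> * ((\<Sum>i=1..N. B i (b j) \<omega>) - (\<Sum>i=1..N. B i (a j) \<omega>)))"
          unfolding X_def by (subst sum.swap) (simp only: sum_distrib_left sum_subtractf[symmetric])
        then show ?thesis
          unfolding U_def by (simp add: sum_distrib_left sum.distrib[symmetric] algebra_simps)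
      qed
      have U2: "(U \<omega>)\<^sup>2 \<le> c\<^sup>2 * T * Q \<omega>"
      proof -
        have "\<bar>U \<omega>\<bar> \<le> (\<Sum>j\<in>I. \<bar>\<eta> j \<omega>\<bar> * (c * (b j - a j)))"
          unfolding U_def
        proof (rule order_trans[OF sum_abs], rule sum_mono)
          fix j assume "j \<in> I"
          then show "\<bar>\<eta> j \<omega> * (V (b j) \<omega> - V (a j) \<omega>)\<bar> \<le> \<bar>\<eta> j \<omega>\<bar> * (c * (b j - a j))"
            using elim[rule_format, of "a j" "b j"] ab[of j] by (auto simp: abs_mult intro!: mult_left_mono)
        qed
        also have "\<dots> = c * (\<Sum>j\<in>I. (\<bar>\<eta> j \<omega>\<bar> * sqrt (b j - a j)) * sqrt (b j - a j))"
          unfolding sum_distrib_left using ab by (intro sum.cong refl) (simp add: mult.assoc)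
        finally have "\<bar>U \<omega>\<bar>\<^sup>2 \<le> (c * (\<Sum>j\<in>I. (\<bar>\<eta> j \<omega>\<bar> * sqrt (b j - a j)) * sqrt (b j - a j)))\<^sup>2"
          by (intro power_mono) auto
        also have "\<dots> = c\<^sup>2 * (\<Sum>j\<in>I. (\<bar>\<eta> j \<omega>\<bar> * sqrt (b j - a j)) * sqrt (b j - a j))\<^sup>2"
          by (rule power_mult_distrib)
        also have "\<dots> \<le> c\<^sup>2 * ((\<Sum>j\<in>I. (\<bar>\<eta> j \<omega>\<bar> * sqrt (b j - a j))\<^sup>2) * (\<Sum>j\<in>I. (sqrt (b j - a j))\<^sup>2))"
          by (intro mult_left_mono Cauchy_Schwarz_ineq_sum) auto
        also have "(\<Sum>j\<in>I. (\<bar>\<eta> j \<omega>\<bar> * sqrt (b j - a j))\<^sup>2) = Q \<omega>"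
          unfolding Q_def using ab by (intro sum.cong refl) (simp add: power_mult_distrib)
        also have "(\<Sum>j\<in>I. (sqrt (b j - a j))\<^sup>2) = (\<Sum>j\<in>I. b j - a j)"
          using ab by (intro sum.cong refl) simp
        also have "c\<^sup>2 * (Q \<omega> * (\<Sum>j\<in>I. b j - a j)) \<le> c\<^sup>2 * (Q \<omega> * T)"
          using sumT Q0 by (intro mult_left_mono) auto
        finally show ?thesis by (simp add: mult_ac)
      qed
      have "((1 / real N) * (\<Sum>i=1..N. X i \<omega>))\<^sup>2 = (1 / real N)\<^sup>2 * (\<Sum>i=1..N. X i \<omega>)\<^sup>2"
        by (rule power_mult_distrib)
      also have "\<dots> \<le> (1 / real N)\<^sup>2 * ((\<Sum>i=1..N. (X i \<omega>)\<^sup>2) * real N)"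
      proof (intro mult_left_mono)
        have "(\<Sum>i=1..N. X i \<omega> * 1)\<^sup>2 \<le> (\<Sum>i=1..N. (X i \<omega>)\<^sup>2) * (\<Sum>i=1..N. 1\<^sup>2)"
          by (rule Cauchy_Schwarz_ineq_sum)
        then show "(\<Sum>i=1..N. X i \<omega>)\<^sup>2 \<le> (\<Sum>i=1..N. (X i \<omega>)\<^sup>2) * real N" by simp
      qed simp
      also have "\<dots> = (1 / real N) * (\<Sum>i=1..N. (X i \<omega>)\<^sup>2)"
        using N by (simp add: power2_eq_square field_simps)
      finally have X2: "((1 / real N) * (\<Sum>i=1..N. X i \<omega>))\<^sup>2 \<le> (1 / real N) * (\<Sum>i=1..N. (X i \<omega>)\<^sup>2)" .
      have "(U \<omega> + (1 / real N) * (\<Sum>i=1..N. X i \<omega>))\<^sup>2 \<le> 2 * (U \<omega>)\<^sup>2 + 2 * ((1 / real N) * (\<Sum>i=1..N. X i \<omega>))\<^sup>2"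
        by (rule power2_sum_le)
      also have "\<dots> \<le> 2 * (c\<^sup>2 * T * Q \<omega>) + 2 * ((1 / real N) * (\<Sum>i=1..N. (X i \<omega>)\<^sup>2))"
        using U2 X2 by linarith
      finally show ?case unfolding split by (simp add: mult.assoc)
    qed
    have int: "integrable M (\<lambda>\<omega>. 2 * c\<^sup>2 * T * Q \<omega> + (2 / real N) * (\<Sum>i=1..N. (X i \<omega>)\<^sup>2))"
      using Q_int X2 by (intro Bochner_Integration.integrable_add integrable_mult_right Bochner_Integration.integrable_sum) auto
    have "(\<integral>\<^sup>+\<omega>. ennreal ((\<Sum>j\<in>I. \<eta> j \<omega> * ((V (b j) \<omega> + (1 / real N) * (\<Sum>i=1..N. B i (b j) \<omega>)) - (V (a j) \<omega> + (1 / real N) * (\<Sum>i=1..N. B i (a j) \<omega>))))\<^sup>2) \<partial>M)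
      \<le> (\<integral>\<^sup>+\<omega>. ennreal (2 * c\<^sup>2 * T * Q \<omega> + (2 / real N) * (\<Sum>i=1..N. (X i \<omega>)\<^sup>2)) \<partial>M)"
      by (rule nn_integral_mono_AE, use AEle in eventually_elim) (rule ennreal_leI)
    also have "\<dots> = ennreal (expectation (\<lambda>\<omega>. 2 * c\<^sup>2 * T * Q \<omega> + (2 / real N) * (\<Sum>i=1..N. (X i \<omega>)\<^sup>2)))"
      using T Q0 by (intro nn_integral_eq_integral int AE_I2 add_nonneg_nonneg mult_nonneg_nonneg sum_nonneg) auto
    also have "expectation (\<lambda>\<omega>. 2 * c\<^sup>2 * T * Q \<omega> + (2 / real N) * (\<Sum>i=1..N. (X i \<omega>)\<^sup>2)) =
       2 * c\<^sup>2 * T * expectation Q + (2 / real N) * (\<Sum>i=1..N. expectation (\<lambda>\<omega>. (X i \<omega>)\<^sup>2))"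
    proof -
      have "integrable M (\<lambda>\<omega>. \<Sum>i=1..N. (X i \<omega>)\<^sup>2)" using X2 by (intro Bochner_Integration.integrable_sum) auto
      moreover have "expectation (\<lambda>\<omega>. \<Sum>i=1..N. (X i \<omega>)\<^sup>2) = (\<Sum>i=1..N. expectation (\<lambda>\<omega>. (X i \<omega>)\<^sup>2))"
        using X2 by (intro Bochner_Integration.integral_sum) auto
      ultimately show ?thesis using Q_int by simp
    qed
    also have "\<dots> = 2 * c\<^sup>2 * T * expectation Q + (2 / real N) * (\<Sum>i=1..N. expectation Q)"
      by (simp only: X2(2) cong: sum.cong)
    also have "\<dots> = (2 * c\<^sup>2 * T + 2) * expectation Q"
      using N by (simp add: algebra_simps)
    also have "ennreal ((2 * c\<^sup>2 * T + 2) * expectation Q) = ennreal (2 * c\<^sup>2 * T + 2) * ennreal (expectation Q)"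
      using T by (intro ennreal_mult) (auto intro: Bochner_Integration.integral_nonneg Q0)
    also have "ennreal (expectation Q) = (\<integral>\<^sup>+\<omega>. ennreal (Q \<omega>) \<partial>M)"
      by (rule nn_integral_eq_integral[OF Q_int, symmetric]) (simp add: Q0)
    finally show "(\<integral>\<^sup>+\<omega>. ennreal ((\<Sum>j\<in>I. \<eta> j \<omega> * ((V (b j) \<omega> + (1 / real N) * (\<Sum>i=1..N. B i (b j) \<omega>)) - (V (a j) \<omega> + (1 / real N) * (\<Sum>i=1..N. B i (a j) \<omega>))))\<^sup>2) \<partial>M)
      \<le> ennreal (2 * c\<^sup>2 * T + 2) * (\<integral>\<^sup>+\<omega>. ennreal (\<Sum>j\<in>I. (\<eta> j \<omega>)\<^sup>2 * (b j - a j)) \<partial>M)"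
      unfolding Q_def .
  qed
qed

section \<open>The mean state and the Lindblad equation\<close>

lemma continuous_on_matrix_mult:
  fixes A B :: "'a::topological_space \<Rightarrow> complex^'d^'d"
  assumes "continuous_on S A" "continuous_on S B"
  shows "continuous_on S (\<lambda>x. A x ** B x)"
  unfolding matrix_matrix_mult_def
  by (intro continuous_on_vec_lambda continuous_on_sum continuous_on_mult continuous_on_component assms)

lemma continuous_on_adj:
  fixes A :: "'a::topological_space \<Rightarrow> complex^'d^'d"
  assumes "continuous_on S A"
  shows "continuous_on S (\<lambda>x. adj (A x))"
  unfolding adj_def
  by (intro continuous_on_vec_lambda continuous_on_cnj continuous_on_component assms)

lemma continuous_on_cscale:
  fixes A :: "'a::topological_space \<Rightarrow> complex^'d^'d"
  assumes "continuous_on S A"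
  shows "continuous_on S (\<lambda>x. cscale c (A x))"
  unfolding cscale_def
  by (intro continuous_on_vec_lambda continuous_on_mult continuous_on_const continuous_on_component assms)

lemma continuous_on_lindblad:
  fixes Hm \<rho> :: "'a::topological_space \<Rightarrow> complex^'d^'d" and Ls :: "'a \<Rightarrow> 'r::finite \<Rightarrow> complex^'d^'d"
  assumes "continuous_on S Hm" "\<And>k. continuous_on S (\<lambda>x. Ls x k)" "continuous_on S \<rho>"
  shows "continuous_on S (\<lambda>x. lindblad (Hm x) (Ls x) (\<rho> x))"
  unfolding lindblad_def commutator_def anticommutator_def
  by (intro continuous_on_add continuous_on_sum continuous_on_diff continuous_on_cscale continuous_on_matrix_mult
      continuous_on_adj continuous_on_scaleR continuous_on_const assms)

lemma continuous_on_bvec: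
  fixes \<rho> :: "'a::topological_space \<Rightarrow> complex^'d^'d" and Ls :: "'a \<Rightarrow> 'r::finite \<Rightarrow> complex^'d^'d"
  assumes "\<And>k. continuous_on S (\<lambda>x. Ls x k)" "continuous_on S \<rho>"
  shows "continuous_on S (\<lambda>x. bvec (Ls x) (\<rho> x))"
  unfolding bvec_def bform_def trace_def
  by (intro continuous_on_vec_lambda continuous_on_mult continuous_on_const continuous_on_Re continuous_on_sum
      continuous_on_component continuous_on_matrix_mult continuous_on_adj assms)

lemma matrix_mult_add_left: "(A + B) ** C = A ** C + B ** (C :: complex^'d^'d)"
  by (simp add: matrix_matrix_mult_def vec_eq_iff distrib_right sum.distrib)

lemma linear_lindblad: "linear (lindblad Hm Ls)"
proof (rule linearI)
  fix x y :: "complex^'a^'a" and c :: real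
  have "(\<Sum>k\<in>UNIV. Ls k ** (x + y) ** adj (Ls k) - (1/2) *\<^sub>R anticommutator (adj (Ls k) ** Ls k) (x + y)) =
    (\<Sum>k\<in>UNIV. Ls k ** x ** adj (Ls k) - (1/2) *\<^sub>R anticommutator (adj (Ls k) ** Ls k) x) +
    (\<Sum>k\<in>UNIV. Ls k ** y ** adj (Ls k) - (1/2) *\<^sub>R anticommutator (adj (Ls k) ** Ls k) y)"
    unfolding sum.distrib[symmetric]
    by (intro sum.cong refl) (simp add: anticommutator_def matrix_add_ldistrib matrix_mult_add_left scaleR_add_right)
  moreover have "cscale c' (commutator Hm (x + y)) = cscale c' (commutator Hm x) + cscale c' (commutator Hm y)" for c'
    by (simp add: cscale_def commutator_def matrix_add_ldistrib matrix_mult_add_left vec_eq_iff algebra_simps)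
  ultimately show "lindblad Hm Ls (x + y) = lindblad Hm Ls x + lindblad Hm Ls y"
    by (simp add: lindblad_def)
  have ml: "A ** (c *\<^sub>R B) = c *\<^sub>R (A ** B)" and mr: "(c *\<^sub>R B) ** A = c *\<^sub>R (B ** A)" for A B :: "complex^'a^'a"
    by (simp_all add: matrix_matrix_mult_def vec_eq_iff scaleR_sum_right)
  have "(\<Sum>k\<in>UNIV. Ls k ** (c *\<^sub>R x) ** adj (Ls k) - (1/2) *\<^sub>R anticommutator (adj (Ls k) ** Ls k) (c *\<^sub>R x)) =
    c *\<^sub>R (\<Sum>k\<in>UNIV. Ls k ** x ** adj (Ls k) - (1/2) *\<^sub>R anticommutator (adj (Ls k) ** Ls k) x)"
    unfolding scaleR_sum_right
    by (intro sum.cong refl) (simp add: anticommutator_def ml mr scaleR_add_right scaleR_diff_right)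
  moreover have "cscale c' (commutator Hm (c *\<^sub>R x)) = c *\<^sub>R cscale c' (commutator Hm x)" for c'
    by (simp add: cscale_def commutator_def ml mr vec_eq_iff algebra_simps)
  ultimately show "lindblad Hm Ls (c *\<^sub>R x) = c *\<^sub>R lindblad Hm Ls x"
    by (simp add: lindblad_def scaleR_add_right)
qed

lemma linear_bvec: "linear (bvec Ls)"
proof (rule linearI)
  fix x y :: "complex^'a^'a" and c :: real
  have ml: "A ** (c *\<^sub>R B) = c *\<^sub>R (A ** B)" for A B :: "complex^'a^'a"
    by (simp add: matrix_matrix_mult_def vec_eq_iff scaleR_sum_right)
  have tr: "trace (c *\<^sub>R B) = c *\<^sub>R trace B" for B :: "complex^'a^'a"
    by (simp add: trace_def scaleR_sum_right)
  show "bvec Ls (x + y) = bvec Ls x + bvec Ls y"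
    by (simp add: bvec_def bform_def matrix_add_ldistrib trace_add vec_eq_iff algebra_simps)
  show "bvec Ls (c *\<^sub>R x) = c *\<^sub>R bvec Ls x"
    by (simp add: bvec_def bform_def ml tr vec_eq_iff)
qed

lemma bounded_linear_lindblad: "bounded_linear (lindblad Hm Ls)"
  using linear_lindblad by (simp add: linear_conv_bounded_linear)

lemma bounded_linear_bvec: "bounded_linear (bvec Ls)"
  using linear_bvec by (simp add: linear_conv_bounded_linear)

text \<open>The quadratic form at the vector whose only entries are \<open>1\<close> at \<open>j\<close> and \<open>c\<close> at \<open>k\<close>.\<close>

lemma density_matrix_quadratic_form_two:
  fixes \<rho> :: "complex^'d^'d"
  assumes \<rho>: "density_matrix \<rho>" and "j \<noteq> k"
  shows "0 \<le> Re (\<rho> $ j $ j + cnj c * c * \<rho> $ k $ k + c * \<rho> $ j $ k + cnj c * \<rho> $ k $ j)"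
proof -
  define x :: "complex^'d" where "x = (\<chi> l. if l = j then 1 else if l = k then c else 0)"
  have s: "(\<Sum>l\<in>UNIV. f l * x $ l) = f j + f k * c" for f :: "'d \<Rightarrow> complex"
  proof -
    have "(\<Sum>l\<in>UNIV. f l * x $ l) = (\<Sum>l\<in>UNIV. (if l = j then f j else 0) + (if l = k then f k * c else 0))"
      using assms(2) by (intro sum.cong refl) (auto simp: x_def)
    then show ?thesis by (simp add: sum.distrib sum.delta)
  qed
  have s': "(\<Sum>l\<in>UNIV. cnj (x $ l) * f l) = f j + cnj c * f k" for f :: "'d \<Rightarrow> complex"
  proof -
    have "(\<Sum>l\<in>UNIV. cnj (x $ l) * f l) = (\<Sum>l\<in>UNIV. (if l = j then f j else 0) + (if l = k then cnj c * f k else 0))"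
      using assms(2) by (intro sum.cong refl) (auto simp: x_def)
    then show ?thesis by (simp add: sum.distrib sum.delta)
  qed
  have "(\<Sum>a\<in>UNIV. \<Sum>b\<in>UNIV. cnj (x $ a) * \<rho> $ a $ b * x $ b) = (\<Sum>a\<in>UNIV. cnj (x $ a) * (\<Sum>b\<in>UNIV. \<rho> $ a $ b * x $ b))"
    by (simp add: sum_distrib_left mult.assoc)
  also have "\<dots> = (\<rho> $ j $ j + \<rho> $ j $ k * c) + cnj c * (\<rho> $ k $ j + \<rho> $ k $ k * c)"
    by (simp only: s s')
  finally have eq: "(\<Sum>a\<in>UNIV. \<Sum>b\<in>UNIV. cnj (x $ a) * \<rho> $ a $ b * x $ b) =
    (\<rho> $ j $ j + \<rho> $ j $ k * c) + cnj c * (\<rho> $ k $ j + \<rho> $ k $ k * c)" .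
  have "0 \<le> Re (\<Sum>a\<in>UNIV. \<Sum>b\<in>UNIV. cnj (x $ a) * \<rho> $ a $ b * x $ b)"
    using \<rho> unfolding density_matrix_def by blast
  then have "0 \<le> Re ((\<rho> $ j $ j + \<rho> $ j $ k * c) + cnj c * (\<rho> $ k $ j + \<rho> $ k $ k * c))"
    by (simp only: eq)
  then show ?thesis by (simp add: algebra_simps)
qed

text \<open>Diagonal entries lie in \<open>[0,1]\<close> by positivity and normalization. Off the diagonal, the four choices \<open>c = 1, -1, \<i>, -\<i>\<close> in
the preceding lemma bound real and imaginary part by \<open>1\<close>. The constant is not sharp; any bound that holds for all
states serves the purpose.\<close>

lemma density_matrix_entry_bound:
  fixes \<rho> :: "complex^'d^'d"
  assumes \<rho>: "density_matrix \<rho>"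
  shows "norm (\<rho> $ j $ k) \<le> 2"
proof -
  have herm: "cnj (\<rho> $ k $ j) = \<rho> $ j $ k" for j k
  proof -
    have "adj \<rho> = \<rho>" using \<rho> by (simp add: density_matrix_def)
    then have "adj \<rho> $ j $ k = \<rho> $ j $ k" by simp
    then show ?thesis by (simp add: adj_def)
  qed
  have diag0: "0 \<le> Re (\<rho> $ j $ j)" for j
  proof -
    define x :: "complex^'d" where "x = (\<chi> l. if l = j then 1 else 0)"
    have "0 \<le> Re (\<Sum>a\<in>UNIV. \<Sum>b\<in>UNIV. cnj (x $ a) * \<rho> $ a $ b * x $ b)"
      using \<rho> unfolding density_matrix_def by blast
    also have "(\<Sum>a\<in>UNIV. \<Sum>b\<in>UNIV. cnj (x $ a) * \<rho> $ a $ b * x $ b) =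
        (\<Sum>a\<in>UNIV. \<Sum>b\<in>UNIV. if b = j then (if a = j then \<rho> $ j $ j else 0) else 0)"
      by (intro sum.cong refl) (auto simp: x_def)
    also have "\<dots> = \<rho> $ j $ j" by (simp add: sum.delta)
    finally show ?thesis .
  qed
  have "(\<Sum>j\<in>UNIV. Re (\<rho> $ j $ j)) = 1"
  proof -
    have "trace \<rho> = 1" using \<rho> by (simp add: density_matrix_def)
    then have "Re (\<Sum>j\<in>UNIV. \<rho> $ j $ j) = 1" by (simp add: trace_def)
    then show ?thesis by simp
  qed
  then have diag1: "Re (\<rho> $ j $ j) \<le> 1" for j
    using member_le_sum[of j UNIV "\<lambda>j. Re (\<rho> $ j $ j)"] diag0 by simp
  have diagI: "Im (\<rho> $ j $ j) = 0" for j
    using arg_cong[OF herm[of j j], of Im] by simp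
  show ?thesis
  proof (cases "j = k")
    case True
    then show ?thesis using cmod_le[of "\<rho> $ j $ j"] diag0[of j] diag1[of j] diagI[of j] by simp
  next
    case False
    have q: "0 \<le> Re (\<rho> $ j $ j + cnj c * c * \<rho> $ k $ k + c * \<rho> $ j $ k + cnj c * \<rho> $ k $ j)" for c
      by (rule density_matrix_quadratic_form_two[OF \<rho> False])
    have kj: "Re (\<rho> $ k $ j) = Re (\<rho> $ j $ k)" "Im (\<rho> $ k $ j) = - Im (\<rho> $ j $ k)"
      using arg_cong[OF herm[of k j], of Re] arg_cong[OF herm[of k j], of Im] by simp_all
    have "\<bar>Re (\<rho> $ j $ k)\<bar> \<le> 1" "\<bar>Im (\<rho> $ j $ k)\<bar> \<le> 1"
      using q[of 1] q[of "-1"] q[of \<i>] q[of "-\<i>"] kj diag1[of j] diag1[of k] by auto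
    then show ?thesis using cmod_le[of "\<rho> $ j $ k"] by simp
  qed
qed

lemma density_matrix_norm_le:
  fixes \<rho> :: "complex^'d^'d"
  assumes "density_matrix \<rho>"
  shows "norm \<rho> \<le> 2 * (real CARD('d))\<^sup>2"
proof -
  have "norm (\<rho> $ j) \<le> real CARD('d) * 2" for j
  proof -
    have "norm (\<rho> $ j) \<le> (\<Sum>k\<in>UNIV. norm (\<rho> $ j $ k))"
      unfolding norm_vec_def by (rule L2_set_le_sum) auto
    also have "\<dots> \<le> real CARD('d) * 2"
      using density_matrix_entry_bound[OF assms] by (intro sum_bounded_above) auto
    finally show ?thesis .
  qed
  then have "(\<Sum>j\<in>UNIV. norm (\<rho> $ j)) \<le> real CARD('d) * (real CARD('d) * 2)"
    by (intro sum_bounded_above) auto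
  moreover have "norm \<rho> \<le> (\<Sum>j\<in>UNIV. norm (\<rho> $ j))"
    unfolding norm_vec_def[of \<rho>] by (rule L2_set_le_sum) auto
  ultimately show ?thesis by (simp add: power2_eq_square mult_ac)
qed

text \<open>The weight \<open>exp (- 2 K t)\<close> is chosen such that, where the weighted function is maximal, the integral term
contributes at most half of the maximum and can be absorbed.\<close>

lemma gronwall_sup_bound:
  fixes u :: "real \<Rightarrow> real"
  assumes T: "0 \<le> T" and u: "continuous_on {0..T} u"
    and a: "0 \<le> a" and K: "0 < K"
    and le: "\<And>t. t \<in> {0..T} \<Longrightarrow> u t \<le> a + K * integral {0..t} u"
    and t: "t \<in> {0..T}"
  shows "u t \<le> 2 * a * exp (2 * K * T)"
proof -
  define w where "w t = exp (- 2 * K * t) * u t" for t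
  have "continuous_on {0..T} w" unfolding w_def by (intro continuous_intros u)
  then obtain r where r: "r \<in> {0..T}" "\<And>s. s \<in> {0..T} \<Longrightarrow> w s \<le> w r"
    using continuous_attains_sup[of "{0..T}" w] T by auto
  have eq: "u s = exp (2 * K * s) * w s" for s
    by (simp add: w_def mult.assoc[symmetric] exp_add[symmetric])
  have us: "u s \<le> exp (2 * K * s) * max 0 (w r)" if "s \<in> {0..T}" for s
    unfolding eq using r(2)[OF that] by (intro mult_left_mono) auto
  have "integral {0..r} u \<le> max 0 (w r) * (exp (2 * K * r) / (2 * K) - exp (2 * K * 0) / (2 * K))"
  proof (rule has_integral_le)
    show "(u has_integral integral {0..r} u) {0..r}"
      using r(1) by (intro integrable_integral integrable_continuous_interval continuous_on_subset[OF u]) auto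
    show "((\<lambda>s. max 0 (w r) * exp (2 * K * s)) has_integral
       max 0 (w r) * (exp (2 * K * r) / (2 * K) - exp (2 * K * 0) / (2 * K))) {0..r}"
    proof (rule has_integral_mult_right, rule fundamental_theorem_of_calculus)
      show "0 \<le> r" using r by simp
      show "((\<lambda>s. exp (2 * K * s) / (2 * K)) has_vector_derivative exp (2 * K * s)) (at s within {0..r})" for s
        unfolding has_real_derivative_iff_has_vector_derivative[symmetric]
        using K by (auto intro!: derivative_eq_intros)
    qed
    show "u s \<le> max 0 (w r) * exp (2 * K * s)" if "s \<in> {0..r}" for s
      using us[of s] that r by (simp add: mult.commute)
  qed
  also have "\<dots> \<le> max 0 (w r) * (exp (2 * K * r) / (2 * K))"
    using K by (intro mult_left_mono) auto
  finally have "K * integral {0..r} u \<le> K * (max 0 (w r) * (exp (2 * K * r) / (2 * K)))"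
    using K by (intro mult_left_mono) auto
  also have "\<dots> = exp (2 * K * r) * (max 0 (w r) / 2)" using K by (simp add: field_simps)
  finally have "u r \<le> a + exp (2 * K * r) * (max 0 (w r) / 2)" using le[OF r(1)] by linarith
  then have "exp (- 2 * K * r) * u r \<le> exp (- 2 * K * r) * (a + exp (2 * K * r) * (max 0 (w r) / 2))"
    by (intro mult_left_mono) auto
  also have "\<dots> = exp (- 2 * K * r) * a + max 0 (w r) / 2"
    by (simp add: distrib_left mult.assoc[symmetric] exp_add[symmetric])
  also have "exp (- 2 * K * r) * a \<le> 1 * a"
    using K r(1) a by (intro mult_right_mono) auto
  finally have "w r \<le> a + max 0 (w r) / 2" by (simp add: w_def)
  then have wr: "max 0 (w r) \<le> 2 * a" using a by linarith
  have "u t \<le> exp (2 * K * t) * max 0 (w r)" by (rule us[OF t])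
  also have "\<dots> \<le> exp (2 * K * T) * (2 * a)"
    using t K wr by (intro mult_mono) auto
  finally show ?thesis by (simp add: mult_ac)
qed

text \<open>With different operators this gives continuous dependence on the parameter; with \<open>A = B\<close> and \<open>d = 0\<close> it gives
uniqueness.\<close>

lemma integral_equation_comparison:
  fixes v w :: "real \<Rightarrow> 'a::euclidean_space" and A B :: "'a \<Rightarrow> 'a"
  assumes T: "0 \<le> T" and K: "0 < K"
    and A: "linear A" "\<And>x. norm (A x) \<le> K * norm x" and B: "linear B"
    and v: "continuous_on {0..T} v" "\<And>t. t \<in> {0..T} \<Longrightarrow> v t = y + integral {0..t} (\<lambda>s. A (v s))"
    and w: "continuous_on {0..T} w" "\<And>t. t \<in> {0..T} \<Longrightarrow> w t = y + integral {0..t} (\<lambda>s. B (w s))"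
    and d: "0 \<le> d" "\<And>t. t \<in> {0..T} \<Longrightarrow> norm (A (w t) - B (w t)) \<le> d"
    and t: "t \<in> {0..T}"
  shows "norm (v t - w t) \<le> 2 * (d * T) * exp (2 * K * T)"
proof (rule gronwall_sup_bound[where u = "\<lambda>t. norm (v t - w t)"])
  have bA: "bounded_linear A" "bounded_linear B" using A B by (simp_all add: linear_conv_bounded_linear)
  show "continuous_on {0..T} (\<lambda>t. norm (v t - w t))" by (intro continuous_intros v w)
  show "0 \<le> d * T" using d T by simp
  fix t assume t: "t \<in> {0..T}"
  have ct: "continuous_on {0..t} v" "continuous_on {0..t} w"
    using t by (auto intro: continuous_on_subset[OF v(1)] continuous_on_subset[OF w(1)])
  have cA: "continuous_on {0..t} (\<lambda>s. A (v s))" "continuous_on {0..t} (\<lambda>s. B (w s))"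
    using ct bA by (auto intro: bounded_linear.continuous_on)
  have cn: "continuous_on {0..t} (\<lambda>s. K * norm (v s - w s) + d)"
    by (intro continuous_intros ct)
  have "v t - w t = integral {0..t} (\<lambda>s. A (v s)) - integral {0..t} (\<lambda>s. B (w s))"
    using v(2)[OF t] w(2)[OF t] by simp
  also have "\<dots> = integral {0..t} (\<lambda>s. A (v s) - B (w s))"
    by (intro Henstock_Kurzweil_Integration.integral_diff[symmetric] integrable_continuous_interval cA)
  also have "norm \<dots> \<le> integral {0..t} (\<lambda>s. K * norm (v s - w s) + d)"
  proof (rule integral_norm_bound_integral)
    show "(\<lambda>s. A (v s) - B (w s)) integrable_on {0..t}"
      by (intro integrable_continuous_interval continuous_intros cA)
    show "(\<lambda>s. K * norm (v s - w s) + d) integrable_on {0..t}"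
      by (intro integrable_continuous_interval cn)
    fix s assume "s \<in> {0..t}"
    then have s: "s \<in> {0..T}" using t by auto
    have "A (v s) - B (w s) = A (v s - w s) + (A (w s) - B (w s))"
      using A(1) by (simp add: linear_diff)
    then have "norm (A (v s) - B (w s)) \<le> norm (A (v s - w s)) + norm (A (w s) - B (w s))"
      by (metis norm_triangle_ineq)
    then show "norm (A (v s) - B (w s)) \<le> K * norm (v s - w s) + d"
      using A(2)[of "v s - w s"] d(2)[OF s] by linarith
  qed
  also have "integral {0..t} (\<lambda>s. K * norm (v s - w s) + d) = K * integral {0..t} (\<lambda>s. norm (v s - w s)) + d * t"
  proof -
    have i: "(\<lambda>s. norm (v s - w s)) integrable_on {0..t}"
      by (intro integrable_continuous_interval continuous_intros ct)
    then show ?thesis using t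
      by (subst Henstock_Kurzweil_Integration.integral_add) (auto intro: integrable_on_mult_right)
  qed
  also have "d * t \<le> d * T" using d t by (intro mult_left_mono) auto
  finally show "norm (v t - w t) \<le> d * T + K * integral {0..t} (\<lambda>t. norm (v t - w t))" by simp
qed (use T K t in auto)

lemma lindblad_family_bound:
  fixes Hm :: "'p::metric_space \<Rightarrow> complex^'d^'d" and Ls :: "'p \<Rightarrow> 'r::finite \<Rightarrow> complex^'d^'d"
  assumes S: "compact S" and c: "continuous_on S Hm" "\<And>k. continuous_on S (\<lambda>\<theta>. Ls \<theta> k)"
  obtains K where "0 < K" "\<And>\<theta> x. \<theta> \<in> S \<Longrightarrow> norm (lindblad (Hm \<theta>) (Ls \<theta>) x) \<le> K * norm x"
proof -
  have "compact (S \<times> sphere (0::complex^'d^'d) 1)" using S by (intro compact_Times) auto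
  moreover have "continuous_on (S \<times> sphere (0::complex^'d^'d) 1) (\<lambda>z. lindblad (Hm (fst z)) (Ls (fst z)) (snd z))"
    by (intro continuous_on_lindblad continuous_on_snd continuous_on_id
        continuous_on_compose2[OF c(1)] continuous_on_compose2[OF c(2)] continuous_on_fst) auto
  ultimately have "compact ((\<lambda>z. lindblad (Hm (fst z)) (Ls (fst z)) (snd z)) ` (S \<times> sphere (0::complex^'d^'d) 1))"
    by (intro compact_continuous_image)
  then have "bounded ((\<lambda>z. lindblad (Hm (fst z)) (Ls (fst z)) (snd z)) ` (S \<times> sphere (0::complex^'d^'d) 1))"
    by (rule compact_imp_bounded)
  then obtain K where K: "0 < K" "\<forall>y\<in>(\<lambda>z. lindblad (Hm (fst z)) (Ls (fst z)) (snd z)) ` (S \<times> sphere (0::complex^'d^'d) 1). norm y \<le> K"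
    unfolding bounded_pos by blast
  show thesis
  proof (rule that[OF K(1)])
    fix \<theta> and x :: "complex^'d^'d" assume \<theta>: "\<theta> \<in> S"
    show "norm (lindblad (Hm \<theta>) (Ls \<theta>) x) \<le> K * norm x"
    proof (cases "x = 0")
      case True
      then show ?thesis by (simp add: linear_0[OF linear_lindblad])
    next
      case False
      define y where "y = x /\<^sub>R norm x"
      have y: "norm y = 1" "x = norm x *\<^sub>R y" using False by (simp_all add: y_def)
      have "norm (lindblad (Hm \<theta>) (Ls \<theta>) y) \<le> K"
        using K(2) \<theta> y(1) by (force simp: dist_norm)
      moreover have "lindblad (Hm \<theta>) (Ls \<theta>) x = norm x *\<^sub>R lindblad (Hm \<theta>) (Ls \<theta>) y"
        by (subst y(2)) (rule linear_scale[OF linear_lindblad])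
      ultimately show ?thesis
        using mult_left_mono[of "norm (lindblad (Hm \<theta>) (Ls \<theta>) y)" K "norm x"] by (simp add: mult.commute)
    qed
  qed
qed

text \<open>For nearby parameters the Lindblad operators are close uniformly on the ball of radius \<open>R\<close>, by compactness, and so the
solutions are close uniformly in time.\<close>

lemma lindblad_solutions_jointly_continuous:
  fixes Hm :: "'p::metric_space \<Rightarrow> complex^'d^'d" and Ls :: "'p \<Rightarrow> 'r::finite \<Rightarrow> complex^'d^'d"
  assumes S: "compact S" and c: "continuous_on S Hm" "\<And>k. continuous_on S (\<lambda>\<theta>. Ls \<theta> k)"
    and T: "0 \<le> (T::real)"
    and v: "\<And>\<theta>. \<theta> \<in> S \<Longrightarrow> continuous_on {0..T} (v \<theta>)"
      "\<And>\<theta> t. \<theta> \<in> S \<Longrightarrow> t \<in> {0..T} \<Longrightarrow> v \<theta> t = y + integral {0..t} (\<lambda>s. lindblad (Hm \<theta>) (Ls \<theta>) (v \<theta> s))"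
      "\<And>\<theta> t. \<theta> \<in> S \<Longrightarrow> t \<in> {0..T} \<Longrightarrow> norm (v \<theta> t) \<le> R"
  shows "continuous_on (S \<times> {0..T}) (\<lambda>z. v (fst z) (snd z))"
proof -
  obtain K where
    K: "0 < K" "\<And>\<theta> x. \<theta> \<in> S \<Longrightarrow> norm (lindblad (Hm \<theta>) (Ls \<theta>) x) \<le> K * norm x"
    by (rule lindblad_family_bound[where Hm = Hm and Ls = Ls, OF S c], rule that)
  let ?\<Lambda> = "\<lambda>z. lindblad (Hm (fst z)) (Ls (fst z)) (snd z)"
  have "continuous_on (S \<times> cball (0::complex^'d^'d) R) ?\<Lambda>"
    by (intro continuous_on_lindblad continuous_on_snd continuous_on_id
        continuous_on_compose2[OF c(1)] continuous_on_compose2[OF c(2)] continuous_on_fst) auto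
  then have uc: "uniformly_continuous_on (S \<times> cball (0::complex^'d^'d) R) ?\<Lambda>"
    using S by (intro compact_uniformly_continuous compact_Times) auto
  show ?thesis
    unfolding continuous_on_iff
  proof (intro ballI allI impI)
    fix z e assume z: "z \<in> S \<times> {0..T}" and e: "0 < (e::real)"
    obtain \<theta> t where zt: "z = (\<theta>, t)" "\<theta> \<in> S" "t \<in> {0..T}" using z by auto
    define d where "d = e / (4 * (T + 1) * exp (2 * K * T))"
    have d: "0 < d" using e T by (simp add: d_def)
    obtain \<delta>1 where \<delta>1: "0 < \<delta>1" "\<And>x x'. x \<in> S \<times> cball 0 R \<Longrightarrow> x' \<in> S \<times> cball 0 R \<Longrightarrow> dist x' x < \<delta>1 \<Longrightarrow> dist (?\<Lambda> x') (?\<Lambda> x) < d"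
      using uc[unfolded uniformly_continuous_on_def, rule_format, OF d] by blast
    obtain \<delta>2 where \<delta>2: "0 < \<delta>2" "\<And>t'. t' \<in> {0..T} \<Longrightarrow> dist t' t < \<delta>2 \<Longrightarrow> dist (v \<theta> t') (v \<theta> t) < e / 2"
      using v(1)[OF zt(2), unfolded continuous_on_iff, rule_format, OF zt(3) half_gt_zero[OF e]] by blast
    have "dist (v (fst z') (snd z')) (v (fst z) (snd z)) < e" if z': "z' \<in> S \<times> {0..T}" "dist z' z < min \<delta>1 \<delta>2" for z'
    proof -
      obtain \<theta>' t' where zt': "z' = (\<theta>', t')" "\<theta>' \<in> S" "t' \<in> {0..T}" using z'(1) by auto
      have dd: "dist \<theta>' \<theta> < \<delta>1" "dist t' t < \<delta>2"
        using z'(2) dist_fst_le[of z' z] dist_snd_le[of z' z] by (auto simp: zt zt')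
      have "norm (v \<theta>' t' - v \<theta> t') \<le> 2 * (d * T) * exp (2 * K * T)"
      proof (rule integral_equation_comparison[OF T K(1) linear_lindblad K(2)[OF zt'(2)] linear_lindblad
            v(1)[OF zt'(2)] v(2)[OF zt'(2)] v(1)[OF zt(2)] v(2)[OF zt(2)]])
        fix s assume s: "s \<in> {0..T}"
        have "dist (?\<Lambda> (\<theta>', v \<theta> s)) (?\<Lambda> (\<theta>, v \<theta> s)) < d"
          using v(3)[OF zt(2) s] zt zt' dd by (intro \<delta>1(2)) (auto simp: dist_Pair_Pair)
        then show "norm (lindblad (Hm \<theta>') (Ls \<theta>') (v \<theta> s) - lindblad (Hm \<theta>) (Ls \<theta>) (v \<theta> s)) \<le> d"
          by (simp add: dist_norm)
      qed (use d zt' in auto)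
      also have "2 * (d * T) * exp (2 * K * T) \<le> e / 2"
      proof -
        have "d * exp (2 * K * T) = e / (4 * (T + 1))" by (simp add: d_def)
        moreover have "2 * (d * T) * exp (2 * K * T) = 2 * T * (d * exp (2 * K * T))" by simp
        ultimately have "2 * (d * T) * exp (2 * K * T) = 2 * T * (e / (4 * (T + 1)))" by (simp only:)
        also have "\<dots> = e / 2 * (T / (T + 1))" using T by (simp add: field_simps)
        also have "\<dots> \<le> e / 2 * 1" using e T by (intro mult_left_mono) auto
        finally show ?thesis by simp
      qed
      finally have "dist (v \<theta>' t') (v \<theta> t') \<le> e / 2" by (simp add: dist_norm)
      moreover have "dist (v \<theta> t') (v \<theta> t) < e / 2" by (rule \<delta>2(2)[OF zt'(3) dd(2)])
      ultimately show ?thesis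
        using dist_triangle[of "v \<theta>' t'" "v \<theta> t" "v \<theta> t'"] by (simp add: zt zt')
    qed
    then show "\<exists>d>0. \<forall>x'\<in>S \<times> {0..T}. dist x' z < d \<longrightarrow> dist (v (fst x') (snd x')) (v (fst z) (snd z)) < e"
      using \<delta>1(1) \<delta>2(1) by (intro exI[of _ "min \<delta>1 \<delta>2"]) auto
  qed
qed

text \<open>In the mean, the stochastic integrals vanish and the Lindblad operator, being linear, commutes with the expectation.
Density matrices are bounded, which justifies Fubini's theorem.\<close>

lemma (in prob_space) mean_state_integral_equation:
  fixes Ls :: "'r::finite \<Rightarrow> complex^'d^'d" and \<rho> :: "real \<Rightarrow> 'a \<Rightarrow> complex^'d^'d"
  assumes T: "0 \<le> T"
    and W: "\<And>k. filtered_wiener M T F (\<lambda>t \<omega>. W t \<omega> $ k)"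
    and sol: "sme_solution M T F W Hm Ls \<rho>0 \<rho>"
    and dens: "AE \<omega> in M. \<forall>t\<in>{0..T}. density_matrix (\<rho> t \<omega>)"
  shows "continuous_on {0..T} (\<lambda>t. expectation (\<rho> t))"
    and "\<And>t. t \<in> {0..T} \<Longrightarrow> expectation (\<rho> t) = \<rho>0 + integral {0..t} (\<lambda>s. lindblad Hm Ls (expectation (\<rho> s)))"
    and "\<And>t. t \<in> {0..T} \<Longrightarrow> norm (expectation (\<rho> t)) \<le> 2 * (real CARD('d))\<^sup>2"
proof -
  define R where "R = 2 * (real CARD('d))\<^sup>2"
  interpret W: filtered_wiener M T F "\<lambda>t \<omega>. W t \<omega> $ undefined" by (rule W)
  have meas: "\<rho> t \<in> borel_measurable M" if "t \<in> {0..T}" for t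
  proof -
    have "\<rho> t \<in> borel_measurable (F t)" using sol that unfolding sme_solution_def by blast
    then show ?thesis by (rule W.measurable_from_F[OF _ that])
  qed
  have cont: "continuous_on {0..T} (\<lambda>t. \<rho> t \<omega>)" if "\<omega> \<in> space M" for \<omega>
    using sol that unfolding sme_solution_def by blast
  have bd: "AE \<omega> in M. \<forall>t\<in>{0..T}. norm (\<rho> t \<omega>) \<le> R"
    using dens by eventually_elim (auto simp: R_def intro: density_matrix_norm_le)
  have bd': "AE \<omega> in M. norm (\<rho> t \<omega>) \<le> R" if "t \<in> {0..T}" for t
    using bd by eventually_elim (use that in auto)
  show "continuous_on {0..T} (\<lambda>t. expectation (\<rho> t))"
    by (rule expectation_integral_continuous_process(1)[OF T meas cont bd])
  have int: "integrable M (\<rho> t)" if "t \<in> {0..T}" for t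
    by (rule norm_expectation_le(1)[OF meas[OF that] bd'[OF that]])
  show "norm (expectation (\<rho> t)) \<le> 2 * (real CARD('d))\<^sup>2" if "t \<in> {0..T}" for t
    using norm_expectation_le(2)[OF meas[OF that] bd'[OF that]] by (simp add: R_def)
  fix t assume t: "t \<in> {0..T}"
  have bl: "bounded_linear (lindblad Hm Ls)" by (rule bounded_linear_lindblad)
  obtain K where K: "0 < K" "\<And>x. norm (lindblad Hm Ls x) \<le> norm x * K"
    using bounded_linear.pos_bounded[OF bl] by blast
  have t0: "0 \<le> t" using t by simp
  have sT: "s \<in> {0..T}" if "s \<in> {0..t}" for s using that t by auto
  have lm: "(\<lambda>\<omega>. lindblad Hm Ls (\<rho> s \<omega>)) \<in> borel_measurable M" if "s \<in> {0..t}" for s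
    by (rule borel_measurable_continuous_on[OF bounded_linear.continuous_on[OF bl continuous_on_id] meas[OF sT[OF that]]])
  have lc: "continuous_on {0..t} (\<lambda>s. lindblad Hm Ls (\<rho> s \<omega>))" if "\<omega> \<in> space M" for \<omega>
    using sT by (intro bounded_linear.continuous_on[OF bl] continuous_on_subset[OF cont[OF that]]) auto
  have lb: "AE \<omega> in M. \<forall>s\<in>{0..t}. norm (lindblad Hm Ls (\<rho> s \<omega>)) \<le> R * K"
    using bd
  proof eventually_elim
    case (elim \<omega>)
    show ?case
    proof
      fix s assume "s \<in> {0..t}"
      then have "norm (\<rho> s \<omega>) * K \<le> R * K" using elim sT K(1) by (intro mult_right_mono) auto
      then show "norm (lindblad Hm Ls (\<rho> s \<omega>)) \<le> R * K" using K(2)[of "\<rho> s \<omega>"] by linarith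
    qed
  qed
  obtain I where I: "\<And>k. has_ito_integral M F (\<lambda>s \<omega>. W s \<omega> $ k) (\<lambda>s \<omega>. diffusion (Ls k) (\<rho> s \<omega>)) t (I k)"
    and eq: "AE \<omega> in M. \<rho> t \<omega> = \<rho>0 + integral {0..t} (\<lambda>s. lindblad Hm Ls (\<rho> s \<omega>)) + (\<Sum>k\<in>UNIV. I k \<omega>)"
    using sol t unfolding sme_solution_def by blast
  have I0: "integrable M (I k)" "expectation (I k) = 0" for k
    using filtered_wiener.expectation_ito_integral[OF W I[of k]] t by auto
  have sumI: "integrable M (\<lambda>\<omega>. \<Sum>k\<in>UNIV. I k \<omega>)" "expectation (\<lambda>\<omega>. \<Sum>k\<in>UNIV. I k \<omega>) = 0"
  proof -
    show "integrable M (\<lambda>\<omega>. \<Sum>k\<in>UNIV. I k \<omega>)" by (rule Bochner_Integration.integrable_sum[OF I0(1)])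
    have "expectation (\<lambda>\<omega>. \<Sum>k\<in>UNIV. I k \<omega>) = (\<Sum>k\<in>UNIV. expectation (I k))"
      by (rule Bochner_Integration.integral_sum[OF I0(1)])
    then show "expectation (\<lambda>\<omega>. \<Sum>k\<in>UNIV. I k \<omega>) = 0" by (simp add: I0)
  qed
  have im: "(\<lambda>\<omega>. integral {0..t} (\<lambda>s. lindblad Hm Ls (\<rho> s \<omega>))) \<in> borel_measurable M"
    by (rule borel_measurable_integral_continuous_process[OF t0 lm lc])
  have "expectation (\<lambda>\<omega>. integral {0..t} (\<lambda>s. lindblad Hm Ls (\<rho> s \<omega>))) = expectation (\<lambda>\<omega>. \<rho> t \<omega> - \<rho>0 - (\<Sum>k\<in>UNIV. I k \<omega>))"
  proof (rule integral_cong_AE[OF im])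
    show "(\<lambda>\<omega>. \<rho> t \<omega> - \<rho>0 - (\<Sum>k\<in>UNIV. I k \<omega>)) \<in> borel_measurable M"
      using meas[OF t] borel_measurable_integrable[OF sumI(1)] by (intro borel_measurable_diff) auto
    show "AE \<omega> in M. integral {0..t} (\<lambda>s. lindblad Hm Ls (\<rho> s \<omega>)) = \<rho> t \<omega> - \<rho>0 - (\<Sum>k\<in>UNIV. I k \<omega>)"
      using eq by eventually_elim simp
  qed
  also have "\<dots> = expectation (\<rho> t) - \<rho>0"
    using int[OF t] sumI by (simp add: prob_space)
  finally have "expectation (\<rho> t) = \<rho>0 + expectation (\<lambda>\<omega>. integral {0..t} (\<lambda>s. lindblad Hm Ls (\<rho> s \<omega>)))" by simp
  also have "expectation (\<lambda>\<omega>. integral {0..t} (\<lambda>s. lindblad Hm Ls (\<rho> s \<omega>))) = integral {0..t} (\<lambda>s. expectation (\<lambda>\<omega>. lindblad Hm Ls (\<rho> s \<omega>)))"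
    by (rule expectation_integral_continuous_process(2)[OF t0 lm lc lb])
  also have "\<dots> = integral {0..t} (\<lambda>s. lindblad Hm Ls (expectation (\<rho> s)))"
    using integral_bounded_linear[OF bl int[OF sT]] by (intro integral_cong) auto
  finally show "expectation (\<rho> t) = \<rho>0 + integral {0..t} (\<lambda>s. lindblad Hm Ls (expectation (\<rho> s)))" .
qed

section \<open>Consistency of maximizers and the law of large numbers\<close>

text \<open>Outside a ball around \<open>\<theta>0\<close> the limit function stays below its maximum by a fixed gap, because the parameter set is
compact. Once the error is less than half of the gap, no maximizer can lie there.\<close>

lemma maximizer_tendsto:
  fixes \<Phi> :: "'p::metric_space \<Rightarrow> real"
  assumes S: "compact S" and \<Phi>: "continuous_on S \<Phi>" and \<theta>0: "\<theta>0 \<in> S"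
    and max: "\<And>\<theta>. \<theta> \<in> S \<Longrightarrow> \<theta> \<noteq> \<theta>0 \<Longrightarrow> \<Phi> \<theta> < \<Phi> \<theta>0"
    and unif: "\<And>\<theta> N. \<theta> \<in> S \<Longrightarrow> 1 \<le> N \<Longrightarrow> \<bar>\<Phi>N N \<theta> - \<Phi> \<theta>\<bar> \<le> err N" and err: "err \<longlonglongrightarrow> 0"
    and hat: "\<And>N. 1 \<le> N \<Longrightarrow> \<theta>h N \<in> S" "\<And>N \<theta>. 1 \<le> N \<Longrightarrow> \<theta> \<in> S \<Longrightarrow> \<Phi>N N \<theta> \<le> \<Phi>N N (\<theta>h N)"
  shows "\<theta>h \<longlonglongrightarrow> \<theta>0"
proof (rule tendstoI)
  fix e :: real assume e: "0 < e"
  define K where "K = S \<inter> {\<theta>. e \<le> dist \<theta> \<theta>0}"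
  have "closed {\<theta>. e \<le> dist \<theta> \<theta>0}" by (intro closed_Collect_le continuous_intros)
  then have K: "compact K" unfolding K_def using S by (intro compact_Int_closed)
  show "\<forall>\<^sub>F N in sequentially. dist (\<theta>h N) \<theta>0 < e"
  proof (cases "K = {}")
    case True
    have "dist (\<theta>h N) \<theta>0 < e" if "1 \<le> N" for N
      using hat(1)[OF that] True by (force simp: K_def not_le)
    then show ?thesis by (auto simp: eventually_sequentially)
  next
    case False
    have "continuous_on K \<Phi>" using \<Phi> by (rule continuous_on_subset) (auto simp: K_def)
    then obtain \<theta>1 where \<theta>1: "\<theta>1 \<in> K" "\<And>\<theta>. \<theta> \<in> K \<Longrightarrow> \<Phi> \<theta> \<le> \<Phi> \<theta>1"
      using continuous_attains_sup[OF K False] by blast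
    define g where "g = \<Phi> \<theta>0 - \<Phi> \<theta>1"
    have g: "0 < g" using \<theta>1(1) e max[of \<theta>1] by (cases "\<theta>1 = \<theta>0") (auto simp: K_def g_def)
    have "\<forall>\<^sub>F N in sequentially. err N < g / 2" using g by (intro order_tendstoD(2)[OF err]) auto
    moreover have "\<forall>\<^sub>F N in sequentially. 1 \<le> N" by (rule eventually_ge_at_top)
    ultimately show ?thesis
    proof eventually_elim
      case (elim N)
      show ?case
      proof (rule ccontr)
        assume "\<not> dist (\<theta>h N) \<theta>0 < e"
        then have "\<theta>h N \<in> K" using hat(1)[OF elim(2)] by (simp add: K_def)
        then have "\<Phi> (\<theta>h N) \<le> \<Phi> \<theta>0 - g" using \<theta>1(2) by (simp add: g_def)
        moreover have "\<bar>\<Phi>N N (\<theta>h N) - \<Phi> (\<theta>h N)\<bar> < g / 2" "\<bar>\<Phi>N N \<theta>0 - \<Phi> \<theta>0\<bar> < g / 2"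
          using unif[OF hat(1)[OF elim(2)] elim(2)] unif[OF \<theta>0 elim(2)] elim(1) by linarith+
        moreover have "\<Phi>N N \<theta>0 \<le> \<Phi>N N (\<theta>h N)" using hat(2)[OF elim(2) \<theta>0] .
        ultimately show False by linarith
      qed
    qed
  qed
qed

lemma integral_square_pos:
  fixes f :: "real \<Rightarrow> 'a::euclidean_space"
  assumes T: "0 < T" and f: "continuous_on {0..T} f" and t: "t \<in> {0..T}" "f t \<noteq> 0"
  shows "0 < integral {0..T} (\<lambda>t. (norm (f t))\<^sup>2)"
proof -
  have c: "continuous_on {0..T} (\<lambda>t. (norm (f t))\<^sup>2)" by (intro continuous_intros f)
  have "integral {0..T} (\<lambda>t. (norm (f t))\<^sup>2) \<noteq> 0"
  proof
    assume "integral {0..T} (\<lambda>t. (norm (f t))\<^sup>2) = 0"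
    then have "((\<lambda>t. (norm (f t))\<^sup>2) has_integral 0) (cbox 0 T)"
      using integrable_integral[OF integrable_continuous_interval[OF c]] by simp
    then have "(norm (f t))\<^sup>2 = 0"
      using c t T by (intro has_integral_0_cbox_imp_0[of 0 T "\<lambda>t. (norm (f t))\<^sup>2"]) (auto simp: box_real)
    then show False using t by simp
  qed
  moreover have "0 \<le> integral {0..T} (\<lambda>t. (norm (f t))\<^sup>2)"
    by (rule integral_nonneg[OF integrable_continuous_interval[OF c]]) auto
  ultimately show ?thesis by simp
qed

text \<open>The part of the argument that takes place on a single path. After integration by parts, the contrast and its limit depend in
the same linear way on the path \<open>Y N\<close> and on its limit, the primitive of \<open>h \<theta>0\<close>. Bounds for \<open>h\<close> and
\<open>h'\<close> turn the distance of the paths into an error that is uniform in \<open>\<theta>\<close>.\<close>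

lemma contrast_maximizer_consistency:
  fixes h h' :: "'p::metric_space \<Rightarrow> real \<Rightarrow> real^'r" and Y :: "nat \<Rightarrow> real \<Rightarrow> real^'r"
  assumes S: "compact S" and \<theta>0: "\<theta>0 \<in> S" and T: "0 < T"
    and h: "continuous_on (S \<times> {0..T}) (\<lambda>z. h (fst z) (snd z))"
    and h': "continuous_on (S \<times> {0..T}) (\<lambda>z. h' (fst z) (snd z))"
    and deriv: "\<And>\<theta> t. \<theta> \<in> S \<Longrightarrow> t \<in> {0..T} \<Longrightarrow> (h \<theta> has_vector_derivative h' \<theta> t) (at t within {0..T})"
    and ident: "\<And>\<theta>. \<theta> \<in> S \<Longrightarrow> \<theta> \<noteq> \<theta>0 \<Longrightarrow> \<exists>t\<in>{0..T}. h \<theta> t \<noteq> h \<theta>0 t"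
    and Y: "\<And>N. continuous_on {0..T} (Y N)"
    and err: "(\<lambda>N. norm (Y N T - integral {0..T} (h \<theta>0)) +
        integral {0..T} (\<lambda>t. norm (Y N t - integral {0..t} (h \<theta>0)))) \<longlonglongrightarrow> 0"
    and hat: "\<And>N. 1 \<le> N \<Longrightarrow> \<theta>h N \<in> S" "\<And>N \<theta>. 1 \<le> N \<Longrightarrow> \<theta> \<in> S \<Longrightarrow> \<Phi>N N \<theta> \<le> \<Phi>N N (\<theta>h N)"
    and \<Phi>N: "\<And>N \<theta>. 1 \<le> N \<Longrightarrow> \<theta> \<in> S \<Longrightarrow> \<Phi>N N \<theta> = h \<theta> T \<bullet> Y N T - integral {0..T} (\<lambda>t. h' \<theta> t \<bullet> Y N t)
        - (1/2) * integral {0..T} (\<lambda>t. (norm (h \<theta> t))\<^sup>2)"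
  shows "\<theta>h \<longlonglongrightarrow> \<theta>0"
proof -
  have slice: "continuous_on {0..T} (f \<theta>)" if "continuous_on (S \<times> {0..T}) (\<lambda>z. f (fst z) (snd z))" "\<theta> \<in> S"
    for f :: "'p \<Rightarrow> real \<Rightarrow> real^'r" and \<theta>
  proof -
    have "continuous_on {0..T} (\<lambda>t. (\<theta>, t))" by (intro continuous_intros)
    from continuous_on_compose2[OF that(1) this] show ?thesis using that(2) by auto
  qed
  note ch = slice[OF h] and ch' = slice[OF h']
  define m where "m t = integral {0..t} (h \<theta>0)" for t
  have m_der: "(m has_vector_derivative h \<theta>0 t) (at t within {0..T})" if "t \<in> {0..T}" for t
    unfolding m_def using integral_has_vector_derivative[OF ch[OF \<theta>0] that] .
  have cm: "continuous_on {0..T} m"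
    unfolding continuous_on_eq_continuous_within using m_der has_vector_derivative_continuous by blast
  have m0: "m 0 = 0" by (simp add: m_def)
  have "compact (S \<times> {0..T})" using S by (intro compact_Times) auto
  then have "bounded ((\<lambda>z. h (fst z) (snd z)) ` (S \<times> {0..T}))" "bounded ((\<lambda>z. h' (fst z) (snd z)) ` (S \<times> {0..T}))"
    using h h' by (auto intro!: compact_imp_bounded compact_continuous_image)
  then obtain C1 C2 where "0 < C1" "\<forall>x\<in>(\<lambda>z. h (fst z) (snd z)) ` (S \<times> {0..T}). norm x \<le> C1"
    and "0 < C2" "\<forall>x\<in>(\<lambda>z. h' (fst z) (snd z)) ` (S \<times> {0..T}). norm x \<le> C2"
    unfolding bounded_pos by blast
  then obtain C where C: "0 < C" "\<And>\<theta> t. \<theta> \<in> S \<Longrightarrow> t \<in> {0..T} \<Longrightarrow> norm (h \<theta> t) \<le> C"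
    "\<And>\<theta> t. \<theta> \<in> S \<Longrightarrow> t \<in> {0..T} \<Longrightarrow> norm (h' \<theta> t) \<le> C"
    by (intro that[of "max C1 C2"]) (auto simp: le_max_iff_disj)
  have parts: "integral {0..T} (\<lambda>t. h \<theta> t \<bullet> h \<theta>0 t) = h \<theta> T \<bullet> m T - integral {0..T} (\<lambda>t. h' \<theta> t \<bullet> m t)" if \<theta>: "\<theta> \<in> S" for \<theta>
  proof -
    have 1: "((\<lambda>t. h \<theta> t \<bullet> h \<theta>0 t + h' \<theta> t \<bullet> m t) has_integral (h \<theta> T \<bullet> m T - h \<theta> 0 \<bullet> m 0)) {0..T}"
      using T by (intro fundamental_theorem_of_calculus
          bounded_bilinear.has_vector_derivative[OF bounded_bilinear_inner] deriv \<theta> m_der) auto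
    have 2: "((\<lambda>t. h \<theta> t \<bullet> h \<theta>0 t + h' \<theta> t \<bullet> m t) has_integral
        (integral {0..T} (\<lambda>t. h \<theta> t \<bullet> h \<theta>0 t) + integral {0..T} (\<lambda>t. h' \<theta> t \<bullet> m t))) {0..T}"
      by (intro has_integral_add integrable_integral integrable_continuous_interval continuous_intros ch ch' cm \<theta> \<theta>0)
    show ?thesis using has_integral_unique[OF 1 2] m0 by simp
  qed
  \<comment> \<open>The limit contrast, with the square completed.\<close>
  define \<Phi> where "\<Phi> \<theta> = (1/2) * integral {0..T} (\<lambda>t. (norm (h \<theta>0 t))\<^sup>2)
      - (1/2) * integral {0..T} (\<lambda>t. (norm (h \<theta> t - h \<theta>0 t))\<^sup>2)" for \<theta>
  have \<Phi>_eq: "\<Phi> \<theta> = h \<theta> T \<bullet> m T - integral {0..T} (\<lambda>t. h' \<theta> t \<bullet> m t) - (1/2) * integral {0..T} (\<lambda>t. (norm (h \<theta> t))\<^sup>2)"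
    if \<theta>: "\<theta> \<in> S" for \<theta>
  proof -
    have i: "(\<lambda>t. (norm (h \<theta> t))\<^sup>2) integrable_on {0..T}" "(\<lambda>t. (norm (h \<theta>0 t))\<^sup>2) integrable_on {0..T}"
      "(\<lambda>t. h \<theta> t \<bullet> h \<theta>0 t) integrable_on {0..T}"
      by (intro integrable_continuous_interval continuous_intros ch \<theta> \<theta>0)+
    have "((\<lambda>t. (norm (h \<theta> t - h \<theta>0 t))\<^sup>2) has_integral (integral {0..T} (\<lambda>t. (norm (h \<theta> t))\<^sup>2)
        - 2 * integral {0..T} (\<lambda>t. h \<theta> t \<bullet> h \<theta>0 t) + integral {0..T} (\<lambda>t. (norm (h \<theta>0 t))\<^sup>2))) {0..T}"
    proof (rule has_integral_eq_rhs[OF has_integral_eq])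
      show "((\<lambda>t. (norm (h \<theta> t))\<^sup>2 - 2 * (h \<theta> t \<bullet> h \<theta>0 t) + (norm (h \<theta>0 t))\<^sup>2) has_integral (integral {0..T} (\<lambda>t. (norm (h \<theta> t))\<^sup>2)
        - 2 * integral {0..T} (\<lambda>t. h \<theta> t \<bullet> h \<theta>0 t) + integral {0..T} (\<lambda>t. (norm (h \<theta>0 t))\<^sup>2))) {0..T}"
        by (intro has_integral_add has_integral_diff has_integral_mult_right integrable_integral i)
    qed (simp_all add: power2_norm_eq_inner inner_diff inner_commute)
    then have "integral {0..T} (\<lambda>t. (norm (h \<theta> t - h \<theta>0 t))\<^sup>2) = integral {0..T} (\<lambda>t. (norm (h \<theta> t))\<^sup>2)
        - 2 * integral {0..T} (\<lambda>t. h \<theta> t \<bullet> h \<theta>0 t) + integral {0..T} (\<lambda>t. (norm (h \<theta>0 t))\<^sup>2)"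
      by (rule integral_unique)
    then show ?thesis unfolding \<Phi>_def using parts[OF \<theta>] by linarith
  qed
  have c\<Phi>: "continuous_on S \<Phi>"
  proof -
    have "continuous_on (S \<times> cbox 0 T) (\<lambda>(\<theta>, t). (norm (h \<theta> t - h \<theta>0 t))\<^sup>2)"
      unfolding case_prod_beta'
    proof (intro continuous_intros)
      show "continuous_on (S \<times> cbox 0 T) (\<lambda>z. h (fst z) (snd z))" using h by simp
      show "continuous_on (S \<times> cbox 0 T) (\<lambda>z. h \<theta>0 (snd z))"
        by (rule continuous_on_compose2[OF ch[OF \<theta>0]]) (auto intro!: continuous_intros)
    qed
    then have "continuous_on S (\<lambda>\<theta>. integral (cbox 0 T) (\<lambda>t. (norm (h \<theta> t - h \<theta>0 t))\<^sup>2))"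
      by (rule integral_continuous_on_param)
    then show ?thesis unfolding \<Phi>_def by (intro continuous_intros) simp
  qed
  show ?thesis
  proof (rule maximizer_tendsto[OF S c\<Phi> \<theta>0])
    show "\<Phi> \<theta> < \<Phi> \<theta>0" if \<theta>: "\<theta> \<in> S" "\<theta> \<noteq> \<theta>0" for \<theta>
    proof -
      obtain t where t: "t \<in> {0..T}" "h \<theta> t \<noteq> h \<theta>0 t" using ident[OF \<theta>] by blast
      have "0 < integral {0..T} (\<lambda>t. (norm (h \<theta> t - h \<theta>0 t))\<^sup>2)"
        by (rule integral_square_pos[OF T _ t(1)]) (use t in \<open>auto intro!: continuous_intros ch \<theta> \<theta>0\<close>)
      then show ?thesis by (simp add: \<Phi>_def)
    qed
    show "(\<lambda>N. C * (norm (Y N T - m T) + integral {0..T} (\<lambda>t. norm (Y N t - m t)))) \<longlonglongrightarrow> 0"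
      using tendsto_mult_right_zero[OF err, of C] by (simp add: m_def)
    show "\<bar>\<Phi>N N \<theta> - \<Phi> \<theta>\<bar> \<le> C * (norm (Y N T - m T) + integral {0..T} (\<lambda>t. norm (Y N t - m t)))"
      if \<theta>: "\<theta> \<in> S" and N: "1 \<le> N" for \<theta> N
    proof -
      have i: "(\<lambda>t. h' \<theta> t \<bullet> Y N t) integrable_on {0..T}" "(\<lambda>t. h' \<theta> t \<bullet> m t) integrable_on {0..T}"
        by (intro integrable_continuous_interval continuous_intros ch' \<theta> Y cm)+
      have "\<Phi>N N \<theta> - \<Phi> \<theta> = h \<theta> T \<bullet> (Y N T - m T) - integral {0..T} (\<lambda>t. h' \<theta> t \<bullet> (Y N t - m t))"
        unfolding \<Phi>N[OF N \<theta>] \<Phi>_eq[OF \<theta>] inner_diff_right Henstock_Kurzweil_Integration.integral_diff[OF i] by simp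
      then have "\<bar>\<Phi>N N \<theta> - \<Phi> \<theta>\<bar> \<le> \<bar>h \<theta> T \<bullet> (Y N T - m T)\<bar> + \<bar>integral {0..T} (\<lambda>t. h' \<theta> t \<bullet> (Y N t - m t))\<bar>"
        by linarith
      also have "\<bar>h \<theta> T \<bullet> (Y N T - m T)\<bar> \<le> C * norm (Y N T - m T)"
        using C(2)[OF \<theta>, of T] T by (intro order_trans[OF Cauchy_Schwarz_ineq2] mult_right_mono) auto
      also have "\<bar>integral {0..T} (\<lambda>t. h' \<theta> t \<bullet> (Y N t - m t))\<bar> \<le> integral {0..T} (\<lambda>t. C * norm (Y N t - m t))"
        unfolding real_norm_def[symmetric]
      proof (rule integral_norm_bound_integral)
        show "(\<lambda>t. h' \<theta> t \<bullet> (Y N t - m t)) integrable_on {0..T}" "(\<lambda>t. C * norm (Y N t - m t)) integrable_on {0..T}"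
          by (intro integrable_continuous_interval continuous_intros ch' \<theta> Y cm)+
        show "norm (h' \<theta> t \<bullet> (Y N t - m t)) \<le> C * norm (Y N t - m t)" if "t \<in> {0..T}" for t
          unfolding real_norm_def using C(3)[OF \<theta> that] by (intro order_trans[OF Cauchy_Schwarz_ineq2] mult_right_mono) auto
      qed
      finally show ?thesis by (simp add: distrib_left)
    qed
  qed (use hat in auto)
qed

text \<open>For small \<open>\<delta>\<close>, the inequality \<open>|x| \<le> \<delta> + x\<^sup>4 / \<delta>\<^sup>3\<close> trades first powers for fourth powers.\<close>

lemma integral_norm_tendsto_0_of_fourth_powers:
  fixes z :: "nat \<Rightarrow> real \<Rightarrow> real^'r"
  assumes T: "0 \<le> T" and z: "\<And>N. continuous_on {0..T} (z N)"
    and lim: "\<And>k. (\<lambda>N. integral {0..T} (\<lambda>t. (z N t $ k) ^ 4)) \<longlonglongrightarrow> 0"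
  shows "(\<lambda>N. integral {0..T} (\<lambda>t. norm (z N t))) \<longlonglongrightarrow> 0"
proof (rule LIMSEQ_I)
  fix e :: real assume e: "0 < e"
  define \<delta> where "\<delta> = e / (2 * (real CARD('r) * T + 1))"
  have den: "0 < real CARD('r) * T + 1" using T by (auto intro: add_nonneg_pos)
  have \<delta>: "0 < \<delta>" using e den by (simp add: \<delta>_def)
  have le: "\<bar>x\<bar> \<le> \<delta> + x ^ 4 / \<delta> ^ 3" for x :: real
  proof (cases "\<bar>x\<bar> \<le> \<delta>")
    case True
    moreover have "0 \<le> x ^ 4 / \<delta> ^ 3" using \<delta> by simp
    ultimately show ?thesis by linarith
  next
    case False
    then have "\<delta> ^ 3 \<le> \<bar>x\<bar> ^ 3" using \<delta> by (intro power_mono) auto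
    then have "\<bar>x\<bar> * \<delta> ^ 3 \<le> \<bar>x\<bar> * \<bar>x\<bar> ^ 3" by (intro mult_left_mono) auto
    also have "\<dots> = \<bar>x\<bar> ^ Suc 3" by (rule power_Suc[symmetric])
    also have "\<dots> = x ^ 4" by (simp add: power_even_abs)
    finally have "\<bar>x\<bar> \<le> x ^ 4 / \<delta> ^ 3" using \<delta> by (simp add: pos_le_divide_eq)
    then show ?thesis using \<delta> by linarith
  qed
  have zk: "continuous_on {0..T} (\<lambda>t. z N t $ k)" for N k by (intro continuous_on_component z)
  have bound: "integral {0..T} (\<lambda>t. norm (z N t)) \<le> e / 2 + (\<Sum>k\<in>UNIV. integral {0..T} (\<lambda>t. (z N t $ k) ^ 4)) / \<delta> ^ 3" for N
  proof -
    have i4: "(\<lambda>t. (z N t $ k) ^ 4) integrable_on {0..T}" for k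
      by (intro integrable_continuous_interval continuous_intros zk)
    have "integral {0..T} (\<lambda>t. norm (z N t)) \<le> real CARD('r) * \<delta> * T + (\<Sum>k\<in>UNIV. integral {0..T} (\<lambda>t. (z N t $ k) ^ 4)) / \<delta> ^ 3"
    proof (rule has_integral_le)
      show "((\<lambda>t. norm (z N t)) has_integral integral {0..T} (\<lambda>t. norm (z N t))) {0..T}"
        by (intro integrable_integral integrable_continuous_interval continuous_intros z)
      have "((\<lambda>t. real CARD('r) * \<delta>) has_integral (T - 0) *\<^sub>R (real CARD('r) * \<delta>)) {0..T}"
        using has_integral_const_real[of "real CARD('r) * \<delta>" 0 T] T by simp
      then have c: "((\<lambda>t. real CARD('r) * \<delta>) has_integral real CARD('r) * \<delta> * T) {0..T}" by (simp add: mult.commute)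
      show "((\<lambda>t. real CARD('r) * \<delta> + (\<Sum>k\<in>UNIV. (z N t $ k) ^ 4) / \<delta> ^ 3) has_integral
         real CARD('r) * \<delta> * T + (\<Sum>k\<in>UNIV. integral {0..T} (\<lambda>t. (z N t $ k) ^ 4)) / \<delta> ^ 3) {0..T}"
        by (intro has_integral_add c has_integral_divide has_integral_sum integrable_integral i4) auto
      fix t
      have "norm (z N t) \<le> (\<Sum>k\<in>UNIV. \<bar>z N t $ k\<bar>)" by (rule norm_le_l1_cart)
      also have "\<dots> \<le> (\<Sum>k\<in>UNIV. \<delta> + (z N t $ k) ^ 4 / \<delta> ^ 3)" by (intro sum_mono le)
      also have "\<dots> = real CARD('r) * \<delta> + (\<Sum>k\<in>UNIV. (z N t $ k) ^ 4) / \<delta> ^ 3"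
        by (simp add: sum.distrib sum_divide_distrib)
      finally show "norm (z N t) \<le> real CARD('r) * \<delta> + (\<Sum>k\<in>UNIV. (z N t $ k) ^ 4) / \<delta> ^ 3" .
    qed
    also have "real CARD('r) * \<delta> * T \<le> e / 2"
    proof -
      have "real CARD('r) * \<delta> * T \<le> \<delta> * (real CARD('r) * T + 1)" using \<delta> by (simp add: algebra_simps)
      also have "\<delta> * (real CARD('r) * T + 1) = e / 2"
      proof -
        define q where "q = real CARD('r) * T + 1"
        have "0 < q" using den by (simp only: q_def)
        then have "e / (2 * q) * q = e / 2" by simp
        then show ?thesis by (simp only: \<delta>_def q_def)
      qed
      finally show ?thesis .
    qed
    finally show ?thesis by simp
  qed
  have "(\<lambda>N. (\<Sum>k\<in>UNIV. integral {0..T} (\<lambda>t. (z N t $ k) ^ 4)) / \<delta> ^ 3) \<longlonglongrightarrow> (\<Sum>k\<in>(UNIV::'r set). 0) / \<delta> ^ 3"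
    using \<delta> by (intro tendsto_divide tendsto_sum lim tendsto_const) auto
  then have "\<forall>\<^sub>F N in sequentially. (\<Sum>k\<in>UNIV. integral {0..T} (\<lambda>t. (z N t $ k) ^ 4)) / \<delta> ^ 3 < e / 2"
    using e by (intro order_tendstoD(2)) auto
  then obtain n0 where n0: "\<And>N. n0 \<le> N \<Longrightarrow> (\<Sum>k\<in>UNIV. integral {0..T} (\<lambda>t. (z N t $ k) ^ 4)) / \<delta> ^ 3 < e / 2"
    unfolding eventually_sequentially by blast
  show "\<exists>no. \<forall>n\<ge>no. norm (integral {0..T} (\<lambda>t. norm (z n t)) - 0) < e"
  proof (intro exI allI impI)
    fix n assume n: "n0 \<le> n"
    have "0 \<le> integral {0..T} (\<lambda>t. norm (z n t))"
      by (intro integral_nonneg integrable_continuous_interval continuous_intros z) auto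
    then have "norm (integral {0..T} (\<lambda>t. norm (z n t)) - 0) = integral {0..T} (\<lambda>t. norm (z n t))" by simp
    then show "norm (integral {0..T} (\<lambda>t. norm (z n t)) - 0) < e" using bound[of n] n0[OF n] by linarith
  qed
qed

text \<open>The fourth moment of the average at each time is at most \<open>3 K / N\<^sup>2\<close>, and the same bound times \<open>T\<close> holds after
integration over time. Both are summable over \<open>N\<close>.\<close>

lemma (in prob_space) process_law_of_large_numbers:
  fixes X :: "nat \<Rightarrow> real \<Rightarrow> 'a \<Rightarrow> real"
  assumes T: "0 \<le> T"
    and ind: "\<And>t. t \<in> {0..T} \<Longrightarrow> indep_vars (\<lambda>_. borel) (\<lambda>i. X i t) {1..}"
    and cont: "\<And>i \<omega>. 1 \<le> i \<Longrightarrow> \<omega> \<in> space M \<Longrightarrow> continuous_on {0..T} (\<lambda>t. X i t \<omega>)"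
    and int: "\<And>i t. 1 \<le> i \<Longrightarrow> t \<in> {0..T} \<Longrightarrow> integrable M (\<lambda>\<omega>. X i t \<omega> ^ 4)"
    and mean: "\<And>i t. 1 \<le> i \<Longrightarrow> t \<in> {0..T} \<Longrightarrow> expectation (X i t) = 0"
    and K: "\<And>i t. 1 \<le> i \<Longrightarrow> t \<in> {0..T} \<Longrightarrow> expectation (\<lambda>\<omega>. X i t \<omega> ^ 4) \<le> K" "0 < K"
  shows "t \<in> {0..T} \<Longrightarrow> AE \<omega> in M. (\<lambda>N. (1 / real N) * (\<Sum>i=1..N. X i t \<omega>)) \<longlonglongrightarrow> 0"
    and "AE \<omega> in M. (\<lambda>N. integral {0..T} (\<lambda>t. ((1 / real N) * (\<Sum>i=1..N. X i t \<omega>)) ^ 4)) \<longlonglongrightarrow> 0"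
proof -
  define A where "A N t \<omega> = (1 / real N) * (\<Sum>i=1..N. X i t \<omega>)" for N t \<omega>
  have Am: "A N t \<in> borel_measurable M" if "t \<in> {0..T}" for N t
    unfolding A_def using ind[OF that] by (intro borel_measurable_times borel_measurable_sum borel_measurable_const) (auto simp: indep_vars_def)
  have Ac: "continuous_on {0..T} (\<lambda>t. A N t \<omega>)" if "\<omega> \<in> space M" for N \<omega>
    unfolding A_def using cont that by (intro continuous_intros) auto
  have A4: "(\<integral>\<^sup>+\<omega>. ennreal (A (Suc n) t \<omega> ^ 4) \<partial>M) \<le> ennreal (3 * K * inverse (real (Suc n) ^ 2))" if t: "t \<in> {0..T}" for n t
  proof -
    note F = fourth_moment_sum_le[OF ind[OF t] int[OF _ t] mean[OF _ t] K(1)[OF _ t] K(2), of "Suc n"]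
    define c where "c = 1 / real (Suc n)"
    have "(\<integral>\<^sup>+\<omega>. ennreal (A (Suc n) t \<omega> ^ 4) \<partial>M) = (\<integral>\<^sup>+\<omega>. ennreal (c ^ 4 * (\<Sum>i=1..Suc n. X i t \<omega>) ^ 4) \<partial>M)"
      by (simp only: A_def c_def power_mult_distrib)
    also have "\<dots> = ennreal (expectation (\<lambda>\<omega>. c ^ 4 * (\<Sum>i=1..Suc n. X i t \<omega>) ^ 4))"
      using F(1) by (intro nn_integral_eq_integral integrable_mult_right AE_I2) auto
    also have "expectation (\<lambda>\<omega>. c ^ 4 * (\<Sum>i=1..Suc n. X i t \<omega>) ^ 4) = c ^ 4 * expectation (\<lambda>\<omega>. (\<Sum>i=1..Suc n. X i t \<omega>) ^ 4)"
      by (rule Bochner_Integration.integral_mult_right_zero)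
    also have "ennreal (c ^ 4 * expectation (\<lambda>\<omega>. (\<Sum>i=1..Suc n. X i t \<omega>) ^ 4)) \<le> ennreal (c ^ 4 * (3 * K * real (Suc n) ^ 2))"
      using F(2) by (intro ennreal_leI mult_left_mono) auto
    also have "c ^ 4 * (3 * K * real (Suc n) ^ 2) = 3 * K * inverse (real (Suc n) ^ 2)"
      by (simp add: c_def power4_eq_xxxx power2_eq_square divide_simps)
    finally show ?thesis .
  qed
  have sum: "summable (\<lambda>n. c * inverse (real (Suc n) ^ 2))" for c :: real
  proof (rule summable_mult)
    have "summable (\<lambda>n. inverse (real n ^ 2))" using inverse_power_summable[of 2, where 'a = real] by simp
    then show "summable (\<lambda>n. inverse (real (Suc n) ^ 2))" by (subst summable_Suc_iff)
  qed
  have bound_nonneg: "0 \<le> 3 * K * inverse (real (Suc n) ^ 2)" for n using K(2) by simp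
  show "AE \<omega> in M. (\<lambda>N. (1 / real N) * (\<Sum>i=1..N. X i t \<omega>)) \<longlonglongrightarrow> 0" if t: "t \<in> {0..T}"
  proof -
    have "AE \<omega> in M. (\<lambda>n. A (Suc n) t \<omega> ^ 4) \<longlonglongrightarrow> 0"
      by (rule AE_tendsto_0_of_summable[OF _ _ A4[OF t] sum bound_nonneg]) (use Am[OF t] in auto)
    then show ?thesis
    proof eventually_elim
      case (elim \<omega>)
      have "(\<lambda>n. \<bar>A (Suc n) t \<omega>\<bar> ^ 4) \<longlonglongrightarrow> 0" using elim by (simp add: power_even_abs)
      then have "(\<lambda>n. root 4 (\<bar>A (Suc n) t \<omega>\<bar> ^ 4)) \<longlonglongrightarrow> root 4 0" by (intro tendsto_real_root)
      moreover have "root 4 (\<bar>A (Suc n) t \<omega>\<bar> ^ 4) = \<bar>A (Suc n) t \<omega>\<bar>" for n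
        by (rule real_root_power_cancel) auto
      ultimately have "(\<lambda>n. \<bar>A (Suc n) t \<omega>\<bar>) \<longlonglongrightarrow> 0" by (simp only: real_root_zero)
      then have "(\<lambda>n. A (Suc n) t \<omega>) \<longlonglongrightarrow> 0" by (simp only: tendsto_rabs_zero_iff)
      then show ?case unfolding A_def by (rule LIMSEQ_imp_Suc)
    qed
  qed
  have "AE \<omega> in M. (\<lambda>n. \<bar>integral {0..T} (\<lambda>t. A (Suc n) t \<omega> ^ 4)\<bar>) \<longlonglongrightarrow> 0"
  proof (rule AE_tendsto_0_of_summable[OF _ _ _ sum[of "3 * K * T"]])
    show "(\<lambda>\<omega>. \<bar>integral {0..T} (\<lambda>t. A (Suc n) t \<omega> ^ 4)\<bar>) \<in> borel_measurable M" for n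
      using Am Ac by (intro borel_measurable_abs borel_measurable_integral_continuous_process[OF T] borel_measurable_power continuous_intros) auto
    show "0 \<le> 3 * K * T * inverse (real (Suc n) ^ 2)" for n using K(2) T by simp
    show "(\<integral>\<^sup>+\<omega>. ennreal \<bar>integral {0..T} (\<lambda>t. A (Suc n) t \<omega> ^ 4)\<bar> \<partial>M) \<le> ennreal (3 * K * T * inverse (real (Suc n) ^ 2))" for n
    proof -
      have "(\<integral>\<^sup>+\<omega>. ennreal \<bar>integral {0..T} (\<lambda>t. A (Suc n) t \<omega> ^ 4)\<bar> \<partial>M) = (\<integral>\<^sup>+\<omega>. ennreal (integral {0..T} (\<lambda>t. A (Suc n) t \<omega> ^ 4)) \<partial>M)"
        by (intro nn_integral_cong arg_cong[where f = ennreal] abs_of_nonneg integral_nonneg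
            integrable_continuous_interval continuous_intros Ac) auto
      also have "\<dots> \<le> ennreal (3 * K * inverse (real (Suc n) ^ 2) * T)"
        using Am Ac by (intro nn_integral_integral_continuous_process_le[OF T] borel_measurable_power continuous_intros A4) auto
      finally show ?thesis by (simp add: mult_ac)
    qed
  qed auto
  then show "AE \<omega> in M. (\<lambda>N. integral {0..T} (\<lambda>t. ((1 / real N) * (\<Sum>i=1..N. X i t \<omega>)) ^ 4)) \<longlonglongrightarrow> 0"
  proof eventually_elim
    case (elim \<omega>)
    then have "(\<lambda>n. integral {0..T} (\<lambda>t. A (Suc n) t \<omega> ^ 4)) \<longlonglongrightarrow> 0" by (simp only: tendsto_rabs_zero_iff)
    then show ?case unfolding A_def by (rule LIMSEQ_imp_Suc)
  qed
qed

section \<open>The observation records\<close>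

text \<open>The drift is bounded by \<open>C\<close> along density matrices, so its integral is Lipschitz in time.\<close>

lemma (in prob_space) drift_integral_regular:
  fixes Ls :: "'r::finite \<Rightarrow> complex^'d^'d" and \<rho> :: "real \<Rightarrow> 'a \<Rightarrow> complex^'d^'d"
  assumes \<rho>c: "\<And>\<omega>. \<omega> \<in> space M \<Longrightarrow> continuous_on {0..T} (\<lambda>t. \<rho> t \<omega>)"
    and dens: "AE \<omega> in M. \<forall>t\<in>{0..T}. density_matrix (\<rho> t \<omega>)"
    and C: "\<And>x :: complex^'d^'d. norm x \<le> 2 * (real CARD('d))\<^sup>2 \<Longrightarrow> norm (bvec Ls x) \<le> C"
  shows "\<And>\<omega>. \<omega> \<in> space M \<Longrightarrow> continuous_on {0..T} (\<lambda>t. bvec Ls (\<rho> t \<omega>))"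
    and "\<And>\<omega>. \<omega> \<in> space M \<Longrightarrow> continuous_on {0..T} (\<lambda>t. integral {0..t} (\<lambda>s. bvec Ls (\<rho> s \<omega>)))"
    and "AE \<omega> in M. \<forall>t\<in>{0..T}. norm (bvec Ls (\<rho> t \<omega>)) \<le> C"
    and "AE \<omega> in M. \<forall>s\<in>{0..T}. \<forall>t\<in>{0..T}.
      norm (integral {0..t} (\<lambda>s. bvec Ls (\<rho> s \<omega>)) - integral {0..s} (\<lambda>s. bvec Ls (\<rho> s \<omega>))) \<le> C * \<bar>t - s\<bar>"
proof -
  show bc: "continuous_on {0..T} (\<lambda>t. bvec Ls (\<rho> t \<omega>))" if "\<omega> \<in> space M" for \<omega>
    by (rule bounded_linear.continuous_on[OF bounded_linear_bvec \<rho>c[OF that]])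
  show "continuous_on {0..T} (\<lambda>t. integral {0..t} (\<lambda>s. bvec Ls (\<rho> s \<omega>)))" if "\<omega> \<in> space M" for \<omega>
    by (intro indefinite_integral_continuous_1 integrable_continuous_interval bc that)
  show bb: "AE \<omega> in M. \<forall>t\<in>{0..T}. norm (bvec Ls (\<rho> t \<omega>)) \<le> C"
    using dens by eventually_elim (auto intro!: C density_matrix_norm_le)
  show "AE \<omega> in M. \<forall>s\<in>{0..T}. \<forall>t\<in>{0..T}.
      norm (integral {0..t} (\<lambda>s. bvec Ls (\<rho> s \<omega>)) - integral {0..s} (\<lambda>s. bvec Ls (\<rho> s \<omega>))) \<le> C * \<bar>t - s\<bar>"
    using bb AE_space
  proof eventually_elim
    case (elim \<omega>)
    let ?b = "\<lambda>s. bvec Ls (\<rho> s \<omega>)"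
    have one: "norm (integral {0..t} ?b - integral {0..s} ?b) \<le> C * (t - s)" if "0 \<le> s" "s \<le> t" "t \<le> T" for s t
    proof -
      have i: "?b integrable_on {0..t}" "?b integrable_on {s..t}"
        using that by (auto intro!: integrable_continuous_interval continuous_on_subset[OF bc[OF elim(2)]])
      have "integral {0..t} ?b = integral {0..s} ?b + integral {s..t} ?b"
        by (rule Henstock_Kurzweil_Integration.integral_combine[OF that(1,2) i(1), symmetric])
      then have "norm (integral {0..t} ?b - integral {0..s} ?b) = norm (integral {s..t} ?b)" by simp
      also have "\<dots> \<le> C * (t - s)"
        using that elim(1) by (intro integral_bound continuous_on_subset[OF bc[OF elim(2)]]) auto
      finally show ?thesis .
    qed
    show ?case
    proof (intro ballI)
      fix s t assume st: "s \<in> {0..T}" "t \<in> {0..T}"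
      show "norm (integral {0..t} ?b - integral {0..s} ?b) \<le> C * \<bar>t - s\<bar>"
      proof (cases "s \<le> t")
        case True
        then show ?thesis using one[of s t] st by simp
      next
        case False
        then show ?thesis using one[of t s] st by (simp add: norm_minus_commute)
      qed
    qed
  qed
qed

text \<open>The centred record is the sum of a centred drift integral, bounded by \<open>2 C T\<close>, and a Wiener process, whose fourth moment
at time \<open>t\<close> is \<open>3 t\<^sup>2\<close>. It is measurable with respect to the filtration of its own Wiener process, which later
yields independence of different records.\<close>

lemma (in prob_space) record_fluctuation:
  fixes Ls :: "'r::finite \<Rightarrow> complex^'d^'d" and \<rho> :: "real \<Rightarrow> 'a \<Rightarrow> complex^'d^'d" and W :: "real \<Rightarrow> 'a \<Rightarrow> real^'r"
  assumes T: "0 < T"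
    and FW: "\<And>k. filtered_wiener M T F (\<lambda>t \<omega>. W t \<omega> $ k)"
    and W0: "\<And>\<omega>. \<omega> \<in> space M \<Longrightarrow> W 0 \<omega> = 0"
    and Wc: "\<And>\<omega>. \<omega> \<in> space M \<Longrightarrow> continuous_on {0..T} (\<lambda>t. W t \<omega>)"
    and ad: "\<And>t. t \<in> {0..T} \<Longrightarrow> \<rho> t \<in> borel_measurable (F t)"
    and \<rho>c: "\<And>\<omega>. \<omega> \<in> space M \<Longrightarrow> continuous_on {0..T} (\<lambda>t. \<rho> t \<omega>)"
    and dens: "AE \<omega> in M. \<forall>t\<in>{0..T}. density_matrix (\<rho> t \<omega>)"
    and C: "\<And>x :: complex^'d^'d. norm x \<le> 2 * (real CARD('d))\<^sup>2 \<Longrightarrow> norm (bvec Ls x) \<le> C"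
  defines "X t \<omega> \<equiv> integral {0..t} (\<lambda>s. bvec Ls (\<rho> s \<omega>)) + W t \<omega> - integral {0..t} (\<lambda>s. bvec Ls (expectation (\<rho> s)))"
  shows "\<And>t. t \<in> {0..T} \<Longrightarrow> (\<lambda>\<omega>. X t \<omega> $ k) \<in> borel_measurable (F T)"
    and "\<And>\<omega>. \<omega> \<in> space M \<Longrightarrow> continuous_on {0..T} (\<lambda>t. X t \<omega> $ k)"
    and "\<And>t. t \<in> {0..T} \<Longrightarrow> integrable M (\<lambda>\<omega>. (X t \<omega> $ k) ^ 4)"
    and "\<And>t. t \<in> {0..T} \<Longrightarrow> expectation (\<lambda>\<omega>. X t \<omega> $ k) = 0"
    and "\<And>t. t \<in> {0..T} \<Longrightarrow> expectation (\<lambda>\<omega>. (X t \<omega> $ k) ^ 4) \<le> 8 * (2 * C * T) ^ 4 + 24 * T\<^sup>2"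
proof -
  interpret B: filtered_wiener M T F "\<lambda>t \<omega>. W t \<omega> $ k" by (rule FW)
  have reg: "\<And>\<omega>. \<omega> \<in> space M \<Longrightarrow> continuous_on {0..T} (\<lambda>t. bvec Ls (\<rho> t \<omega>))"
    "\<And>\<omega>. \<omega> \<in> space M \<Longrightarrow> continuous_on {0..T} (\<lambda>t. integral {0..t} (\<lambda>s. bvec Ls (\<rho> s \<omega>)))"
    "AE \<omega> in M. \<forall>t\<in>{0..T}. norm (bvec Ls (\<rho> t \<omega>)) \<le> C"
    "AE \<omega> in M. \<forall>s\<in>{0..T}. \<forall>t\<in>{0..T}.
      norm (integral {0..t} (\<lambda>s. bvec Ls (\<rho> s \<omega>)) - integral {0..s} (\<lambda>s. bvec Ls (\<rho> s \<omega>))) \<le> C * \<bar>t - s\<bar>"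
    by (rule drift_integral_regular[OF \<rho>c dens C]; assumption)+
  define U where "U t \<omega> = integral {0..t} (\<lambda>s. bvec Ls (\<rho> s \<omega>))" for t \<omega>
  define m where "m t = integral {0..t} (\<lambda>s. bvec Ls (expectation (\<rho> s)))" for t
  have Xk: "X t \<omega> $ k = (U t \<omega> - m t) $ k + W t \<omega> $ k" for t \<omega>
    by (simp add: X_def U_def m_def)
  have C0: "0 \<le> C"
  proof -
    have "norm (bvec Ls 0) \<le> C" by (rule C) simp
    then show ?thesis using norm_ge_zero order_trans by blast
  qed
  have \<rho>M: "\<rho> t \<in> borel_measurable M" if "t \<in> {0..T}" for t
    by (rule B.measurable_from_F[OF ad[OF that] that])
  have bd: "AE \<omega> in M. \<forall>t\<in>{0..T}. norm (\<rho> t \<omega>) \<le> 2 * (real CARD('d))\<^sup>2"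
    using dens by eventually_elim (auto intro!: density_matrix_norm_le)
  have bd': "AE \<omega> in M. norm (\<rho> t \<omega>) \<le> 2 * (real CARD('d))\<^sup>2" if "t \<in> {0..T}" for t
    using bd by eventually_elim (use that in auto)
  have \<rho>i: "integrable M (\<rho> t)" "norm (expectation (\<rho> t)) \<le> 2 * (real CARD('d))\<^sup>2" if "t \<in> {0..T}" for t
    using norm_expectation_le[OF \<rho>M[OF that] bd'[OF that]] by auto
  have T0: "0 \<le> T" using T by simp
  have vc: "continuous_on {0..T} (\<lambda>t. expectation (\<rho> t))"
    by (rule expectation_integral_continuous_process(1)[OF T0 \<rho>M \<rho>c bd])
  have hc: "continuous_on {0..T} (\<lambda>t. bvec Ls (expectation (\<rho> t)))"
    by (rule bounded_linear.continuous_on[OF bounded_linear_bvec vc])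
  have mc: "continuous_on {0..T} m" unfolding m_def
    by (intro indefinite_integral_continuous_1 integrable_continuous_interval hc)
  have bm: "(\<lambda>\<omega>. bvec Ls (\<rho> s \<omega>)) \<in> borel_measurable N" if "\<rho> s \<in> borel_measurable N" for s N
    by (rule borel_measurable_continuous_on[OF bounded_linear.continuous_on[OF bounded_linear_bvec continuous_on_id] that])
  have UF: "U t \<in> borel_measurable (F T)" if t: "t \<in> {0..T}" for t
    unfolding U_def
  proof (rule borel_measurable_integral_continuous_process)
    show "0 \<le> t" using t by simp
    show "(\<lambda>\<omega>. bvec Ls (\<rho> s \<omega>)) \<in> borel_measurable (F T)" if "s \<in> {0..t}" for s
      using that t by (intro bm B.measurable_F_mono[OF ad]) auto
    show "continuous_on {0..t} (\<lambda>s. bvec Ls (\<rho> s \<omega>))" if "\<omega> \<in> space (F T)" for \<omega>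
      using that t B.space_F[of T] T by (intro continuous_on_subset[OF reg(1)]) auto
  qed
  have vn: "(\<lambda>v::real^'r. v $ k) \<in> borel_measurable borel"
    by (intro borel_measurable_continuous_onI continuous_intros)
  show XF: "(\<lambda>\<omega>. X t \<omega> $ k) \<in> borel_measurable (F T)" if t: "t \<in> {0..T}" for t
    unfolding Xk
  proof (rule borel_measurable_add)
    show "(\<lambda>\<omega>. (U t \<omega> - m t) $ k) \<in> borel_measurable (F T)"
      by (rule measurable_compose[OF _ vn]) (use UF[OF t] in measurable)
    show "(\<lambda>\<omega>. W t \<omega> $ k) \<in> borel_measurable (F T)"
      using t by (intro B.measurable_F_mono[OF B.adapted]) auto
  qed
  show "continuous_on {0..T} (\<lambda>t. X t \<omega> $ k)" if "\<omega> \<in> space M" for \<omega>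
    unfolding Xk using reg(2)[OF that] Wc[OF that] mc
    by (intro continuous_on_add continuous_on_component continuous_on_diff) (auto simp: U_def)
  fix t assume t: "t \<in> {0..T}"
  have TT: "T \<in> {0..T}" using T by simp
  have XM: "(\<lambda>\<omega>. X t \<omega> $ k) \<in> borel_measurable M" by (rule B.measurable_from_F[OF XF[OF t] TT])
  have UM: "U t \<in> borel_measurable M" by (rule B.measurable_from_F[OF UF[OF t] TT])
  have CT: "C * t \<le> C * T" using t C0 by (intro mult_left_mono) auto
  have Ub: "AE \<omega> in M. norm (U t \<omega>) \<le> C * T"
    using reg(4)
  proof eventually_elim
    case (elim \<omega>)
    have "0 \<in> {0..T}" using T by simp
    then have "norm (U t \<omega> - U 0 \<omega>) \<le> C * \<bar>t - 0\<bar>" using elim t unfolding U_def by blast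
    then show ?case using t CT by (simp add: U_def)
  qed
  have mb: "norm (m t) \<le> C * T"
  proof -
    have "norm (m t) \<le> C * (t - 0)"
      unfolding m_def using t by (intro integral_bound continuous_on_subset[OF hc] C \<rho>i) auto
    then show ?thesis using CT by simp
  qed
  have Ui: "integrable M (U t)" by (rule norm_expectation_le(1)[OF UM Ub])
  have t0: "0 \<le> t" using t by simp
  have EU: "expectation (U t) = m t"
  proof -
    have sT: "s \<in> {0..T}" if "s \<in> {0..t}" for s using that t by auto
    have bt: "AE \<omega> in M. \<forall>s\<in>{0..t}. norm (bvec Ls (\<rho> s \<omega>)) \<le> C"
      using reg(3) by eventually_elim (use sT in blast)
    have "expectation (U t) = integral {0..t} (\<lambda>s. expectation (\<lambda>\<omega>. bvec Ls (\<rho> s \<omega>)))"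
      unfolding U_def
      by (rule expectation_integral_continuous_process(2)[OF t0 bm[OF \<rho>M[OF sT]] continuous_on_subset[OF reg(1)] bt])
        (use t in auto)
    also have "\<dots> = m t"
      unfolding m_def using integral_bounded_linear[OF bounded_linear_bvec \<rho>i(1)[OF sT]] by (intro integral_cong) auto
    finally show ?thesis .
  qed
  have bl: "bounded_linear (\<lambda>v::real^'r. v $ k)" by (rule bounded_linear_vec_nth)
  have inc: "expectation (\<lambda>\<omega>. W t \<omega> $ k) = 0" "integrable M (\<lambda>\<omega>. W t \<omega> $ k)"
     "expectation (\<lambda>\<omega>. (W t \<omega> $ k) ^ 4) = 3 * t\<^sup>2" "integrable M (\<lambda>\<omega>. (W t \<omega> $ k) ^ 4)"
  proof -
    have tT: "t \<le> T" using t by simp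
    note mo = B.increment_moments[OF order_refl t0 tT]
    have c1: "expectation (\<lambda>\<omega>. g (W t \<omega> $ k - W 0 \<omega> $ k)) = expectation (\<lambda>\<omega>. g (W t \<omega> $ k))" for g :: "real \<Rightarrow> real"
      using W0 by (intro Bochner_Integration.integral_cong) auto
    have c2: "integrable M (\<lambda>\<omega>. g (W t \<omega> $ k - W 0 \<omega> $ k)) \<longleftrightarrow> integrable M (\<lambda>\<omega>. g (W t \<omega> $ k))" for g :: "real \<Rightarrow> real"
      using W0 by (intro Bochner_Integration.integrable_cong) auto
    show "expectation (\<lambda>\<omega>. W t \<omega> $ k) = 0" using mo(4) c1[of "\<lambda>x. x"] by simp
    show "integrable M (\<lambda>\<omega>. W t \<omega> $ k)" using mo(3) c2[of "\<lambda>x. x"] by simp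
    show "expectation (\<lambda>\<omega>. (W t \<omega> $ k) ^ 4) = 3 * t\<^sup>2" using mo(6) c1[of "\<lambda>x. x ^ 4"] by simp
    show "integrable M (\<lambda>\<omega>. (W t \<omega> $ k) ^ 4)" using mo(1) c2[of "\<lambda>x. x ^ 4"] by simp
  qed
  have Uk: "integrable M (\<lambda>\<omega>. (U t \<omega> - m t) $ k)" "expectation (\<lambda>\<omega>. (U t \<omega> - m t) $ k) = 0"
  proof -
    have i: "integrable M (\<lambda>\<omega>. U t \<omega> - m t)" using Ui by simp
    show "integrable M (\<lambda>\<omega>. (U t \<omega> - m t) $ k)" by (rule integrable_bounded_linear[OF bl i])
    have "expectation (\<lambda>\<omega>. (U t \<omega> - m t) $ k) = expectation (\<lambda>\<omega>. U t \<omega> - m t) $ k"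
      by (rule integral_bounded_linear[OF bl i])
    also have "expectation (\<lambda>\<omega>. U t \<omega> - m t) = 0" using Ui EU by (simp add: prob_space)
    finally show "expectation (\<lambda>\<omega>. (U t \<omega> - m t) $ k) = 0" by simp
  qed
  show "expectation (\<lambda>\<omega>. X t \<omega> $ k) = 0"
    unfolding Xk Bochner_Integration.integral_add[OF Uk(1) inc(2)] Uk(2) inc(1) by simp
  have four: "(a + b) ^ 4 \<le> 8 * a ^ 4 + 8 * b ^ 4" for a b :: real
  proof -
    have "(a + b) ^ 4 = ((a + b)\<^sup>2)\<^sup>2" by simp
    also have "\<dots> \<le> (2 * a\<^sup>2 + 2 * b\<^sup>2)\<^sup>2" by (intro power_mono power2_sum_le) auto
    also have "\<dots> \<le> 2 * (2 * a\<^sup>2)\<^sup>2 + 2 * (2 * b\<^sup>2)\<^sup>2" by (rule power2_sum_le)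
    also have "\<dots> = 8 * a ^ 4 + 8 * b ^ 4" by (simp add: power_mult_distrib)
    finally show ?thesis .
  qed
  have Xb: "AE \<omega> in M. (X t \<omega> $ k) ^ 4 \<le> 8 * (2 * C * T) ^ 4 + 8 * (W t \<omega> $ k) ^ 4"
    using Ub
  proof eventually_elim
    case (elim \<omega>)
    have "\<bar>(U t \<omega> - m t) $ k\<bar> \<le> norm (U t \<omega> - m t)" by (rule component_le_norm_cart)
    also have "\<dots> \<le> 2 * C * T" using norm_triangle_ineq4[of "U t \<omega>" "m t"] elim mb by linarith
    finally have "\<bar>(U t \<omega> - m t) $ k\<bar> ^ 4 \<le> (2 * C * T) ^ 4" by (intro power_mono) auto
    then have "((U t \<omega> - m t) $ k) ^ 4 \<le> (2 * C * T) ^ 4" by (simp only: power_even_abs_numeral even_numeral)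
    then show ?case unfolding Xk using four[of "(U t \<omega> - m t) $ k" "W t \<omega> $ k"] by linarith
  qed
  have ib: "integrable M (\<lambda>\<omega>. 8 * (2 * C * T) ^ 4 + 8 * (W t \<omega> $ k) ^ 4)" using inc by simp
  show iX: "integrable M (\<lambda>\<omega>. (X t \<omega> $ k) ^ 4)"
  proof (rule Bochner_Integration.integrable_bound[OF ib])
    show "(\<lambda>\<omega>. (X t \<omega> $ k) ^ 4) \<in> borel_measurable M" using XM by measurable
    show "AE \<omega> in M. norm ((X t \<omega> $ k) ^ 4) \<le> norm (8 * (2 * C * T) ^ 4 + 8 * (W t \<omega> $ k) ^ 4)"
      using Xb
    proof eventually_elim
      case (elim \<omega>)
      have "0 \<le> (X t \<omega> $ k) ^ 4" by simp
      then show ?case using elim unfolding real_norm_def by linarith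
    qed
  qed
  have "expectation (\<lambda>\<omega>. (X t \<omega> $ k) ^ 4) \<le> expectation (\<lambda>\<omega>. 8 * (2 * C * T) ^ 4 + 8 * (W t \<omega> $ k) ^ 4)"
    by (rule integral_mono_AE[OF iX ib Xb])
  also have "\<dots> = 8 * (2 * C * T) ^ 4 + 8 * (3 * t\<^sup>2)" using inc by (simp add: prob_space)
  also have "t\<^sup>2 \<le> T\<^sup>2" using t by (intro power_mono) auto
  finally show "expectation (\<lambda>\<omega>. (X t \<omega> $ k) ^ 4) \<le> 8 * (2 * C * T) ^ 4 + 24 * T\<^sup>2" by simp
qed

lemma continuous_on_eq_from_dense:
  fixes f g :: "'p::metric_space \<Rightarrow> 'b::t2_space"
  assumes "continuous_on S f" "continuous_on S g" "D \<subseteq> S" "S \<subseteq> closure D"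
    and "\<And>x. x \<in> D \<Longrightarrow> f x = g x" and "x \<in> S"
  shows "f x = g x"
proof -
  obtain u where u: "\<And>n. u n \<in> D" "u \<longlonglongrightarrow> x"
    using assms(4,6) closure_sequential by blast
  have uS: "\<forall>\<^sub>F n in sequentially. u n \<in> S" using u(1) assms(3) by (intro always_eventually) blast
  have "(\<lambda>n. f (u n)) \<longlonglongrightarrow> f x" "(\<lambda>n. g (u n)) \<longlonglongrightarrow> g x"
    by (rule continuous_on_tendsto_compose[OF assms(1) u(2) assms(6) uS],
        rule continuous_on_tendsto_compose[OF assms(2) u(2) assms(6) uS])
  moreover have "(\<lambda>n. f (u n)) = (\<lambda>n. g (u n))" using assms(5) u(1) by auto
  ultimately show ?thesis using LIMSEQ_unique by metis
qed

text \<open>The mean record is a Lipschitz drift plus an average of Wiener processes, so the scalar result applies to each coordinate.\<close>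

lemma (in prob_space) record_integral_by_parts:
  fixes Ls :: "'r::finite \<Rightarrow> complex^'d^'d" and \<rho> :: "nat \<Rightarrow> real \<Rightarrow> 'a \<Rightarrow> complex^'d^'d"
    and W :: "nat \<Rightarrow> real \<Rightarrow> 'a \<Rightarrow> real^'r" and x x' :: "real \<Rightarrow> real^'r"
  assumes T: "0 < T" and N: "1 \<le> N"
    and FW: "\<And>i k. i \<in> {1..N} \<Longrightarrow> filtered_wiener M T F (\<lambda>t \<omega>. W i t \<omega> $ k)"
    and W0: "\<And>i \<omega>. i \<in> {1..N} \<Longrightarrow> \<omega> \<in> space M \<Longrightarrow> W i 0 \<omega> = 0"
    and Wc: "\<And>i \<omega>. i \<in> {1..N} \<Longrightarrow> \<omega> \<in> space M \<Longrightarrow> continuous_on {0..T} (\<lambda>t. W i t \<omega>)"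
    and \<rho>m: "\<And>i t. i \<in> {1..N} \<Longrightarrow> t \<in> {0..T} \<Longrightarrow> \<rho> i t \<in> borel_measurable M"
    and \<rho>c: "\<And>i \<omega>. i \<in> {1..N} \<Longrightarrow> \<omega> \<in> space M \<Longrightarrow> continuous_on {0..T} (\<lambda>t. \<rho> i t \<omega>)"
    and dens: "\<And>i. i \<in> {1..N} \<Longrightarrow> AE \<omega> in M. \<forall>t\<in>{0..T}. density_matrix (\<rho> i t \<omega>)"
    and C: "\<And>x :: complex^'d^'d. norm x \<le> 2 * (real CARD('d))\<^sup>2 \<Longrightarrow> norm (bvec Ls x) \<le> C"
    and x: "\<And>t. t \<in> {0..T} \<Longrightarrow> (x has_vector_derivative x' t) (at t within {0..T})"
    and x': "continuous_on {0..T} x'"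
  defines "Y t \<omega> \<equiv> (1 / real N) *\<^sub>R (\<Sum>i=1..N. integral {0..t} (\<lambda>s. bvec Ls (\<rho> i s \<omega>)) + W i t \<omega>)"
  assumes J: "has_ito_integral_inner M F Y (\<lambda>t \<omega>. x t) T J"
  shows "AE \<omega> in M. J \<omega> = x T \<bullet> Y T \<omega> - integral {0..T} (\<lambda>t. x' t \<bullet> Y t \<omega>)"
proof -
  define U where "U i t \<omega> = integral {0..t} (\<lambda>s. bvec Ls (\<rho> i s \<omega>))" for i t \<omega>
  define V where "V k t \<omega> = (1 / real N) * (\<Sum>i=1..N. U i t \<omega> $ k)" for k t \<omega>
  have Yk: "Y t \<omega> $ k = V k t \<omega> + (1 / real N) * (\<Sum>i=1..N. W i t \<omega> $ k)" for t \<omega> k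
    by (simp add: Y_def V_def U_def sum.distrib distrib_left)
  have C0: "0 \<le> C"
  proof -
    have "norm (bvec Ls 0) \<le> C" by (rule C) simp
    then show ?thesis using norm_ge_zero order_trans by blast
  qed
  have bc: "continuous_on {0..T} (\<lambda>t. bvec Ls (\<rho> i t \<omega>))" and Uc: "continuous_on {0..T} (\<lambda>t. U i t \<omega>)"
    if "i \<in> {1..N}" "\<omega> \<in> space M" for i \<omega>
    unfolding U_def by (rule drift_integral_regular[OF \<rho>c[OF that(1)] dens[OF that(1)] C]; (assumption | rule that))+
  have Ulip: "AE \<omega> in M. \<forall>s\<in>{0..T}. \<forall>t\<in>{0..T}. norm (U i t \<omega> - U i s \<omega>) \<le> C * \<bar>t - s\<bar>" if "i \<in> {1..N}" for i
    unfolding U_def by (rule drift_integral_regular(4)[OF \<rho>c[OF that(1)] dens[OF that(1)] C]; assumption)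
  have Um: "U i t \<in> borel_measurable M" if i: "i \<in> {1..N}" and t: "t \<in> {0..T}" for i t
    unfolding U_def
  proof (rule borel_measurable_integral_continuous_process)
    show "0 \<le> t" using t by simp
    show "(\<lambda>\<omega>. bvec Ls (\<rho> i s \<omega>)) \<in> borel_measurable M" if "s \<in> {0..t}" for s
      by (rule borel_measurable_continuous_on[OF bounded_linear.continuous_on[OF bounded_linear_bvec continuous_on_id] \<rho>m[OF i]])
         (use that t in auto)
    show "continuous_on {0..t} (\<lambda>s. bvec Ls (\<rho> i s \<omega>))" if "\<omega> \<in> space M" for \<omega>
      using t by (intro continuous_on_subset[OF bc[OF i that]]) auto
  qed
  have vn: "(\<lambda>v::real^'r. v $ k) \<in> borel_measurable borel" for k
    by (intro borel_measurable_continuous_onI continuous_intros)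
  have L2: "l2_integrator M T F (\<lambda>t \<omega>. Y t \<omega> $ k) (2 * C\<^sup>2 * T + 2)" for k
    unfolding Yk
  proof (rule l2_integrator_drift_plus_average[OF T N FW])
    show "continuous_on {0..T} (\<lambda>t. W i t \<omega> $ k)" if "i \<in> {1..N}" "\<omega> \<in> space M" for i \<omega>
      by (intro continuous_on_component Wc that)
    show "W i 0 \<omega> $ k = 0" if "i \<in> {1..N}" "\<omega> \<in> space M" for i \<omega>
      using W0[OF that] by simp
    show "V k t \<in> borel_measurable M" if "t \<in> {0..T}" for t
      unfolding V_def using Um that
      by (intro borel_measurable_times borel_measurable_sum borel_measurable_const measurable_compose[OF _ vn]) auto
    show "continuous_on {0..T} (\<lambda>t. V k t \<omega>)" if "\<omega> \<in> space M" for \<omega>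
      unfolding V_def using that by (intro continuous_on_mult continuous_on_const continuous_on_sum continuous_on_component Uc) auto
    show "V k 0 \<omega> = 0" for \<omega> by (simp add: V_def U_def)
    have "AE \<omega> in M. \<forall>i\<in>{1..N}. \<forall>s\<in>{0..T}. \<forall>t\<in>{0..T}. norm (U i t \<omega> - U i s \<omega>) \<le> C * \<bar>t - s\<bar>"
      by (rule AE_finite_allI[OF _ Ulip]) auto
    then show "AE \<omega> in M. \<forall>s\<in>{0..T}. \<forall>t\<in>{0..T}. \<bar>V k t \<omega> - V k s \<omega>\<bar> \<le> C * \<bar>t - s\<bar>"
    proof eventually_elim
      case (elim \<omega>)
      show ?case
      proof (intro ballI)
        fix s t assume st: "s \<in> {0..T}" "t \<in> {0..T}"
        have "V k t \<omega> - V k s \<omega> = (1 / real N) * (\<Sum>i=1..N. (U i t \<omega> - U i s \<omega>) $ k)"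
          by (simp add: V_def sum_subtractf right_diff_distrib)
        then have "\<bar>V k t \<omega> - V k s \<omega>\<bar> = (1 / real N) * \<bar>\<Sum>i=1..N. (U i t \<omega> - U i s \<omega>) $ k\<bar>"
          by (simp add: abs_mult)
        also have "\<dots> \<le> (1 / real N) * (\<Sum>i=1..N. C * \<bar>t - s\<bar>)"
        proof (intro mult_left_mono order_trans[OF sum_abs] sum_mono)
          fix i assume i: "i \<in> {1..N}"
          have "norm (U i t \<omega> - U i s \<omega>) \<le> C * \<bar>t - s\<bar>" using elim i st by blast
          then show "\<bar>(U i t \<omega> - U i s \<omega>) $ k\<bar> \<le> C * \<bar>t - s\<bar>"
            by (rule order_trans[OF component_le_norm_cart])
        qed simp
        also have "\<dots> = C * \<bar>t - s\<bar>" using N by simp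
        finally show "\<bar>V k t \<omega> - V k s \<omega>\<bar> \<le> C * \<bar>t - s\<bar>" .
      qed
    qed
  qed (use C0 in auto)
  obtain I where I: "\<And>k. has_ito_integral M F (\<lambda>s \<omega>. Y s \<omega> $ k) (\<lambda>s \<omega>. x s $ k) T (I k)"
    and JI: "AE \<omega> in M. J \<omega> = (\<Sum>k\<in>UNIV. I k \<omega>)"
    using J unfolding has_ito_integral_inner_def by blast
  have "AE \<omega> in M. I k \<omega> = x T $ k * Y T \<omega> $ k - integral {0..T} (\<lambda>t. x' t $ k * Y t \<omega> $ k)" for k
    by (rule l2_integrator.ito_integral_by_parts[OF L2 I])
       (auto intro: bounded_linear.has_vector_derivative[OF bounded_linear_vec_nth x] continuous_on_component x')
  then have "AE \<omega> in M. \<forall>k. I k \<omega> = x T $ k * Y T \<omega> $ k - integral {0..T} (\<lambda>t. x' t $ k * Y t \<omega> $ k)"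
    by (subst AE_all_countable) auto
  then show ?thesis
    using JI AE_space
  proof eventually_elim
    case (elim \<omega>)
    have Yc: "continuous_on {0..T} (\<lambda>t. Y t \<omega> $ k)" for k
      by (rule l2_integrator.Z_cont[OF L2 elim(3)])
    have "(\<lambda>t. x' t $ k * Y t \<omega> $ k) integrable_on {0..T}" for k
      by (intro integrable_continuous_interval continuous_on_mult continuous_on_component x' Yc)
    then have "integral {0..T} (\<lambda>t. x' t \<bullet> Y t \<omega>) = (\<Sum>k\<in>UNIV. integral {0..T} (\<lambda>t. x' t $ k * Y t \<omega> $ k))"
      unfolding inner_vec_def inner_real_def by (intro Henstock_Kurzweil_Integration.integral_sum) auto
    then show ?case
      using elim(1,2) by (simp add: inner_vec_def sum_subtractf)
  qed
qed

theorem theorem3p1: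
  fixes M :: "'w measure"
    and T :: real
    and \<Theta>0 :: "(real^'p) set" and \<theta>0 :: "real^'p" and A :: "'p set"
    and H :: "real^'p \<Rightarrow> complex^'d^'d"
    and L :: "real^'p \<Rightarrow> 'r::finite \<Rightarrow> complex^'d^'d"
    and W :: "nat \<Rightarrow> real \<Rightarrow> 'w \<Rightarrow> real^'r"
    and \<rho>0 :: "complex^'d^'d"
    and \<rho> :: "real^'p \<Rightarrow> nat \<Rightarrow> real \<Rightarrow> 'w \<Rightarrow> complex^'d^'d"
    and J :: "nat \<Rightarrow> real^'p \<Rightarrow> 'w \<Rightarrow> real"
    and \<theta>hat :: "nat \<Rightarrow> 'w \<Rightarrow> real^'p"
  assumes prob: "prob_space M"
    and T: "0 < T"
    and Theta: "open \<Theta>0" "convex \<Theta>0" "bounded \<Theta>0" "\<theta>0 \<in> \<Theta>0"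
    and H_selfadjoint: "\<And>\<theta>. \<theta> \<in> closure \<Theta>0 \<Longrightarrow> adj (H (alpha_part A \<theta>)) = H (alpha_part A \<theta>)"
    and W: "independent_wiener M T W {1..}"
    and rho0: "density_matrix \<rho>0"
    and rho_solution: "\<And>\<theta> i. \<theta> \<in> closure \<Theta>0 \<Longrightarrow> 1 \<le> i \<Longrightarrow>
      sme_solution M T (aug_filtration M W {i}) (W i)
        (H (alpha_part A \<theta>)) (L (beta_part A \<theta>)) \<rho>0 (\<rho> \<theta> i)"
    and rho_density: "\<And>\<theta> i. \<theta> \<in> closure \<Theta>0 \<Longrightarrow> 1 \<le> i \<Longrightarrow>
      AE \<omega> in M. \<forall>t\<in>{0..T}. density_matrix (\<rho> \<theta> i t \<omega>)"
    and H_C1: "C1_on_closure \<Theta>0 (\<lambda>\<theta>. H (alpha_part A \<theta>))"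
    and L_C1: "\<And>k. C1_on_closure \<Theta>0 (\<lambda>\<theta>. L (beta_part A \<theta>) k)"
    and identifiable: "\<And>\<theta>. \<theta> \<in> closure \<Theta>0 \<Longrightarrow> \<theta> \<noteq> \<theta>0 \<Longrightarrow>
      \<exists>t\<in>{0..T}. mean_signal M A L \<rho> t \<theta> \<noteq> mean_signal M A L \<rho> t \<theta>0"
    and J_version: "\<And>N \<theta>. 1 \<le> N \<Longrightarrow> \<theta> \<in> closure \<Theta>0 \<Longrightarrow>
      has_ito_integral_inner M (aug_filtration M W {1..N}) (mean_record A L W \<rho> \<theta>0 N)
        (\<lambda>t \<omega>. mean_signal M A L \<rho> t \<theta>) T (J N \<theta>)"
    and J_continuous: "\<And>N. 1 \<le> N \<Longrightarrow>
      AE \<omega> in M. continuous_on (closure \<Theta>0) (\<lambda>\<theta>. J N \<theta> \<omega>)"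
    and estimator_measurable: "\<And>N. 1 \<le> N \<Longrightarrow> \<theta>hat N \<in> borel_measurable M"
    and estimator_maximizes: "\<And>N. 1 \<le> N \<Longrightarrow>
      AE \<omega> in M. is_arg_max (contrast M T A L \<rho> J N \<omega>) (\<lambda>\<theta>. \<theta> \<in> closure \<Theta>0) (\<theta>hat N \<omega>)"
  shows "AE \<omega> in M. (\<lambda>N. \<theta>hat N \<omega>) \<longlonglongrightarrow> \<theta>0"
proof -
  interpret prob_space M by (rule prob)
  let ?S = "closure \<Theta>0"
  define Hm where "Hm \<theta> = H (alpha_part A \<theta>)" for \<theta>
  define Ls where "Ls \<theta> = L (beta_part A \<theta>)" for \<theta>
  define v where "v \<theta> t = mean_state M \<rho> \<theta> t" for \<theta> t
  define h where "h \<theta> t = bvec (Ls \<theta>) (v \<theta> t)" for \<theta> t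
  define h' where "h' \<theta> t = bvec (Ls \<theta>) (lindblad (Hm \<theta>) (Ls \<theta>) (v \<theta> t))" for \<theta> t
  define Y where "Y N t \<omega> = mean_record A L W \<rho> \<theta>0 N t \<omega>" for N t \<omega>
  have T0: "0 \<le> T" "T \<in> {0..T}" using T by auto
  have S: "compact ?S" using Theta(3) by (simp add: compact_closure)
  have \<theta>0: "\<theta>0 \<in> ?S" using Theta(4) closure_subset by blast
  have signal: "mean_signal M A L \<rho> t \<theta> = h \<theta> t" for t \<theta>
    by (simp add: mean_signal_def h_def v_def Ls_def)
  have cH: "continuous_on ?S Hm" using H_C1 by (simp add: C1_on_closure_def Hm_def[abs_def])
  have cL: "continuous_on ?S (\<lambda>\<theta>. Ls \<theta> k)" for k using L_C1[of k] by (simp add: C1_on_closure_def Ls_def)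
  have wien: "wiener_process M T (W i)" if "1 \<le> i" for i
    using W that by (auto simp: independent_wiener_def)
  have W0: "W i 0 \<omega> = 0" and Wc: "continuous_on {0..T} (\<lambda>t. W i t \<omega>)" if "1 \<le> i" "\<omega> \<in> space M" for i \<omega>
    using wien[OF that(1)] that(2) unfolding wiener_process_def by blast+
  have FW1: "filtered_wiener M T (aug_filtration M W {i}) (\<lambda>t \<omega>. W i t \<omega> $ k)" if "1 \<le> i" for i k
    using that by (intro filtered_wiener_component[OF W]) auto
  have FWN: "filtered_wiener M T (aug_filtration M W {1..N}) (\<lambda>t \<omega>. W i t \<omega> $ k)" if "i \<in> {1..N}" for i k N
    using that by (intro filtered_wiener_component[OF W]) auto
  have sol: "sme_solution M T (aug_filtration M W {i}) (W i) (Hm \<theta>) (Ls \<theta>) \<rho>0 (\<rho> \<theta> i)" if "\<theta> \<in> ?S" "1 \<le> i" for \<theta> i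
    using rho_solution[OF that] by (simp add: Hm_def Ls_def)
  have \<rho>ad: "\<rho> \<theta> i t \<in> borel_measurable (aug_filtration M W {i} t)" if "\<theta> \<in> ?S" "1 \<le> i" "t \<in> {0..T}" for \<theta> i t
    using sol[OF that(1,2)] that(3) unfolding sme_solution_def by blast
  have \<rho>c: "continuous_on {0..T} (\<lambda>t. \<rho> \<theta> i t \<omega>)" if "\<theta> \<in> ?S" "1 \<le> i" "\<omega> \<in> space M" for \<theta> i \<omega>
    using sol[OF that(1,2)] that(3) unfolding sme_solution_def by blast
  have \<rho>m: "\<rho> \<theta> i t \<in> borel_measurable M" if "\<theta> \<in> ?S" "1 \<le> i" "t \<in> {0..T}" for \<theta> i t
    by (rule filtered_wiener.measurable_from_F[OF FW1[OF that(2)] \<rho>ad[OF that] that(3)])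
  have ode: "continuous_on {0..T} (\<lambda>t. expectation (\<rho> \<theta> i t))"
    "\<And>t. t \<in> {0..T} \<Longrightarrow> expectation (\<rho> \<theta> i t) = \<rho>0 + integral {0..t} (\<lambda>s. lindblad (Hm \<theta>) (Ls \<theta>) (expectation (\<rho> \<theta> i s)))"
    "\<And>t. t \<in> {0..T} \<Longrightarrow> norm (expectation (\<rho> \<theta> i t)) \<le> 2 * (real CARD('d))\<^sup>2"
    if \<theta>: "\<theta> \<in> ?S" and i: "1 \<le> i" for \<theta> i
    by (rule mean_state_integral_equation[OF T0(1) FW1[OF i] sol[OF \<theta> i] rho_density[OF \<theta> i]]; assumption)+
  have v1: "v \<theta> t = expectation (\<rho> \<theta> 1 t)" for \<theta> t by (simp add: v_def mean_state_def)
  have vc: "continuous_on {0..T} (v \<theta>)"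
    and veq: "\<And>t. t \<in> {0..T} \<Longrightarrow> v \<theta> t = \<rho>0 + integral {0..t} (\<lambda>s. lindblad (Hm \<theta>) (Ls \<theta>) (v \<theta> s))"
    and vb: "\<And>t. t \<in> {0..T} \<Longrightarrow> norm (v \<theta> t) \<le> 2 * (real CARD('d))\<^sup>2" if \<theta>: "\<theta> \<in> ?S" for \<theta>
    unfolding v1[abs_def] using ode[OF \<theta> order_refl] by blast+
  \<comment> \<open>All trajectories have the same mean state, by uniqueness for the integral equation.\<close>
  have vi: "expectation (\<rho> \<theta> i t) = v \<theta> t" if \<theta>: "\<theta> \<in> ?S" and i: "1 \<le> i" and t: "t \<in> {0..T}" for \<theta> i t
  proof -
    obtain K where K: "0 < K" "\<And>x. norm (lindblad (Hm \<theta>) (Ls \<theta>) x) \<le> norm x * K"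
      using bounded_linear.pos_bounded[OF bounded_linear_lindblad] by blast
    have "norm (expectation (\<rho> \<theta> i t) - v \<theta> t) \<le> 2 * (0 * T) * exp (2 * K * T)"
      by (rule integral_equation_comparison[OF T0(1) K(1) linear_lindblad _ linear_lindblad
           ode(1)[OF \<theta> i] ode(2)[OF \<theta> i] vc[OF \<theta>] veq[OF \<theta>] _ _ t])
         (use K(2) in \<open>auto simp: mult.commute\<close>)
    then show ?thesis by simp
  qed
  have v2: "continuous_on (?S \<times> {0..T}) (\<lambda>z. v (fst z) (snd z))"
    by (rule lindblad_solutions_jointly_continuous[OF S cH cL T0(1) vc veq vb])
  have cHz: "continuous_on (?S \<times> {0..T}) (\<lambda>z. Hm (fst z))" and cLz: "continuous_on (?S \<times> {0..T}) (\<lambda>z. Ls (fst z) k)" for k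
    by (intro continuous_on_compose2[OF cH] continuous_on_compose2[OF cL] continuous_on_fst continuous_on_id, auto)+
  have ch: "continuous_on (?S \<times> {0..T}) (\<lambda>z. h (fst z) (snd z))"
    unfolding h_def by (intro continuous_on_bvec cLz v2)
  have ch': "continuous_on (?S \<times> {0..T}) (\<lambda>z. h' (fst z) (snd z))"
    unfolding h'_def by (intro continuous_on_bvec continuous_on_lindblad cHz cLz v2)
  have deriv: "(h \<theta> has_vector_derivative h' \<theta> t) (at t within {0..T})" if \<theta>: "\<theta> \<in> ?S" and t: "t \<in> {0..T}" for \<theta> t
  proof -
    have "continuous_on {0..T} (\<lambda>s. lindblad (Hm \<theta>) (Ls \<theta>) (v \<theta> s))"
      by (rule bounded_linear.continuous_on[OF bounded_linear_lindblad vc[OF \<theta>]])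
    then have "((\<lambda>t. integral {0..t} (\<lambda>s. lindblad (Hm \<theta>) (Ls \<theta>) (v \<theta> s))) has_vector_derivative lindblad (Hm \<theta>) (Ls \<theta>) (v \<theta> t)) (at t within {0..T})"
      by (rule integral_has_vector_derivative[OF _ t])
    from has_vector_derivative_add[OF has_vector_derivative_const[of \<rho>0] this]
    have "((\<lambda>t. \<rho>0 + integral {0..t} (\<lambda>s. lindblad (Hm \<theta>) (Ls \<theta>) (v \<theta> s))) has_vector_derivative lindblad (Hm \<theta>) (Ls \<theta>) (v \<theta> t)) (at t within {0..T})"
      by simp
    then have "(v \<theta> has_vector_derivative lindblad (Hm \<theta>) (Ls \<theta>) (v \<theta> t)) (at t within {0..T})"
      by (rule has_vector_derivative_transform[OF t veq[OF \<theta>], rotated])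
    then show ?thesis
      unfolding h_def[abs_def] h'_def by (rule bounded_linear.has_vector_derivative[OF bounded_linear_bvec])
  qed
  obtain C where C: "\<And>x :: complex^'d^'d. norm x \<le> 2 * (real CARD('d))\<^sup>2 \<Longrightarrow> norm (bvec (Ls \<theta>0) x) \<le> C"
  proof -
    obtain K where K: "0 < K" "\<And>x. norm (bvec (Ls \<theta>0) x) \<le> norm x * K"
      using bounded_linear.pos_bounded[OF bounded_linear_bvec] by blast
    have "norm (bvec (Ls \<theta>0) x) \<le> 2 * (real CARD('d))\<^sup>2 * K" if "norm x \<le> 2 * (real CARD('d))\<^sup>2" for x
      using mult_right_mono[OF that, of K] K(1) K(2)[of x] by linarith
    then show thesis by (rule that)
  qed
  have Yeq: "Y N t \<omega> = (1 / real N) *\<^sub>R (\<Sum>i=1..N. integral {0..t} (\<lambda>s. bvec (Ls \<theta>0) (\<rho> \<theta>0 i s \<omega>)) + W i t \<omega>)" for N t \<omega>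
    by (simp add: Y_def mean_record_def obs_record_def Ls_def)
  have hslice: "continuous_on {0..T} (h' \<theta>)" if "\<theta> \<in> ?S" for \<theta>
  proof -
    have "continuous_on {0..T} (\<lambda>t. (\<theta>, t))" by (intro continuous_intros)
    from continuous_on_compose2[OF ch' this] show ?thesis using that by auto
  qed
  have parts: "AE \<omega> in M. J N \<theta> \<omega> = h \<theta> T \<bullet> Y N T \<omega> - integral {0..T} (\<lambda>t. h' \<theta> t \<bullet> Y N t \<omega>)"
    if N: "1 \<le> N" and \<theta>: "\<theta> \<in> ?S" for N \<theta>
    unfolding Yeq
  proof (rule record_integral_by_parts[OF T N FWN W0 Wc \<rho>m[OF \<theta>0] \<rho>c[OF \<theta>0] rho_density[OF \<theta>0] C deriv[OF \<theta>] hslice[OF \<theta>]])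
    have "has_ito_integral_inner M (aug_filtration M W {1..N}) (Y N) (\<lambda>t \<omega>. h \<theta> t) T (J N \<theta>)"
      using J_version[OF N \<theta>] by (simp add: Y_def[abs_def] signal)
    then show "has_ito_integral_inner M (aug_filtration M W {1..N})
       (\<lambda>t \<omega>. (1 / real N) *\<^sub>R (\<Sum>i=1..N. integral {0..t} (\<lambda>s. bvec (Ls \<theta>0) (\<rho> \<theta>0 i s \<omega>)) + W i t \<omega>))
       (\<lambda>t \<omega>. h \<theta> t) T (J N \<theta>)"
      by (simp only: Yeq[abs_def])
  qed auto
  define X where "X i t \<omega> = integral {0..t} (\<lambda>s. bvec (Ls \<theta>0) (\<rho> \<theta>0 i s \<omega>)) + W i t \<omega> -
      integral {0..t} (\<lambda>s. bvec (Ls \<theta>0) (expectation (\<rho> \<theta>0 i s)))" for i t \<omega>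
  define Kf where "Kf = 8 * (2 * C * T) ^ 4 + 24 * T\<^sup>2"
  have Kf: "0 < Kf" using T by (auto simp: Kf_def intro: add_nonneg_pos)
  have XF: "(\<lambda>\<omega>. X i t \<omega> $ k) \<in> borel_measurable (aug_filtration M W {i} T)"
    and X4: "integrable M (\<lambda>\<omega>. (X i t \<omega> $ k) ^ 4)" and X1: "expectation (\<lambda>\<omega>. X i t \<omega> $ k) = 0"
    and XK: "expectation (\<lambda>\<omega>. (X i t \<omega> $ k) ^ 4) \<le> Kf" if i: "1 \<le> i" and t: "t \<in> {0..T}" for i t k
    unfolding X_def Kf_def
    by (rule record_fluctuation[OF T FW1[OF i] W0[OF i] Wc[OF i] \<rho>ad[OF \<theta>0 i] \<rho>c[OF \<theta>0 i] rho_density[OF \<theta>0 i] C];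
        (assumption | rule t))+
  have Xc: "continuous_on {0..T} (\<lambda>t. X i t \<omega> $ k)" if i: "1 \<le> i" and \<omega>: "\<omega> \<in> space M" for i k \<omega>
    unfolding X_def
    by (rule record_fluctuation[OF T FW1[OF i] W0[OF i] Wc[OF i] \<rho>ad[OF \<theta>0 i] \<rho>c[OF \<theta>0 i] rho_density[OF \<theta>0 i] C];
        (assumption | rule \<omega>))+
  have Xind: "indep_vars (\<lambda>_. borel) (\<lambda>i \<omega>. X i t \<omega> $ k) {1..}" if t: "t \<in> {0..T}" for t k
    unfolding indep_vars_def2
  proof (intro conjI ballI)
    fix i :: nat assume "i \<in> {1..}"
    then have i: "1 \<le> i" by simp
    show "(\<lambda>\<omega>. X i t \<omega> $ k) \<in> borel_measurable M"
      by (rule filtered_wiener.measurable_from_F[OF FW1[OF i] XF[OF i t] T0(2)])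
  next
    show "indep_sets (\<lambda>i. {(\<lambda>\<omega>. X i t \<omega> $ k) -` B \<inter> space M |B. B \<in> sets borel}) {1..}"
    proof (rule indep_sets_mono_sets[OF indep_aug_filtration_singletons[OF W]])
      fix i :: nat assume "i \<in> {1..}"
      then have i: "1 \<le> i" by simp
      show "{(\<lambda>\<omega>. X i t \<omega> $ k) -` B \<inter> space M |B. B \<in> sets borel} \<subseteq> sets (aug_filtration M W {i} T)"
        using measurable_sets[OF XF[OF i t, of k]] by (auto simp: space_aug_filtration)
    qed
  qed
  have lln: "t \<in> {0..T} \<Longrightarrow> AE \<omega> in M. (\<lambda>N. (1 / real N) * (\<Sum>i=1..N. X i t \<omega> $ k)) \<longlonglongrightarrow> 0"
    "AE \<omega> in M. (\<lambda>N. integral {0..T} (\<lambda>t. ((1 / real N) * (\<Sum>i=1..N. X i t \<omega> $ k)) ^ 4)) \<longlonglongrightarrow> 0" for t k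
    by (rule process_law_of_large_numbers[where X = "\<lambda>i t \<omega>. X i t \<omega> $ k" and K = Kf, OF T0(1) Xind Xc X4 X1 XK Kf]; assumption)+
  have YX: "(Y N t \<omega> - integral {0..t} (h \<theta>0)) $ k = (1 / real N) * (\<Sum>i=1..N. X i t \<omega> $ k)"
    if "1 \<le> N" "t \<in> {0..T}" for N t \<omega> k
  proof -
    have "integral {0..t} (\<lambda>s. bvec (Ls \<theta>0) (expectation (\<rho> \<theta>0 i s))) = integral {0..t} (h \<theta>0)" if "i \<in> {1..N}" for i
      using that \<open>t \<in> {0..T}\<close> by (intro integral_cong) (auto simp: h_def vi[OF \<theta>0])
    then have "(\<Sum>i=1..N. integral {0..t} (\<lambda>s. bvec (Ls \<theta>0) (expectation (\<rho> \<theta>0 i s)))) = real N *\<^sub>R integral {0..t} (h \<theta>0)"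
      by (simp only: sum_constant_scaleR card_atLeastAtMost diff_Suc_1 Suc_eq_plus1[symmetric] cong: sum.cong)
    then have "(\<Sum>i=1..N. X i t \<omega>) = (\<Sum>i=1..N. integral {0..t} (\<lambda>s. bvec (Ls \<theta>0) (\<rho> \<theta>0 i s \<omega>)) + W i t \<omega>) - real N *\<^sub>R integral {0..t} (h \<theta>0)"
      by (simp only: X_def sum_subtractf)
    then have "(1 / real N) *\<^sub>R (\<Sum>i=1..N. X i t \<omega>) = Y N t \<omega> - integral {0..t} (h \<theta>0)"
      using that(1) by (simp add: Yeq scaleR_diff_right)
    then have "((1 / real N) *\<^sub>R (\<Sum>i=1..N. X i t \<omega>)) $ k = (Y N t \<omega> - integral {0..t} (h \<theta>0)) $ k" by simp
    then show ?thesis by simp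
  qed
  obtain D where D: "countable D" "D \<subseteq> ?S" "?S \<subseteq> closure D"
    using separable by blast
  have E1: "AE \<omega> in M. \<forall>N. 1 \<le> N \<longrightarrow> (\<forall>\<theta>\<in>D. J N \<theta> \<omega> = h \<theta> T \<bullet> Y N T \<omega> - integral {0..T} (\<lambda>t. h' \<theta> t \<bullet> Y N t \<omega>))"
    unfolding AE_all_countable
  proof
    fix N
    show "AE \<omega> in M. 1 \<le> N \<longrightarrow> (\<forall>\<theta>\<in>D. J N \<theta> \<omega> = h \<theta> T \<bullet> Y N T \<omega> - integral {0..T} (\<lambda>t. h' \<theta> t \<bullet> Y N t \<omega>))"
    proof (cases "1 \<le> N")
      case True
      have "AE \<omega> in M. \<forall>\<theta>\<in>D. J N \<theta> \<omega> = h \<theta> T \<bullet> Y N T \<omega> - integral {0..T} (\<lambda>t. h' \<theta> t \<bullet> Y N t \<omega>)"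
        using parts[OF True] D(2) by (subst AE_ball_countable[OF D(1)]) blast
      then show ?thesis by eventually_elim simp
    qed simp
  qed
  have E2: "AE \<omega> in M. \<forall>N. 1 \<le> N \<longrightarrow> continuous_on ?S (\<lambda>\<theta>. J N \<theta> \<omega>)"
    unfolding AE_all_countable
  proof
    fix N show "AE \<omega> in M. 1 \<le> N \<longrightarrow> continuous_on ?S (\<lambda>\<theta>. J N \<theta> \<omega>)"
      using J_continuous[of N] by (cases "1 \<le> N") auto
  qed
  have E3: "AE \<omega> in M. \<forall>N. 1 \<le> N \<longrightarrow> is_arg_max (contrast M T A L \<rho> J N \<omega>) (\<lambda>\<theta>. \<theta> \<in> ?S) (\<theta>hat N \<omega>)"
    unfolding AE_all_countable
  proof
    fix N show "AE \<omega> in M. 1 \<le> N \<longrightarrow> is_arg_max (contrast M T A L \<rho> J N \<omega>) (\<lambda>\<theta>. \<theta> \<in> ?S) (\<theta>hat N \<omega>)"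
      using estimator_maximizes[of N] by (cases "1 \<le> N") auto
  qed
  have E4: "AE \<omega> in M. \<forall>k. (\<lambda>N. (1 / real N) * (\<Sum>i=1..N. X i T \<omega> $ k)) \<longlonglongrightarrow> 0"
    unfolding AE_all_countable using lln(1)[OF T0(2)] by blast
  have E5: "AE \<omega> in M. \<forall>k. (\<lambda>N. integral {0..T} (\<lambda>t. ((1 / real N) * (\<Sum>i=1..N. X i t \<omega> $ k)) ^ 4)) \<longlonglongrightarrow> 0"
    unfolding AE_all_countable using lln(2) by blast
  show ?thesis
    using E1 E2 E3 E4 E5 AE_space
  proof eventually_elim
    case (elim \<omega>)
    have Yc: "continuous_on {0..T} (\<lambda>t. Y N t \<omega>)" for N
      unfolding Yeq using bounded_linear.continuous_on[OF bounded_linear_bvec \<rho>c[OF \<theta>0]] Wc elim(6)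
      by (intro continuous_on_scaleR continuous_on_const continuous_on_sum continuous_on_add
          indefinite_integral_continuous_1 integrable_continuous_interval) auto
    have chs: "continuous_on {0..T} (h \<theta>0)"
    proof -
      have "continuous_on {0..T} (\<lambda>t. (\<theta>0, t))" by (intro continuous_intros)
      from continuous_on_compose2[OF ch this] show ?thesis using \<theta>0 by auto
    qed
    \<comment> \<open>From the countable dense set to all parameters, by continuity of both sides.\<close>
    have Jeq: "J N \<theta> \<omega> = h \<theta> T \<bullet> Y N T \<omega> - integral {0..T} (\<lambda>t. h' \<theta> t \<bullet> Y N t \<omega>)" if N: "1 \<le> N" and \<theta>: "\<theta> \<in> ?S" for N \<theta>
    proof (rule continuous_on_eq_from_dense[OF _ _ D(2,3) _ \<theta>])
      show "continuous_on ?S (\<lambda>\<theta>. J N \<theta> \<omega>)" using elim(2) N by blast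
      show "J N \<theta> \<omega> = h \<theta> T \<bullet> Y N T \<omega> - integral {0..T} (\<lambda>t. h' \<theta> t \<bullet> Y N t \<omega>)" if "\<theta> \<in> D" for \<theta>
        using elim(1) N that by blast
      have pair: "continuous_on ?S (\<lambda>\<theta>. (\<theta>, T))" by (intro continuous_intros)
      have "continuous_on ?S (\<lambda>\<theta>. h (fst (\<theta>, T)) (snd (\<theta>, T)))"
        by (rule continuous_on_compose2[OF ch pair]) (use T0 in auto)
      then have c1: "continuous_on ?S (\<lambda>\<theta>. h \<theta> T)" by simp
      have "continuous_on (?S \<times> cbox 0 T) (\<lambda>(\<theta>, t). h' \<theta> t \<bullet> Y N t \<omega>)"
        unfolding case_prod_beta'
      proof (rule continuous_on_inner)
        show "continuous_on (?S \<times> cbox 0 T) (\<lambda>z. h' (fst z) (snd z))" using ch' by simp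
        show "continuous_on (?S \<times> cbox 0 T) (\<lambda>z. Y N (snd z) \<omega>)"
          by (rule continuous_on_compose2[OF Yc]) (auto intro!: continuous_intros)
      qed
      then have "continuous_on ?S (\<lambda>\<theta>. integral (cbox 0 T) (\<lambda>t. h' \<theta> t \<bullet> Y N t \<omega>))"
        by (rule integral_continuous_on_param)
      then show "continuous_on ?S (\<lambda>\<theta>. h \<theta> T \<bullet> Y N T \<omega> - integral {0..T} (\<lambda>t. h' \<theta> t \<bullet> Y N t \<omega>))"
        using c1 by (intro continuous_on_diff continuous_on_inner continuous_on_const) auto
    qed
    have lim1: "(\<lambda>N. norm (Y N T \<omega> - integral {0..T} (h \<theta>0))) \<longlonglongrightarrow> 0"
    proof -
      have "(\<lambda>N. (Y N T \<omega> - integral {0..T} (h \<theta>0)) $ k) \<longlonglongrightarrow> 0" for k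
      proof (rule Lim_transform_eventually[OF elim(4)[rule_format]])
        show "\<forall>\<^sub>F N in sequentially. (1 / real N) * (\<Sum>i=1..N. X i T \<omega> $ k) = (Y N T \<omega> - integral {0..T} (h \<theta>0)) $ k"
          using eventually_ge_at_top[of 1] by eventually_elim (simp only: YX T0(2))
      qed
      then have "(\<lambda>N. Y N T \<omega> - integral {0..T} (h \<theta>0)) \<longlonglongrightarrow> 0"
        by (intro vec_tendstoI) simp
      then show ?thesis by (rule tendsto_norm_zero)
    qed
    have lim2: "(\<lambda>N. integral {0..T} (\<lambda>t. norm (Y N t \<omega> - integral {0..t} (h \<theta>0)))) \<longlonglongrightarrow> 0"
    proof (rule integral_norm_tendsto_0_of_fourth_powers[OF T0(1)])
      show "continuous_on {0..T} (\<lambda>t. Y N t \<omega> - integral {0..t} (h \<theta>0))" for N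
        by (intro continuous_on_diff Yc indefinite_integral_continuous_1 integrable_continuous_interval chs)
      show "(\<lambda>N. integral {0..T} (\<lambda>t. ((Y N t \<omega> - integral {0..t} (h \<theta>0)) $ k) ^ 4)) \<longlonglongrightarrow> 0" for k
      proof (rule Lim_transform_eventually[OF elim(5)[rule_format]])
        show "\<forall>\<^sub>F N in sequentially. integral {0..T} (\<lambda>t. ((1 / real N) * (\<Sum>i=1..N. X i t \<omega> $ k)) ^ 4) =
            integral {0..T} (\<lambda>t. ((Y N t \<omega> - integral {0..t} (h \<theta>0)) $ k) ^ 4)"
          using eventually_ge_at_top[of 1] by eventually_elim (intro integral_cong, simp only: YX)
      qed
    qed
    show ?case
    proof (rule contrast_maximizer_consistency[OF S \<theta>0 T ch ch' deriv _ Yc, where \<Phi>N = "\<lambda>N. contrast M T A L \<rho> J N \<omega>"])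
      show "\<exists>t\<in>{0..T}. h \<theta> t \<noteq> h \<theta>0 t" if "\<theta> \<in> ?S" "\<theta> \<noteq> \<theta>0" for \<theta>
        using identifiable[OF that] by (simp add: signal)
      show "(\<lambda>N. norm (Y N T \<omega> - integral {0..T} (h \<theta>0)) +
          integral {0..T} (\<lambda>t. norm (Y N t \<omega> - integral {0..t} (h \<theta>0)))) \<longlonglongrightarrow> 0"
        using tendsto_add[OF lim1 lim2] by simp
      fix N :: nat assume N: "1 \<le> N"
      have am: "is_arg_max (contrast M T A L \<rho> J N \<omega>) (\<lambda>\<theta>. \<theta> \<in> ?S) (\<theta>hat N \<omega>)" using elim(3) N by blast
      then show "\<theta>hat N \<omega> \<in> ?S" by (simp add: is_arg_max_def)
      fix \<theta> assume \<theta>: "\<theta> \<in> ?S"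
      show "contrast M T A L \<rho> J N \<omega> \<theta> \<le> contrast M T A L \<rho> J N \<omega> (\<theta>hat N \<omega>)"
        using am \<theta> by (auto simp: is_arg_max_def not_less)
      show "contrast M T A L \<rho> J N \<omega> \<theta> = h \<theta> T \<bullet> Y N T \<omega> - integral {0..T} (\<lambda>t. h' \<theta> t \<bullet> Y N t \<omega>)
        - (1/2) * integral {0..T} (\<lambda>t. (norm (h \<theta> t))\<^sup>2)"
        using Jeq[OF N \<theta>] by (simp add: contrast_def signal)
    qed
  qed
qed

end
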